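(* Endow $\prod_{k=1}^nC_c^\infty(N_k)$ with the norm of $H=\prod_{k=1}^nL^2(N_k)$. Then: (i) $V:\prod_{k=1}^nC_c^\infty(N_k)\to L^2_\sigma$ is isometric and can therefore be extended to an isometry $\tilde V:H\to L^2_\sigma$. In particular, for all $f\in H$ we have $|\tilde Vf|_\sigma^2=(f,f)_H$. (ii) $Z=\tilde V^{-1}$ on $\tilde V(H)$ (with $Z$ extended as in (iii)). (iii) $Z$ can be extended to a continuous operator on $L^2_\sigma$.
   Context: Let $n\ge 2$, $c_1,\dots,c_n>0$ and $0\le a_1\le a_2\le\dots\le a_n<+\infty$. Let $N_1,\dots,N_n$ be $n$ disjoint copies of $(0,+\infty)$ and let $N=\bigcup_{k=1}^n\overline{N_k}$ with the endpoints $0$ of all branches identified (star-shaped network). A function $f$ on $N$ is identified with the tuple $(f_1,\dots,f_n)$ of its restrictions to the branches, and $\int_N$ denotes the sum of the integrals over the $N_k$, $k=1,\dots,n$. $H=\prod_{k=1}^n L^2(N_k)$ (complex-valued functions) with $(u,v)_H=\sum_k(u_k,v_k)_{L^2(N_k)}$. The complex square root is $\sqrt{re^{i\phi}}=\sqrt r\,e^{i\phi/2}$ for $r>0$, $\phi\in[-\pi,\pi)$. For $\lambda\in\mathbb C$: $\xi_k(\lambda)=\sqrt{(\lambda-a_k)/c_k}$, $s_k(\lambda)=-\dfrac{\sum_{l\ne k}c_l\xi_l(\lambda)}{c_k\xi_k(\lambda)}$. The functions $F_\lambda^{-,j}:N\to\mathbb C$ are given on $\overline{N_k}$ by $F_{\lambda,k}^{-,j}$,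 where $F_{\lambda,j}^{-,j}(x)=\cos(\xi_j(\lambda)x)- i\,s_j(\lambda)\sin(\xi_j(\lambda)x)$ and $F_{\lambda,k}^{-,j}(x)=\exp(- i\xi_k(\lambda)x)$ for $k\ne j$. For real $\lambda$, $w(\lambda)=-i\sum_{j=1}^n c_j\xi_j(\lambda)$. Weights: for $\lambda>a_k$, $\sigma_k(\lambda)=\dfrac{c_k\xi_k(\lambda)}{|w(\lambda)|^2}$. $L^2([a_k,+\infty),\sigma_k)$ is the space of measurable $F:[a_k,+\infty)\to\mathbb C$ with $\int_{a_k}^\infty\sigma_k|F|^2d\lambda<\infty$, with inner product $\int_{a_k}^\infty\sigma_k F\overline G\,d\lambda$. $L^2_\sigma=\prod_{k=1}^nL^2([a_k,+\infty),\sigma_k)$ with $(F,G)_\sigma=\sum_k(F_k,G_k)_{L^2([a_k,+\infty),\sigma_k)}$ and $|F|_\sigma=(F,F)_\sigma^{1/2}$. For $f\in L^1(N,\mathbb C)$, $Vf=((Vf)_1,\dots,(Vf)_n)$ with $(Vf)_k(\lambda)=\int_N f(x)\overline{F_\lambda^{-,k}}(x)\,dx$ for $\lambda\in[a_k,+\infty)$. Fix $\chi\in C^\infty(\mathbb R)$ with $\chi\equiv0$ on $(-\infty,a_n+1)$ and $\chi\equiv1$ on $(a_n+2,+\infty)$. For $G_k\in C^\infty([a_k,+\infty),\mathbb C)$ such that $\chi G_k$ can be extended by zero to an element of the Schwartz space $\mathcal S(\mathbb R)$, $k=1,\dots,n$, define $$Z(G_1,\dots,G_n)(x)=\sum_{k=1}^n\int_{(a_k,+\infty)}\sigma_k(\lambda)G_k(\lambda)F_\lambda^{-,k}(x)\,d\lambda,\qquad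 x\in N.$$
   Formalization: The weight σ_k is taken as c_k ξ_k/(π|w|²) instead of c_k ξ_k/|w|², in L²_σ and in Z: with the printed weight |Vf|_σ² = π(f,f)_H and ZV = π·id (e.g. n=2, c_k=1, a_k=0, where V is the unnormalized Fourier transform on the line). *)

theory Defs
  imports "HOL-Analysis.Analysis"
begin

text \<open>
  A function on the star-shaped network is the tuple of its branch restrictions: a map
  \<open>f :: nat \<Rightarrow> real \<Rightarrow> complex\<close> of which only the values \<open>f k x\<close> with \<open>k \<in> {1..n}\<close> and \<open>0 < x\<close>
  matter.  Likewise an element \<open>F\<close> of \<open>L\<^sup>2_\<sigma>\<close> matters only through \<open>F k \<mu>\<close> with \<open>k \<in> {1..n}\<close>
  and \<open>a k \<le> \<mu>\<close>.  Elements of the Hilbert spaces are represented by functions, and equality in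
  them is equality almost everywhere.
\<close>

type_synonym tuple = "nat \<Rightarrow> real \<Rightarrow> complex"

definition lincomb :: "complex \<Rightarrow> tuple \<Rightarrow> complex \<Rightarrow> tuple \<Rightarrow> tuple" where
  "lincomb \<alpha> f \<beta> g = (\<lambda>k x. \<alpha> * f k x + \<beta> * g k x)"


subsection \<open>Smooth functions and the Schwartz space\<close>

text \<open>
  \<open>D j\<close> is the \<open>j\<close>-th derivative of \<open>f\<close> on \<open>S\<close>; derivatives are taken within \<open>S\<close>, hence
  one-sided at the endpoint of \<open>S = {a..}\<close>.
\<close>
definition derivs_on :: "real set \<Rightarrow> (real \<Rightarrow> 'a::real_normed_vector) \<Rightarrow> (nat \<Rightarrow> real \<Rightarrow> 'a) \<Rightarrow> bool" where
  "derivs_on S f D \<longleftrightarrow> (\<forall>x\<in>S. D 0 x = f x) \<and>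
     (\<forall>j. \<forall>x\<in>S. (D j has_vector_derivative D (Suc j) x) (at x within S))"

definition C_inf_on :: "real set \<Rightarrow> (real \<Rightarrow> 'a::real_normed_vector) \<Rightarrow> bool" where
  "C_inf_on S f \<longleftrightarrow> (\<exists>D. derivs_on S f D)"

definition schwartz :: "(real \<Rightarrow> complex) \<Rightarrow> bool" where
  "schwartz f \<longleftrightarrow> (\<exists>D. derivs_on UNIV f D \<and>
     (\<forall>m j. bounded (range (\<lambda>x. \<bar>x\<bar> ^ m * norm (D j x)))))"

definition test_functions :: "nat \<Rightarrow> tuple set" where
  "test_functions n = {f. \<forall>k\<in>{1..n}. C_inf_on {0<..} (f k) \<and>
     (\<exists>K. compact K \<and> K \<subseteq> {0<..} \<and> (\<forall>x\<in>{0<..} - K. f k x = 0))}"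


subsection \<open>The space \<open>H\<close>\<close>

definition H_space :: "nat \<Rightarrow> tuple set" where
  "H_space n = {f. \<forall>k\<in>{1..n}. f k \<in> borel_measurable (lebesgue_on {0<..}) \<and>
     integrable (lebesgue_on {0<..}) (\<lambda>x. (cmod (f k x))\<^sup>2)}"

definition H_inner :: "nat \<Rightarrow> tuple \<Rightarrow> tuple \<Rightarrow> complex" where
  "H_inner n f g = (\<Sum>k=1..n. LINT x|lebesgue_on {0<..}. f k x * cnj (g k x))"

definition H_norm :: "nat \<Rightarrow> tuple \<Rightarrow> real" where
  "H_norm n f = sqrt (Re (H_inner n f f))"

definition H_eq :: "nat \<Rightarrow> tuple \<Rightarrow> tuple \<Rightarrow> bool" where
  "H_eq n f g \<longleftrightarrow> (\<forall>k\<in>{1..n}. AE x in lebesgue_on {0<..}. f k x = g k x)"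


subsection \<open>Generalized eigenfunctions\<close>

text \<open>The spectral parameter is written \<open>\<mu>\<close>.\<close>

text \<open>
  The branch with arguments in \<open>[-\<pi>, \<pi>)\<close>; it differs from \<open>csqrt\<close> exactly on the negative real
  axis, where it takes the value with negative imaginary part.
\<close>
definition nsqrt :: "complex \<Rightarrow> complex" where
  "nsqrt z = (let \<phi> = (if Arg z = pi then - pi else Arg z) in of_real (sqrt (cmod z)) * cis (\<phi> / 2))"

definition xi :: "(nat \<Rightarrow> real) \<Rightarrow> (nat \<Rightarrow> real) \<Rightarrow> nat \<Rightarrow> complex \<Rightarrow> complex" where
  "xi c a k \<mu> = nsqrt ((\<mu> - of_real (a k)) / of_real (c k))"

definition s_coeff :: "nat \<Rightarrow> (nat \<Rightarrow> real) \<Rightarrow> (nat \<Rightarrow> real) \<Rightarrow> nat \<Rightarrow> complex \<Rightarrow> complex" where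
  "s_coeff n c a k \<mu> =
     - (\<Sum>l\<in>{1..n} - {k}. of_real (c l) * xi c a l \<mu>) / (of_real (c k) * xi c a k \<mu>)"

text \<open>\<open>F_minus n c a j \<mu> k x\<close> is the value of \<open>F\<^sub>\<mu>\<^sup>-\<^sup>,\<^sup>j\<close> at the point \<open>x\<close> of the branch \<open>k\<close>.\<close>
definition F_minus :: "nat \<Rightarrow> (nat \<Rightarrow> real) \<Rightarrow> (nat \<Rightarrow> real) \<Rightarrow> nat \<Rightarrow> complex \<Rightarrow> tuple" where
  "F_minus n c a j \<mu> k x =
     (if k = j
      then cos (xi c a j \<mu> * of_real x) - \<i> * s_coeff n c a j \<mu> * sin (xi c a j \<mu> * of_real x)
      else exp (- \<i> * xi c a k \<mu> * of_real x))"

definition w :: "nat \<Rightarrow> (nat \<Rightarrow> real) \<Rightarrow> (nat \<Rightarrow> real) \<Rightarrow> real \<Rightarrow> complex" where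
  "w n c a \<mu> = - \<i> * (\<Sum>j=1..n. of_real (c j) * xi c a j (of_real \<mu>))"


subsection \<open>The weighted space \<open>L\<^sup>2_\<sigma>\<close>\<close>

text \<open>
  For \<open>\<mu> > a k\<close> the number \<open>xi c a k \<mu>\<close> is a positive real, so \<open>Re\<close> only changes the type.

  The factor \<open>1/\<pi>\<close> normalizes the spectral measure.  With the bare weight
  \<open>c\<^sub>k \<xi>\<^sub>k / |w|\<^sup>2\<close> and the unnormalized \<open>d\<mu>\<close> used below, \<open>V\<close> would multiply squared norms by \<open>\<pi>\<close>:
  for \<open>n = 2\<close>, \<open>c = 1\<close>, \<open>a = 0\<close> it is the Fourier transform on the line without prefactor, and
  \<open>c\<^sub>k \<xi>\<^sub>k / |w|\<^sup>2 d\<mu> = d\<xi> / 2\<close>, so Plancherel gives the factor \<open>1/2 * 2 \<pi>\<close>.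
\<close>
definition sigma :: "nat \<Rightarrow> (nat \<Rightarrow> real) \<Rightarrow> (nat \<Rightarrow> real) \<Rightarrow> nat \<Rightarrow> real \<Rightarrow> real" where
  "sigma n c a k \<mu> = 1 / pi * (c k * Re (xi c a k (of_real \<mu>)) / (cmod (w n c a \<mu>))\<^sup>2)"

definition L2_sigma :: "nat \<Rightarrow> (nat \<Rightarrow> real) \<Rightarrow> (nat \<Rightarrow> real) \<Rightarrow> tuple set" where
  "L2_sigma n c a = {F. \<forall>k\<in>{1..n}. F k \<in> borel_measurable (lebesgue_on {a k..}) \<and>
     integrable (lebesgue_on {a k..}) (\<lambda>\<mu>. sigma n c a k \<mu> * (cmod (F k \<mu>))\<^sup>2)}"

definition sigma_inner :: "nat \<Rightarrow> (nat \<Rightarrow> real) \<Rightarrow> (nat \<Rightarrow> real) \<Rightarrow> tuple \<Rightarrow> tuple \<Rightarrow> complex" where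
  "sigma_inner n c a F G =
     (\<Sum>k=1..n. LINT \<mu>|lebesgue_on {a k..}. of_real (sigma n c a k \<mu>) * F k \<mu> * cnj (G k \<mu>))"

definition sigma_norm :: "nat \<Rightarrow> (nat \<Rightarrow> real) \<Rightarrow> (nat \<Rightarrow> real) \<Rightarrow> tuple \<Rightarrow> real" where
  "sigma_norm n c a F = sqrt (Re (sigma_inner n c a F F))"

text \<open>Since \<open>\<sigma>\<^sub>k > 0\<close> on \<open>(a\<^sub>k, \<infinity>)\<close>, null sets for \<open>\<sigma>\<^sub>k d\<mu>\<close> and for \<open>d\<mu>\<close> coincide.\<close>
definition sigma_eq :: "nat \<Rightarrow> (nat \<Rightarrow> real) \<Rightarrow> tuple \<Rightarrow> tuple \<Rightarrow> bool" where
  "sigma_eq n a F G \<longleftrightarrow> (\<forall>k\<in>{1..n}. AE \<mu> in lebesgue_on {a k..}. F k \<mu> = G k \<mu>)"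


subsection \<open>The transforms\<close>

definition V :: "nat \<Rightarrow> (nat \<Rightarrow> real) \<Rightarrow> (nat \<Rightarrow> real) \<Rightarrow> tuple \<Rightarrow> tuple" where
  "V n c a f k \<mu> =
     (\<Sum>j=1..n. LINT x|lebesgue_on {0<..}. f j x * cnj (F_minus n c a k (of_real \<mu>) j x))"

definition Z_domain :: "nat \<Rightarrow> (nat \<Rightarrow> real) \<Rightarrow> (real \<Rightarrow> real) \<Rightarrow> tuple set" where
  "Z_domain n a chi = {G. \<forall>k\<in>{1..n}. C_inf_on {a k..} (G k) \<and>
     schwartz (\<lambda>\<mu>. if a k \<le> \<mu> then of_real (chi \<mu>) * G k \<mu> else 0)}"

definition Z :: "nat \<Rightarrow> (nat \<Rightarrow> real) \<Rightarrow> (nat \<Rightarrow> real) \<Rightarrow> tuple \<Rightarrow> tuple" where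
  "Z n c a G j x =
     (\<Sum>k=1..n. LINT \<mu>|lebesgue_on {a k<..}.
        of_real (sigma n c a k \<mu>) * G k \<mu> * F_minus n c a k (of_real \<mu>) j x)"


subsection \<open>Operators between spaces of representatives\<close>

text \<open>
  The relation \<open>eq\<close> is equality in the target space.  Linearity up to \<open>eq\<close> together with a norm bound
  makes such a map descend to the spaces of classes.
\<close>
definition linear_op :: "tuple set \<Rightarrow> tuple set \<Rightarrow> (tuple \<Rightarrow> tuple \<Rightarrow> bool) \<Rightarrow> (tuple \<Rightarrow> tuple) \<Rightarrow> bool" where
  "linear_op A B eq T \<longleftrightarrow> (\<forall>f\<in>A. T f \<in> B) \<and>
     (\<forall>f\<in>A. \<forall>g\<in>A. \<forall>\<alpha> \<beta>. eq (T (lincomb \<alpha> f \<beta> g)) (lincomb \<alpha> (T f) \<beta> (T g)))"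

definition linear_isometry ::
  "tuple set \<Rightarrow> (tuple \<Rightarrow> real) \<Rightarrow> tuple set \<Rightarrow> (tuple \<Rightarrow> real) \<Rightarrow> (tuple \<Rightarrow> tuple \<Rightarrow> bool) \<Rightarrow> (tuple \<Rightarrow> tuple) \<Rightarrow> bool"
  where "linear_isometry A normA B normB eq T \<longleftrightarrow>
     linear_op A B eq T \<and> (\<forall>f\<in>A. normB (T f) = normA f)"

definition bounded_op ::
  "tuple set \<Rightarrow> (tuple \<Rightarrow> real) \<Rightarrow> tuple set \<Rightarrow> (tuple \<Rightarrow> real) \<Rightarrow> (tuple \<Rightarrow> tuple \<Rightarrow> bool) \<Rightarrow> (tuple \<Rightarrow> tuple) \<Rightarrow> bool"
  where "bounded_op A normA B normB eq T \<longleftrightarrow>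
     linear_op A B eq T \<and> (\<exists>C. \<forall>f\<in>A. normB (T f) \<le> C * normA f)"

end

theory Submission
  imports
    Defs
    "HOL-Complex_Analysis.Complex_Analysis"
    "HOL-Probability.Probability"
    "HOL-Real_Asymp.Real_Asymp"
begin

text \<open>
  On the real axis the complex conjugate of \<open>\<xi>\<^sub>k\<close> is the boundary value \<open>\<eta>\<^sub>k\<close> of a square root
  that is holomorphic in the upper half plane.  Put \<open>W = \<Sum>\<^sub>j c\<^sub>j \<eta>\<^sub>j\<close>, and for a test function \<open>f\<close> let
  \<open>A = \<Sum>\<^sub>j \<integral> f\<^sub>j(x) exp(i \<eta>\<^sub>j x) dx\<close>, let \<open>S\<close> be the same sum for the conjugate of \<open>f\<close>, and let \<open>B\<^sub>k\<close> be the
  sine transform of \<open>f\<^sub>k\<close> at \<open>\<eta>\<^sub>k\<close>.  Expanding \<open>(V f)\<^sub>k = A - i W B\<^sub>k / (c\<^sub>k \<eta>\<^sub>k)\<close> gives, pointwise in \<open>\<mu>\<close> and with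
  sums over the \<open>k\<close> with \<open>a\<^sub>k < \<mu>\<close>,

    \<open>\<pi> \<Sum>\<^sub>k \<sigma>\<^sub>k |(V f)\<^sub>k|\<^sup>2 = Re (A S / W) + \<Sum>\<^sub>k |B\<^sub>k|\<^sup>2 / (c\<^sub>k \<eta>\<^sub>k)\<close>.

  The first term integrates to \<open>0\<close> over the real line by Cauchy's theorem in the upper half plane, and
  the second one to \<open>\<pi>\<close> times the squared norm of \<open>f\<close> by Plancherel's theorem for the sine transform.

  By Fubini's theorem \<open>Z\<close> is the formal adjoint of \<open>V\<close>.  Hence it is a contraction on the dense subspace
  of those \<open>G\<close> for which all \<open>\<sigma>\<^sub>k G\<^sub>k\<close> are integrable, and its continuous extension is the adjoint of an
  isometry, so a left inverse of it.
\<close>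


subsection \<open>Square integrable tuples\<close>

text \<open>Summation over the active branches is what produces the first term: there the c_k
  \<eta>_k add up to Re W and the B_k to (A - cnj S) / (2i), so the |A|^2 contributions cancel and
  the real part of a holomorphic function survives. The sum of the B_k is accessible because an
  inactive \<eta>_k is imaginary, so that -cnj \<eta>_k = \<eta>_k there.

  The contour argument rests on one geometric fact: all \<eta>_j lie in the closed first quadrant.
  Hence W cannot vanish away from a_1 and |W| grows like |z|^(1/2); A and S each decay like
  |z|^(-1/2), which leaves an integrable singularity at a_1 and decay |z|^(-3/2) at infinity.

  The integrals defining V and Z do not converge on the full spaces, so both operators are first
  controlled on dense subspaces. Both spaces are instances of \<open>L2\<close> with one measure per
  branch, so a single extension argument serves both directions. Density of the test functions needs
  a smooth cut-off, and the given \<open>chi\<close>, shifted and rescaled, provides it.\<close>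

definition L2 :: "nat \<Rightarrow> (nat \<Rightarrow> real measure) \<Rightarrow> tuple set" where
  "L2 n M = {f. \<forall>k\<in>{1..n}. f k \<in> borel_measurable (M k) \<and> integrable (M k) (\<lambda>x. (cmod (f k x))\<^sup>2)}"

definition L2_inner :: "nat \<Rightarrow> (nat \<Rightarrow> real measure) \<Rightarrow> tuple \<Rightarrow> tuple \<Rightarrow> complex" where
  "L2_inner n M f g = (\<Sum>k=1..n. LINT x|M k. f k x * cnj (g k x))"

definition L2_norm :: "nat \<Rightarrow> (nat \<Rightarrow> real measure) \<Rightarrow> tuple \<Rightarrow> real" where
  "L2_norm n M f = sqrt (Re (L2_inner n M f f))"

definition L2_eq :: "nat \<Rightarrow> (nat \<Rightarrow> real measure) \<Rightarrow> tuple \<Rightarrow> tuple \<Rightarrow> bool" where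
  "L2_eq n M f g \<longleftrightarrow> (\<forall>k\<in>{1..n}. AE x in M k. f k x = g k x)"

abbreviation diff :: "tuple \<Rightarrow> tuple \<Rightarrow> tuple" (infixl "\<ominus>" 65) where
  "f \<ominus> g \<equiv> lincomb 1 f (-1) g"

lemma L2D:
  assumes "f \<in> L2 n M" "k \<in> {1..n}"
  shows "f k \<in> borel_measurable (M k)" "integrable (M k) (\<lambda>x. (cmod (f k x))\<^sup>2)"
  using assms by (auto simp: L2_def)

lemma measurable_cnj: "u \<in> borel_measurable N \<Longrightarrow> (\<lambda>x. cnj (u x)) \<in> borel_measurable N"
  by (rule borel_measurable_continuous_on[of cnj]) (intro continuous_intros)

lemma norm_mult_le_squares: "norm (u * v) \<le> (norm u)\<^sup>2 + (norm v)\<^sup>2" for u v :: complex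
proof -
  have "0 \<le> norm u * norm v" by simp
  then show ?thesis
    using sum_squares_bound[of "norm u" "norm v"] unfolding norm_mult mult.assoc by linarith
qed

lemma integrable_L2_mult:
  assumes f: "f \<in> L2 n M" and g: "g \<in> L2 n M" and k: "k \<in> {1..n}"
  shows "integrable (M k) (\<lambda>x. f k x * cnj (g k x))"
proof (rule Bochner_Integration.integrable_bound[OF Bochner_Integration.integrable_add[OF L2D(2)[OF f k] L2D(2)[OF g k]]])
  have "(\<lambda>x. cnj (g k x)) \<in> borel_measurable (M k)"
    by (rule measurable_cnj[OF L2D(1)[OF g k]])
  then show "(\<lambda>x. f k x * cnj (g k x)) \<in> borel_measurable (M k)"
    using L2D(1)[OF f k] by measurable
  show "AE x in M k. norm (f k x * cnj (g k x)) \<le> norm ((cmod (f k x))\<^sup>2 + (cmod (g k x))\<^sup>2)"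
    using norm_mult_le_squares[of "f k _" "cnj (g k _)"] by (intro AE_I2) simp
qed

lemma lincomb_L2:
  assumes f: "f \<in> L2 n M" and g: "g \<in> L2 n M"
  shows "lincomb \<alpha> f \<beta> g \<in> L2 n M"
  unfolding L2_def
proof (intro CollectI ballI conjI)
  fix k assume k: "k \<in> {1..n}"
  note [measurable] = L2D(1)[OF f k] L2D(1)[OF g k]
  show m: "lincomb \<alpha> f \<beta> g k \<in> borel_measurable (M k)"
    unfolding lincomb_def by measurable
  have "integrable (M k) (\<lambda>x. 2 * (cmod \<alpha>)\<^sup>2 * (cmod (f k x))\<^sup>2 + 2 * (cmod \<beta>)\<^sup>2 * (cmod (g k x))\<^sup>2)"
    using L2D(2)[OF f k] L2D(2)[OF g k] by auto
  then show "integrable (M k) (\<lambda>x. (cmod (lincomb \<alpha> f \<beta> g k x))\<^sup>2)"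
  proof (rule Bochner_Integration.integrable_bound)
    show "AE x in M k. norm ((cmod (lincomb \<alpha> f \<beta> g k x))\<^sup>2)
       \<le> norm (2 * (cmod \<alpha>)\<^sup>2 * (cmod (f k x))\<^sup>2 + 2 * (cmod \<beta>)\<^sup>2 * (cmod (g k x))\<^sup>2)"
    proof (rule AE_I2)
      fix x
      have "(cmod (\<alpha> * f k x + \<beta> * g k x))\<^sup>2 \<le> (cmod (\<alpha> * f k x) + cmod (\<beta> * g k x))\<^sup>2"
        by (intro power_mono norm_triangle_ineq) auto
      also have "\<dots> \<le> 2 * (cmod (\<alpha> * f k x))\<^sup>2 + 2 * (cmod (\<beta> * g k x))\<^sup>2"
        using sum_squares_bound[of "cmod (\<alpha> * f k x)" "cmod (\<beta> * g k x)"] by (simp add: power2_sum)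
      finally show "norm ((cmod (lincomb \<alpha> f \<beta> g k x))\<^sup>2)
       \<le> norm (2 * (cmod \<alpha>)\<^sup>2 * (cmod (f k x))\<^sup>2 + 2 * (cmod \<beta>)\<^sup>2 * (cmod (g k x))\<^sup>2)"
        by (simp add: lincomb_def norm_mult power_mult_distrib mult.assoc)
    qed
  qed (use m in measurable)
qed

lemma L2_inner_lincomb:
  assumes f: "f \<in> L2 n M" and g: "g \<in> L2 n M" and h: "h \<in> L2 n M"
  shows "L2_inner n M (lincomb \<alpha> f \<beta> g) h = \<alpha> * L2_inner n M f h + \<beta> * L2_inner n M g h"
proof -
  have "(LINT x|M k. lincomb \<alpha> f \<beta> g k x * cnj (h k x)) =
      \<alpha> * (LINT x|M k. f k x * cnj (h k x)) + \<beta> * (LINT x|M k. g k x * cnj (h k x))"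
    if k: "k \<in> {1..n}" for k
    using integrable_L2_mult[OF f h k] integrable_L2_mult[OF g h k]
    by (simp add: lincomb_def distrib_right mult.assoc)
  then show ?thesis
    by (simp add: L2_inner_def sum.distrib sum_distrib_left)
qed

lemma L2_inner_cnj: "cnj (L2_inner n M f g) = L2_inner n M g f"
  unfolding L2_inner_def cnj_sum Bochner_Integration.integral_cnj[symmetric]
  by (simp add: mult.commute)

lemma L2_inner_self: "L2_inner n M f f = of_real (\<Sum>k=1..n. LINT x|M k. (cmod (f k x))\<^sup>2)"
  unfolding L2_inner_def of_real_sum integral_complex_of_real[symmetric]
  by (simp only: complex_norm_square)

lemma L2_norm_square: "(L2_norm n M f)\<^sup>2 = (\<Sum>k=1..n. LINT x|M k. (cmod (f k x))\<^sup>2)"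
  by (simp add: L2_norm_def L2_inner_self sum_nonneg)

lemma L2_inner_self_norm: "L2_inner n M f f = of_real ((L2_norm n M f)\<^sup>2)"
  by (simp only: L2_norm_square L2_inner_self)

lemma L2_norm_nonneg [simp]: "0 \<le> L2_norm n M f"
  by (simp add: L2_norm_def L2_inner_self sum_nonneg)

section \<open>Cauchy-Schwarz and triangle inequalities\<close>

lemma mult_bound_from_weighted:
  fixes p u v :: real
  assumes uv: "0 \<le> u" "0 \<le> v" and p: "\<And>t. 0 < t \<Longrightarrow> 2 * p \<le> t * u\<^sup>2 + v\<^sup>2 / t"
  shows "p \<le> u * v"
proof (cases "u = 0 \<or> v = 0")
  case False
  then have "2 * p \<le> v / u * u\<^sup>2 + v\<^sup>2 / (v / u)" using uv by (intro p) auto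
  also have "\<dots> = 2 * (u * v)" using False by (simp add: power2_eq_square)
  finally show ?thesis by simp
next
  case True
  \<comment> \<open>The weights (v^2 + 1) / e and e / (u^2 + 1) leave at most e; the added 1
    excludes degenerate weights.\<close>
  have "p \<le> e" if e: "0 < e" for e
  proof (cases "u = 0")
    case True
    have "2 * p \<le> v\<^sup>2 / ((v\<^sup>2 + 1) / e)"
      using p[of "(v\<^sup>2 + 1) / e"] e True by (simp add: add_nonneg_pos)
    also have "\<dots> = e * (v\<^sup>2 / (v\<^sup>2 + 1))" by simp
    also have "\<dots> \<le> e * 1" using e by (intro mult_left_mono) (auto simp: divide_le_eq add_nonneg_pos)
    finally show ?thesis using e by simp
  next
    case False
    then have "v = 0" using \<open>u = 0 \<or> v = 0\<close> by simp
    then have "2 * p \<le> e / (u\<^sup>2 + 1) * u\<^sup>2"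
      using p[of "e / (u\<^sup>2 + 1)"] e by (simp add: add_nonneg_pos)
    also have "\<dots> = e * (u\<^sup>2 / (u\<^sup>2 + 1))" by simp
    also have "\<dots> \<le> e * 1" using e by (intro mult_left_mono) (auto simp: divide_le_eq add_nonneg_pos)
    finally show ?thesis using e by simp
  qed
  then have "p \<le> 0" using field_le_epsilon[of p 0] by simp
  then show ?thesis using True by auto
qed

text \<open>Unlike the product of norms, the weighted inequality 2 |u v| \<le> t |u|^2 + |v|^2 / t
  passes through the integral and the sum over branches with the same t, which is optimized only at
  the end.\<close>

lemma L2_Cauchy_Schwarz:
  assumes f: "f \<in> L2 n M" and g: "g \<in> L2 n M"
  shows "cmod (L2_inner n M f g) \<le> L2_norm n M f * L2_norm n M g"
proof (rule mult_bound_from_weighted)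
  fix t :: real assume t: "0 < t"
  have pt: "2 * norm (u * cnj v) \<le> t * (norm u)\<^sup>2 + (norm v)\<^sup>2 / t" for u v :: complex
  proof -
    have "0 \<le> (t * norm u - norm v)\<^sup>2 / t" using t by simp
    also have "\<dots> = t * (norm u)\<^sup>2 + (norm v)\<^sup>2 / t - 2 * norm u * norm v"
      using t by (simp add: power2_eq_square field_simps)
    finally show ?thesis by (simp add: norm_mult)
  qed
  have "2 * cmod (L2_inner n M f g) \<le> (\<Sum>k=1..n. 2 * norm (LINT x|M k. f k x * cnj (g k x)))"
    unfolding L2_inner_def by (simp add: norm_sum flip: sum_distrib_left)
  also have "\<dots> \<le> (\<Sum>k=1..n. t * (LINT x|M k. (cmod (f k x))\<^sup>2) + (LINT x|M k. (cmod (g k x))\<^sup>2) / t)"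
  proof (rule sum_mono)
    fix k assume k: "k \<in> {1..n}"
    note i = L2D(2)[OF f k] L2D(2)[OF g k]
    have "2 * norm (LINT x|M k. f k x * cnj (g k x)) \<le> 2 * (LINT x|M k. norm (f k x * cnj (g k x)))"
      by simp
    also have "\<dots> = (LINT x|M k. 2 * norm (f k x * cnj (g k x)))" by simp
    also have "\<dots> \<le> (LINT x|M k. t * (cmod (f k x))\<^sup>2 + (cmod (g k x))\<^sup>2 / t)"
      using i integrable_L2_mult[OF f g k] by (intro integral_mono pt) auto
    also have "\<dots> = t * (LINT x|M k. (cmod (f k x))\<^sup>2) + (LINT x|M k. (cmod (g k x))\<^sup>2) / t"
      using i by simp
    finally show "2 * norm (LINT x|M k. f k x * cnj (g k x))
      \<le> t * (LINT x|M k. (cmod (f k x))\<^sup>2) + (LINT x|M k. (cmod (g k x))\<^sup>2) / t" .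
  qed
  also have "\<dots> = t * (L2_norm n M f)\<^sup>2 + (L2_norm n M g)\<^sup>2 / t"
    by (simp add: L2_norm_square sum.distrib sum_distrib_left sum_divide_distrib)
  finally show "2 * cmod (L2_inner n M f g) \<le> t * (L2_norm n M f)\<^sup>2 + (L2_norm n M g)\<^sup>2 / t" .
qed auto

lemma L2_norm_lincomb_square:
  assumes f: "f \<in> L2 n M" and g: "g \<in> L2 n M"
  shows "(L2_norm n M (lincomb \<alpha> f \<beta> g))\<^sup>2 = (cmod \<alpha> * L2_norm n M f)\<^sup>2 +
     2 * Re (\<alpha> * cnj \<beta> * L2_inner n M f g) + (cmod \<beta> * L2_norm n M g)\<^sup>2"
proof -
  let ?I = "L2_inner n M"
  have right: "?I h (lincomb \<alpha> f \<beta> g) = cnj \<alpha> * ?I h f + cnj \<beta> * ?I h g" if "h \<in> L2 n M" for h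
    using arg_cong[OF L2_inner_lincomb[OF f g that], of cnj] by (simp add: L2_inner_cnj)
  have "complex_of_real ((L2_norm n M (lincomb \<alpha> f \<beta> g))\<^sup>2) =
     \<alpha> * cnj \<alpha> * ?I f f + (\<alpha> * cnj \<beta> * ?I f g + cnj (\<alpha> * cnj \<beta> * ?I f g)) + \<beta> * cnj \<beta> * ?I g g"
    unfolding L2_inner_self_norm[symmetric]
    by (simp add: L2_inner_lincomb[OF f g lincomb_L2[OF f g]] right[OF f] right[OF g] L2_inner_cnj algebra_simps)
  also have "\<dots> = of_real ((cmod \<alpha> * L2_norm n M f)\<^sup>2 +
     2 * Re (\<alpha> * cnj \<beta> * ?I f g) + (cmod \<beta> * L2_norm n M g)\<^sup>2)"
    unfolding complex_add_cnj complex_norm_square[symmetric] L2_inner_self_norm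
    by (simp only: of_real_mult of_real_add of_real_power power_mult_distrib)
  finally show ?thesis by (simp only: of_real_eq_iff)
qed

lemma L2_norm_lincomb_le:
  assumes f: "f \<in> L2 n M" and g: "g \<in> L2 n M"
  shows "L2_norm n M (lincomb \<alpha> f \<beta> g) \<le> cmod \<alpha> * L2_norm n M f + cmod \<beta> * L2_norm n M g"
proof (rule power2_le_imp_le)
  have "Re (\<alpha> * cnj \<beta> * L2_inner n M f g) \<le> cmod (\<alpha> * cnj \<beta> * L2_inner n M f g)"
    by (rule complex_Re_le_cmod)
  also have "\<dots> \<le> cmod \<alpha> * cmod \<beta> * (L2_norm n M f * L2_norm n M g)"
    unfolding norm_mult by (intro mult_mono L2_Cauchy_Schwarz f g) auto
  finally have "Re (\<alpha> * cnj \<beta> * L2_inner n M f g)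
      \<le> (cmod \<alpha> * L2_norm n M f) * (cmod \<beta> * L2_norm n M g)"
    by (simp only: mult_ac)
  moreover have "x\<^sup>2 + 2 * R + y\<^sup>2 \<le> (x + y)\<^sup>2" if "R \<le> x * y" for R x y :: real
    using that by (simp add: power2_sum)
  ultimately show "(L2_norm n M (lincomb \<alpha> f \<beta> g))\<^sup>2
      \<le> (cmod \<alpha> * L2_norm n M f + cmod \<beta> * L2_norm n M g)\<^sup>2"
    unfolding L2_norm_lincomb_square[OF f g] by blast
qed auto

lemma L2_norm_triangle:
  assumes "f \<in> L2 n M" "g \<in> L2 n M" "h \<in> L2 n M"
  shows "L2_norm n M (f \<ominus> h) \<le> L2_norm n M (f \<ominus> g) + L2_norm n M (g \<ominus> h)"
proof -
  have "f \<ominus> h = lincomb 1 (f \<ominus> g) 1 (g \<ominus> h)" by (simp add: lincomb_def)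
  then show ?thesis
    using L2_norm_lincomb_le[OF lincomb_L2[OF assms(1,2), where \<alpha>=1 and \<beta>="-1"]
        lincomb_L2[OF assms(2,3), where \<alpha>=1 and \<beta>="-1"], where \<alpha>=1 and \<beta>=1] by simp
qed

lemma L2_norm_diff_commute: "L2_norm n M (f \<ominus> g) = L2_norm n M (g \<ominus> f)"
proof -
  have "(L2_norm n M (f \<ominus> g))\<^sup>2 = (L2_norm n M (g \<ominus> f))\<^sup>2"
    unfolding L2_norm_square by (simp add: lincomb_def norm_minus_commute)
  then show ?thesis by (simp add: power2_eq_iff_nonneg)
qed

lemma L2_norm_triangle':
  assumes "f \<in> L2 n M" "g \<in> L2 n M"
  shows "L2_norm n M f \<le> L2_norm n M (f \<ominus> g) + L2_norm n M g"
proof -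
  have "f = lincomb 1 (f \<ominus> g) 1 g" by (simp add: lincomb_def)
  then show ?thesis
    using L2_norm_lincomb_le[OF lincomb_L2[OF assms, where \<alpha>=1 and \<beta>="-1"] assms(2),
        where \<alpha>=1 and \<beta>=1] by simp
qed

lemma L2_norm_cong:
  assumes "L2_eq n M f g" "f \<in> L2 n M" "g \<in> L2 n M"
  shows "L2_norm n M f = L2_norm n M g"
proof -
  have "(LINT x|M k. (cmod (f k x))\<^sup>2) = (LINT x|M k. (cmod (g k x))\<^sup>2)" if k: "k \<in> {1..n}" for k
  proof (rule integral_cong_AE)
    have "AE x in M k. f k x = g k x" using assms(1) k by (simp add: L2_eq_def)
    then show "AE x in M k. (cmod (f k x))\<^sup>2 = (cmod (g k x))\<^sup>2" by eventually_elim simp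
  qed (use L2D(2)[OF assms(2) k] L2D(2)[OF assms(3) k] in auto)
  then have "(L2_norm n M f)\<^sup>2 = (L2_norm n M g)\<^sup>2" by (simp add: L2_norm_square)
  then show ?thesis by (simp add: power2_eq_iff_nonneg)
qed

lemma L2_norm_0_imp_eq:
  assumes f: "f \<in> L2 n M" and g: "g \<in> L2 n M" and 0: "L2_norm n M (f \<ominus> g) = 0"
  shows "L2_eq n M f g"
  unfolding L2_eq_def
proof
  fix k assume k: "k \<in> {1..n}"
  have "(\<Sum>k=1..n. LINT x|M k. (cmod ((f \<ominus> g) k x))\<^sup>2) = 0"
    using 0 L2_norm_square[of n M "f \<ominus> g"] by simp
  then have "(LINT x|M k. (cmod ((f \<ominus> g) k x))\<^sup>2) = 0"
    using k by (subst (asm) sum_nonneg_eq_0_iff) auto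
  then have "AE x in M k. (cmod ((f \<ominus> g) k x))\<^sup>2 = 0"
    using integral_nonneg_eq_0_iff_AE[OF L2D(2)[OF lincomb_L2[OF f g] k]] by simp
  then show "AE x in M k. f k x = g k x" by eventually_elim (simp add: lincomb_def)
qed

lemma L2_eq_lincomb:
  assumes "L2_eq n M f f'" "L2_eq n M g g'"
  shows "L2_eq n M (lincomb \<alpha> f \<beta> g) (lincomb \<alpha> f' \<beta> g')"
  unfolding L2_eq_def
proof
  fix k assume "k \<in> {1..n}"
  then have "AE x in M k. f k x = f' k x" "AE x in M k. g k x = g' k x"
    using assms by (auto simp: L2_eq_def)
  then show "AE x in M k. lincomb \<alpha> f \<beta> g k x = lincomb \<alpha> f' \<beta> g' k x"
    by eventually_elim (simp add: lincomb_def)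
qed

section \<open>Completeness and truncation\<close>

text \<open>
  The increments are dominated by \<open>2\<^sup>-\<^sup>m sqrt T\<close> with \<open>T\<close> the sum of the \<open>4\<^sup>m |u\<^sub>m\<^sub>+\<^sub>1 - u\<^sub>m|\<^sup>2\<close>, which is integrable.
\<close>
lemma mean_square_limit:
  fixes u :: "nat \<Rightarrow> 'a \<Rightarrow> complex"
  assumes u [measurable]: "\<And>m. u m \<in> borel_measurable N"
    and int: "\<And>m. integrable N (\<lambda>x. (cmod (u (Suc m) x - u m x))\<^sup>2)"
    and small: "\<And>m. (LINT x|N. (cmod (u (Suc m) x - u m x))\<^sup>2) \<le> 1 / 8 ^ m"
  obtains v where "v \<in> borel_measurable N" "\<And>m. integrable N (\<lambda>x. (cmod (v x - u m x))\<^sup>2)"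
    "(\<lambda>m. LINT x|N. (cmod (v x - u m x))\<^sup>2) \<longlonglongrightarrow> 0"
proof -
  let ?d = "\<lambda>m x. (cmod (u (Suc m) x - u m x))\<^sup>2"
  let ?S = "\<lambda>x. \<Sum>m. ennreal (4 ^ m * ?d m x)"
  \<comment> \<open>Where the series diverges \<open>enn2real\<close> returns 0, a value without
    meaning; \<open>AET\<close> confines this to a null set.\<close>
  define T where "T x = enn2real (?S x)" for x
  have "(\<integral>\<^sup>+x. ?S x \<partial>N) = (\<Sum>m. \<integral>\<^sup>+x. ennreal (4 ^ m * ?d m x) \<partial>N)"
    by (rule nn_integral_suminf) measurable
  also have "\<dots> \<le> (\<Sum>m. ennreal ((1 / 2) ^ m))"
  proof (rule suminf_le)
    fix m
    have "(\<integral>\<^sup>+x. ennreal (4 ^ m * ?d m x) \<partial>N) = ennreal (4 ^ m * (LINT x|N. ?d m x))"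
      using int[of m] by (subst nn_integral_eq_integral) auto
    also have "\<dots> \<le> ennreal ((1 / 2) ^ m)"
    proof (rule ennreal_leI)
      \<comment> \<open>The rate 8^-m makes both uses geometric: the weight 4^m leaves the summable
        2^-m here and gives pointwise increments of order 2^-m below.\<close>
      have "4 ^ m * (LINT x|N. ?d m x) \<le> 4 ^ m * (1 / 8 ^ m)"
        by (intro mult_left_mono small) simp
      also have "\<dots> = (1 / 2) ^ m" by (simp add: power_mult_distrib[symmetric] flip: power_divide)
      finally show "4 ^ m * (LINT x|N. ?d m x) \<le> (1 / 2) ^ m" .
    qed
    finally show "(\<integral>\<^sup>+x. ennreal (4 ^ m * ?d m x) \<partial>N) \<le> ennreal ((1 / 2) ^ m)" .
  qed auto
  also have "\<dots> = ennreal (\<Sum>m. (1 / 2) ^ m)"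
    by (intro suminf_ennreal2) (auto intro: summable_geometric)
  finally have fin: "(\<integral>\<^sup>+x. ?S x \<partial>N) < \<infinity>"
    by (rule le_less_trans) simp
  have "AE x in N. ?S x \<noteq> \<infinity>"
  proof (rule nn_integral_PInf_AE)
    show "(\<integral>\<^sup>+x. ?S x \<partial>N) \<noteq> \<infinity>" using fin by simp
  qed measurable
  then have AET: "AE x in N. ennreal (T x) = ?S x"
    by eventually_elim (simp add: T_def ennreal_enn2real_if)
  have Tm [measurable]: "T \<in> borel_measurable N" unfolding T_def by measurable
  have T0: "0 \<le> T x" for x by (simp add: T_def)
  have Tint: "integrable N T"
  proof (rule integrableI_nonneg[OF Tm])
    have "(\<integral>\<^sup>+x. ennreal (T x) \<partial>N) = (\<integral>\<^sup>+x. ?S x \<partial>N)"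
      by (rule nn_integral_cong_AE[OF AET])
    then show "(\<integral>\<^sup>+x. ennreal (T x) \<partial>N) < \<infinity>" using fin by simp
  qed (use T0 in auto)
  \<comment> \<open>\<open>lim\<close> is total and measurable, so no exceptional set enters the
    definition; it is the genuine limit wherever \<open>AET\<close> holds.\<close>
  define v where "v x = lim (\<lambda>m. u m x)" for x
  have vm [measurable]: "v \<in> borel_measurable N" unfolding v_def by measurable
  have bound: "AE x in N. \<forall>m. cmod (v x - u m x) \<le> 2 * (1 / 2) ^ m * sqrt (T x)"
    using AET
  proof eventually_elim
    case (elim x)
    have step: "cmod (u (Suc m) x - u m x) \<le> (1 / 2) ^ m * sqrt (T x)" for m
    proof (rule power2_le_imp_le)
      have "ennreal (4 ^ m * ?d m x) \<le> ?S x"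
      proof -
        have "sum (\<lambda>m. ennreal (4 ^ m * ?d m x)) {m} \<le> ?S x"
          by (rule sum_le_suminf) (rule summableI, simp, simp)
        then show ?thesis by (simp only: sum.insert sum.empty finite.emptyI empty_iff not_False_eq_True add_0_right)
      qed
      then have "4 ^ m * ?d m x \<le> T x"
        unfolding elim[symmetric] by (simp only: ennreal_le_iff[OF T0])
      then have "?d m x \<le> (1 / 4) ^ m * T x" by (simp add: power_divide field_simps)
      also have "(1 / 4 :: real) ^ m = ((1 / 2) ^ m)\<^sup>2"
        by (simp only: power2_eq_square power_mult_distrib[symmetric]) simp
      finally show "?d m x \<le> ((1 / 2) ^ m * sqrt (T x))\<^sup>2" by (simp add: power_mult_distrib T0)
    qed (simp add: T0)
    \<comment> \<open>The remainder 2 * 2^-(m+j) is kept so that the induction closes: one step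
      costs 2^-(m+j), exactly the drop of the remainder.\<close>
    have tele: "cmod (u (m + j) x - u m x) \<le> (2 * (1 / 2) ^ m - 2 * (1 / 2) ^ (m + j)) * sqrt (T x)" for m j
    proof (induction j)
      case (Suc j)
      have "cmod (u (m + Suc j) x - u m x) \<le> cmod (u (Suc (m + j)) x - u (m + j) x) + cmod (u (m + j) x - u m x)"
        using norm_triangle_ineq[of "u (Suc (m + j)) x - u (m + j) x" "u (m + j) x - u m x"] by simp
      also have "\<dots> \<le> (1 / 2) ^ (m + j) * sqrt (T x) + (2 * (1 / 2) ^ m - 2 * (1 / 2) ^ (m + j)) * sqrt (T x)"
        by (intro add_mono step Suc)
      also have "\<dots> = (2 * (1 / 2) ^ m - 2 * (1 / 2) ^ (m + Suc j)) * sqrt (T x)"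
        by (simp add: algebra_simps)
      finally show ?case .
    qed simp
    have tail: "cmod (u (m + j) x - u m x) \<le> 2 * (1 / 2) ^ m * sqrt (T x)" for m j
      by (rule order_trans[OF tele]) (auto intro!: mult_right_mono simp: T0)
    have "Cauchy (\<lambda>m. u m x)"
    proof (rule CauchyI)
      fix e :: real assume e: "0 < e"
      have "(\<lambda>m. 2 * (1 / 2) ^ m * sqrt (T x)) \<longlonglongrightarrow> 2 * 0 * sqrt (T x)"
        by (intro tendsto_intros LIMSEQ_power_zero) auto
      then have "\<forall>\<^sub>F m in sequentially. 2 * (1 / 2) ^ m * sqrt (T x) < e / 2"
        using e by (intro order_tendstoD(2)) auto
      then obtain m0 where m0: "2 * (1 / 2) ^ m0 * sqrt (T x) < e / 2"
        by (auto simp: eventually_sequentially)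
      have near: "cmod (u m x - u m0 x) < e / 2" if "m0 \<le> m" for m
        using tail[of m0 "m - m0"] m0 that by simp
      show "\<exists>M. \<forall>m\<ge>M. \<forall>k\<ge>M. cmod (u m x - u k x) < e"
      proof (intro exI allI impI)
        fix m k assume "m0 \<le> m" "m0 \<le> k"
        from near[OF this(1)] near[OF this(2)] show "cmod (u m x - u k x) < e"
          using norm_triangle_ineq4[of "u m x - u m0 x" "u k x - u m0 x"] by simp
      qed
    qed
    then have lim: "(\<lambda>m. u m x) \<longlonglongrightarrow> v x"
      unfolding v_def using Cauchy_convergent convergent_LIMSEQ_iff by blast
    show ?case
    proof
      fix m
      have "(\<lambda>j. cmod (u (j + m) x - u m x)) \<longlonglongrightarrow> cmod (v x - u m x)"
        by (intro tendsto_intros LIMSEQ_ignore_initial_segment lim)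
      then show "cmod (v x - u m x) \<le> 2 * (1 / 2) ^ m * sqrt (T x)"
        by (rule tendsto_upperbound) (use tail[of m] in \<open>auto simp: add.commute\<close>)
    qed
  qed
  have bound2: "AE x in N. (cmod (v x - u m x))\<^sup>2 \<le> 4 * (1 / 4) ^ m * T x" for m
    using bound
  proof eventually_elim
    case (elim x)
    then have "(cmod (v x - u m x))\<^sup>2 \<le> (2 * (1 / 2) ^ m * sqrt (T x))\<^sup>2"
      by (intro power_mono) auto
    also have "\<dots> = 4 * ((1 / 2) ^ m)\<^sup>2 * T x" by (simp add: power_mult_distrib T0)
    also have "((1 / 2 :: real) ^ m)\<^sup>2 = (1 / 4) ^ m"
      by (simp only: power2_eq_square power_mult_distrib[symmetric]) simp
    finally show ?case .
  qed
  have i: "integrable N (\<lambda>x. (cmod (v x - u m x))\<^sup>2)" for m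
    by (rule Bochner_Integration.integrable_bound[OF integrable_mult_right[OF Tint, of "4 * (1 / 4) ^ m"]])
       (use bound2[of m] T0 in \<open>auto elim!: eventually_mono\<close>)
  have "(\<lambda>m. LINT x|N. (cmod (v x - u m x))\<^sup>2) \<longlonglongrightarrow> 0"
  proof (rule real_tendsto_sandwich[of "\<lambda>_. 0" _ _ "\<lambda>m. 4 * (1 / 4) ^ m * (LINT x|N. T x)"])
    show "\<forall>\<^sub>F m in sequentially. (LINT x|N. (cmod (v x - u m x))\<^sup>2) \<le> 4 * (1 / 4) ^ m * (LINT x|N. T x)"
    proof (rule always_eventually, rule allI)
      fix m
      have "(LINT x|N. (cmod (v x - u m x))\<^sup>2) \<le> (LINT x|N. 4 * (1 / 4) ^ m * T x)"
        by (rule integral_mono_AE[OF i integrable_mult_right[OF Tint] bound2])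
      then show "(LINT x|N. (cmod (v x - u m x))\<^sup>2) \<le> 4 * (1 / 4) ^ m * (LINT x|N. T x)" by simp
    qed
    have "(\<lambda>m. 4 * (1 / 4) ^ m * (LINT x|N. T x)) \<longlonglongrightarrow> 4 * 0 * (LINT x|N. T x)"
      by (intro tendsto_intros LIMSEQ_power_zero) auto
    then show "(\<lambda>m. 4 * (1 / 4) ^ m * (LINT x|N. T x)) \<longlonglongrightarrow> 0" by simp
  qed auto
  with vm i show ?thesis by (rule that)
qed

text \<open>The prescribed rate spares a passage to subsequences: the approximants are chosen to
  converge this fast. Each branch has its own limit, and the tuple is assembled by one choice per
  branch.\<close>

lemma L2_limit:
  assumes F: "\<And>m. F m \<in> L2 n M"
    and small: "\<And>m. (L2_norm n M (F (Suc m) \<ominus> F m))\<^sup>2 \<le> 1 / 8 ^ m"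
  obtains G where "G \<in> L2 n M" "(\<lambda>m. L2_norm n M (G \<ominus> F m)) \<longlonglongrightarrow> 0"
proof -
  let ?P = "\<lambda>k v. v \<in> borel_measurable (M k) \<and> (\<forall>m. integrable (M k) (\<lambda>x. (cmod (v x - F m k x))\<^sup>2)) \<and>
      (\<lambda>m. LINT x|M k. (cmod (v x - F m k x))\<^sup>2) \<longlonglongrightarrow> 0"
  define G where "G k = (SOME v. ?P k v)" for k
  have "\<exists>v. ?P k v" if k: "k \<in> {1..n}" for k
  proof -
    have "(LINT x|M k. (cmod (F (Suc m) k x - F m k x))\<^sup>2) \<le> (L2_norm n M (F (Suc m) \<ominus> F m))\<^sup>2" for m
    proof -
      have "(LINT x|M k. (cmod ((F (Suc m) \<ominus> F m) k x))\<^sup>2) \<le> (L2_norm n M (F (Suc m) \<ominus> F m))\<^sup>2"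
        unfolding L2_norm_square using k by (intro member_le_sum) auto
      then show ?thesis by (simp add: lincomb_def)
    qed
    then have s: "(LINT x|M k. (cmod (F (Suc m) k x - F m k x))\<^sup>2) \<le> 1 / 8 ^ m" for m
      using small order_trans by blast
    have i: "integrable (M k) (\<lambda>x. (cmod (F (Suc m) k x - F m k x))\<^sup>2)" for m
      using L2D(2)[OF lincomb_L2[OF F[of "Suc m"] F[of m], where \<alpha>=1 and \<beta>="-1"] k]
      by (simp add: lincomb_def)
    obtain v where "v \<in> borel_measurable (M k)" "\<And>m. integrable (M k) (\<lambda>x. (cmod (v x - F m k x))\<^sup>2)"
      "(\<lambda>m. LINT x|M k. (cmod (v x - F m k x))\<^sup>2) \<longlonglongrightarrow> 0"
      using mean_square_limit[of "\<lambda>m. F m k" "M k", OF L2D(1)[OF F k] i s] by blast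
    then show ?thesis by blast
  qed
  then have "?P k (G k)" if "k \<in> {1..n}" for k
    unfolding G_def by (rule someI_ex) (rule that)
  then have G: "\<And>k. k \<in> {1..n} \<Longrightarrow> G k \<in> borel_measurable (M k)"
    "\<And>k m. k \<in> {1..n} \<Longrightarrow> integrable (M k) (\<lambda>x. (cmod (G k x - F m k x))\<^sup>2)"
    "\<And>k. k \<in> {1..n} \<Longrightarrow> (\<lambda>m. LINT x|M k. (cmod (G k x - F m k x))\<^sup>2) \<longlonglongrightarrow> 0"
    by blast+
  have GF: "G \<ominus> F m \<in> L2 n M" for m
    unfolding L2_def
  proof (intro CollectI ballI conjI)
    fix k assume k: "k \<in> {1..n}"
    note [measurable] = G(1)[OF k] L2D(1)[OF F k]
    show "(G \<ominus> F m) k \<in> borel_measurable (M k)" unfolding lincomb_def by measurable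
    show "integrable (M k) (\<lambda>x. (cmod ((G \<ominus> F m) k x))\<^sup>2)"
      using G(2)[OF k] by (simp add: lincomb_def)
  qed
  have "G = lincomb 1 (G \<ominus> F 0) 1 (F 0)" by (simp add: lincomb_def)
  then have GL: "G \<in> L2 n M" using lincomb_L2[OF GF[of 0] F[of 0], where \<alpha>=1 and \<beta>=1] by simp
  have "(\<lambda>m. (L2_norm n M (G \<ominus> F m))\<^sup>2) \<longlonglongrightarrow> (\<Sum>k=1..n. 0)"
    unfolding L2_norm_square using G(3) by (intro tendsto_sum) (simp add: lincomb_def)
  then have "(\<lambda>m. sqrt ((L2_norm n M (G \<ominus> F m))\<^sup>2)) \<longlonglongrightarrow> sqrt 0"
    by (intro tendsto_real_sqrt) simp
  then show ?thesis using that[OF GL] by simp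
qed


text \<open>The error is pointwise either 0 or \<open>G\<close> itself, so |G|^2 dominates and the
  error vanishes in mean square. The alternative \<open>G k x = 0\<close> in \<open>ev\<close>
  admits cut-offs that never include the zeros of \<open>G\<close>, such as a lower bound on
  |G|.\<close>

lemma L2_truncation:
  assumes G: "G \<in> L2 n M" and e: "0 < e"
    and meas: "\<And>m k. k \<in> {1..n} \<Longrightarrow> Measurable.pred (M k) (P m k)"
    and ev: "\<And>k x. k \<in> {1..n} \<Longrightarrow> x \<in> space (M k) \<Longrightarrow> \<forall>\<^sub>F m in sequentially. P m k x \<or> G k x = 0"
  defines "t \<equiv> \<lambda>m k x. if P m k x then G k x else 0"
  shows "t m \<in> L2 n M" and "\<exists>m. L2_norm n M (G \<ominus> t m) < e"
proof -
  show tL: "t m \<in> L2 n M" for m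
    unfolding L2_def
  proof (intro CollectI ballI conjI)
    fix k assume k: "k \<in> {1..n}"
    note [measurable] = L2D(1)[OF G k] meas[OF k]
    show tm [measurable]: "t m k \<in> borel_measurable (M k)" unfolding t_def by measurable
    show "integrable (M k) (\<lambda>x. (cmod (t m k x))\<^sup>2)"
    proof (rule Bochner_Integration.integrable_bound[OF L2D(2)[OF G k]])
      show "(\<lambda>x. (cmod (t m k x))\<^sup>2) \<in> borel_measurable (M k)" by measurable
    qed (auto simp: t_def)
  qed
  have "(\<lambda>m. (L2_norm n M (G \<ominus> t m))\<^sup>2) \<longlonglongrightarrow> (\<Sum>k=1..n. 0)"
    unfolding L2_norm_square
  proof (rule tendsto_sum)
    fix k assume k: "k \<in> {1..n}"
    have "(\<lambda>m. LINT x|M k. (cmod ((G \<ominus> t m) k x))\<^sup>2) \<longlonglongrightarrow> (LINT x|M k. (0::real))"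
    proof (rule integral_dominated_convergence[OF _ _ L2D(2)[OF G k]])
      show "AE x in M k. (\<lambda>m. (cmod ((G \<ominus> t m) k x))\<^sup>2) \<longlonglongrightarrow> 0"
      proof (rule AE_I2)
        fix x assume "x \<in> space (M k)"
        from ev[OF k this] have "\<forall>\<^sub>F m in sequentially. (cmod ((G \<ominus> t m) k x))\<^sup>2 = 0"
          by eventually_elim (auto simp: t_def lincomb_def)
        then show "(\<lambda>m. (cmod ((G \<ominus> t m) k x))\<^sup>2) \<longlonglongrightarrow> 0" by (rule tendsto_eventually)
      qed
      show "AE x in M k. norm ((cmod ((G \<ominus> t m) k x))\<^sup>2) \<le> (cmod (G k x))\<^sup>2" for m
        by (rule AE_I2) (auto simp: lincomb_def t_def)
      show "(\<lambda>x. (cmod ((G \<ominus> t m) k x))\<^sup>2) \<in> borel_measurable (M k)" for m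
        using L2D(2)[OF lincomb_L2[OF G tL[of m]] k] by (rule borel_measurable_integrable)
    qed simp
    then show "(\<lambda>m. LINT x|M k. (cmod ((G \<ominus> t m) k x))\<^sup>2) \<longlonglongrightarrow> 0" by simp
  qed
  then have "(\<lambda>m. (L2_norm n M (G \<ominus> t m))\<^sup>2) \<longlonglongrightarrow> 0" by simp
  from order_tendstoD(2)[OF this, of "e\<^sup>2"] e
  have "\<forall>\<^sub>F m in sequentially. (L2_norm n M (G \<ominus> t m))\<^sup>2 < e\<^sup>2" by simp
  then obtain m where "(L2_norm n M (G \<ominus> t m))\<^sup>2 < e\<^sup>2"
    using eventually_happens trivial_limit_sequentially by blast
  then have "L2_norm n M (G \<ominus> t m) < e"
    by (rule power2_less_imp_less) (use e in simp)
  then show "\<exists>m. L2_norm n M (G \<ominus> t m) < e" by blast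
qed

section \<open>Continuous extension of densely defined contractions\<close>

locale L2_extension =
  fixes n :: nat and M N :: "nat \<Rightarrow> real measure" and D :: "tuple set" and T :: "tuple \<Rightarrow> tuple"
  assumes D: "D \<subseteq> L2 n M"
    and D_lincomb: "f \<in> D \<Longrightarrow> g \<in> D \<Longrightarrow> lincomb \<alpha> f \<beta> g \<in> D"
    and dense: "h \<in> L2 n M \<Longrightarrow> 0 < e \<Longrightarrow> \<exists>f\<in>D. L2_norm n M (h \<ominus> f) < e"
    and T: "f \<in> D \<Longrightarrow> T f \<in> L2 n N"
    and T_lincomb: "f \<in> D \<Longrightarrow> g \<in> D \<Longrightarrow> L2_eq n N (T (lincomb \<alpha> f \<beta> g)) (lincomb \<alpha> (T f) \<beta> (T g))"
    and T_le: "f \<in> D \<Longrightarrow> L2_norm n N (T f) \<le> L2_norm n M f"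
begin

lemma D': "f \<in> D \<Longrightarrow> f \<in> L2 n M" using D by auto

lemma T_diff_le:
  assumes "f \<in> D" "g \<in> D"
  shows "L2_norm n N (T f \<ominus> T g) \<le> L2_norm n M (f \<ominus> g)"
  using L2_norm_cong[OF T_lincomb[OF assms, of 1 "-1"] T[OF D_lincomb[OF assms]] lincomb_L2[OF T T]]
    T_le[OF D_lincomb[OF assms, of 1 "-1"]] assms by simp

text \<open>The limit of \<open>T\<close> along one fast approximating sequence satisfies a bound
  against every element of \<open>D\<close>. Stating that bound instead of convergence removes the
  sequence from view, so independence of its choice never has to be proved.\<close>

lemma ext_exists:
  assumes h: "h \<in> L2 n M"
  shows "\<exists>F. F \<in> L2 n N \<and> (\<forall>f\<in>D. L2_norm n N (F \<ominus> T f) \<le> L2_norm n M (h \<ominus> f))"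
proof -
  \<comment> \<open>Neighbours then differ by at most 4^-m, and the square 16^-m is below the rate
    8^-m that \<open>L2_limit\<close> asks for.\<close>
  have "\<exists>f. f \<in> D \<and> L2_norm n M (h \<ominus> f) < (1 / 4) ^ m / 2" for m :: nat
    using dense[OF h, of "(1 / 4) ^ m / 2"] by auto
  then obtain f where f: "\<And>m. f m \<in> D" "\<And>m. L2_norm n M (h \<ominus> f m) < (1 / 4) ^ m / 2"
    by metis
  have "(L2_norm n N (T (f (Suc m)) \<ominus> T (f m)))\<^sup>2 \<le> 1 / 8 ^ m" for m
  proof -
    have "L2_norm n N (T (f (Suc m)) \<ominus> T (f m)) \<le> L2_norm n M (f (Suc m) \<ominus> f m)"
      by (intro T_diff_le f)
    also have "\<dots> \<le> L2_norm n M (f (Suc m) \<ominus> h) + L2_norm n M (h \<ominus> f m)"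
      by (intro L2_norm_triangle D' f h)
    also have "\<dots> \<le> (1 / 4) ^ Suc m / 2 + (1 / 4) ^ m / 2"
      unfolding L2_norm_diff_commute[of n M "f (Suc m)" h] by (intro add_mono less_imp_le f)
    also have "\<dots> \<le> (1 / 4) ^ m" by simp
    finally have "(L2_norm n N (T (f (Suc m)) \<ominus> T (f m)))\<^sup>2 \<le> ((1 / 4) ^ m)\<^sup>2"
      by (intro power_mono) auto
    also have "\<dots> = (1 / 16) ^ m" by (simp only: power2_eq_square power_mult_distrib[symmetric]) simp
    also have "\<dots> \<le> (1 / 8) ^ m" by (intro power_mono) auto
    finally show ?thesis by (simp add: power_divide)
  qed
  then obtain F where F: "F \<in> L2 n N" "(\<lambda>m. L2_norm n N (F \<ominus> T (f m))) \<longlonglongrightarrow> 0"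
    using L2_limit[of "\<lambda>m. T (f m)" n N] T f by blast
  have "L2_norm n N (F \<ominus> T g) \<le> L2_norm n M (h \<ominus> g)" if g: "g \<in> D" for g
  proof (rule tendsto_lowerbound)
    have "(\<lambda>m. L2_norm n N (F \<ominus> T (f m)) + (1 / 4) ^ m / 2 + L2_norm n M (h \<ominus> g))
        \<longlonglongrightarrow> 0 + 0 / 2 + L2_norm n M (h \<ominus> g)"
      by (intro tendsto_intros F LIMSEQ_power_zero) auto
    then show "(\<lambda>m. L2_norm n N (F \<ominus> T (f m)) + (1 / 4) ^ m / 2 + L2_norm n M (h \<ominus> g))
        \<longlonglongrightarrow> L2_norm n M (h \<ominus> g)" by simp
    show "\<forall>\<^sub>F m in sequentially. L2_norm n N (F \<ominus> T g)
        \<le> L2_norm n N (F \<ominus> T (f m)) + (1 / 4) ^ m / 2 + L2_norm n M (h \<ominus> g)"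
    proof (rule always_eventually, rule allI)
      fix m
      have "L2_norm n N (F \<ominus> T g) \<le> L2_norm n N (F \<ominus> T (f m)) + L2_norm n N (T (f m) \<ominus> T g)"
        by (intro L2_norm_triangle F T f g)
      moreover have "L2_norm n N (T (f m) \<ominus> T g) \<le> L2_norm n M (f m \<ominus> g)"
        by (intro T_diff_le f g)
      moreover have "L2_norm n M (f m \<ominus> g) \<le> L2_norm n M (f m \<ominus> h) + L2_norm n M (h \<ominus> g)"
        by (intro L2_norm_triangle D' f h g)
      moreover have "L2_norm n M (f m \<ominus> h) < (1 / 4) ^ m / 2"
        unfolding L2_norm_diff_commute[of n M "f m" h] by (rule f)
      ultimately show "L2_norm n N (F \<ominus> T g)
        \<le> L2_norm n N (F \<ominus> T (f m)) + (1 / 4) ^ m / 2 + L2_norm n M (h \<ominus> g)" by linarith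
    qed
  qed simp
  with F(1) show ?thesis by blast
qed

text \<open>The condition determines the limit of \<open>T\<close> at \<open>h\<close> up to equality almost everywhere.\<close>
definition ext :: "tuple \<Rightarrow> tuple" where
  "ext h = (SOME F. F \<in> L2 n N \<and> (\<forall>f\<in>D. L2_norm n N (F \<ominus> T f) \<le> L2_norm n M (h \<ominus> f)))"

lemma ext:
  assumes "h \<in> L2 n M"
  shows "ext h \<in> L2 n N" "\<And>f. f \<in> D \<Longrightarrow> L2_norm n N (ext h \<ominus> T f) \<le> L2_norm n M (h \<ominus> f)"
  using someI_ex[OF ext_exists[OF assms]] unfolding ext_def by blast+

lemma ext_on_D:
  assumes f: "f \<in> D"
  shows "L2_eq n N (ext f) (T f)"
proof (rule L2_norm_0_imp_eq[OF ext(1)[OF D'[OF f]] T[OF f]])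
  have "(L2_norm n M (f \<ominus> f))\<^sup>2 = 0" unfolding L2_norm_square by (simp add: lincomb_def)
  then show "L2_norm n N (ext f \<ominus> T f) = 0"
    using ext(2)[OF D'[OF f] f] by (simp add: order_antisym)
qed

text \<open>\<open>ext\<close> selects arbitrary representatives, so linearity can hold only up to
  null functions. Both sides are compared with the combination of \<open>T f1\<close> and
  \<open>T f2\<close> for approximants f1, f2 in \<open>D\<close>.\<close>

lemma ext_lincomb:
  assumes h: "h1 \<in> L2 n M" "h2 \<in> L2 n M"
  shows "L2_eq n N (ext (lincomb \<alpha> h1 \<beta> h2)) (lincomb \<alpha> (ext h1) \<beta> (ext h2))"
proof (rule L2_norm_0_imp_eq)
  let ?h = "lincomb \<alpha> h1 \<beta> h2" and ?F = "lincomb \<alpha> (ext h1) \<beta> (ext h2)"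
  show 1: "ext ?h \<in> L2 n N" "?F \<in> L2 n N"
    using h by (auto intro: ext lincomb_L2)
  have "L2_norm n N (ext ?h \<ominus> ?F) \<le> 0 + e" if e: "0 < e" for e
  proof -
    \<comment> \<open>Each of the two comparisons costs (|\<alpha>| + |\<beta>|) d; the added 1
      keeps the denominator positive when both coefficients are 0.\<close>
    define d where "d = e / (2 * (cmod \<alpha> + cmod \<beta> + 1))"
    have pos: "0 < 2 * (cmod \<alpha> + cmod \<beta> + 1)" by (simp add: add_nonneg_pos)
    have d: "0 < d" using e pos by (simp add: d_def)
    obtain f1 f2 where f: "f1 \<in> D" "f2 \<in> D" "L2_norm n M (h1 \<ominus> f1) < d" "L2_norm n M (h2 \<ominus> f2) < d"
      using dense[OF h(1) d] dense[OF h(2) d] by blast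
    let ?f = "lincomb \<alpha> f1 \<beta> f2"
    have fD: "?f \<in> D" by (intro D_lincomb f)
    let ?G = "lincomb \<alpha> (T f1) \<beta> (T f2)"
    have GL: "?G \<in> L2 n N" by (intro lincomb_L2 T f)
    have "L2_norm n N (ext ?h \<ominus> T ?f) \<le> L2_norm n M (?h \<ominus> ?f)"
      by (intro ext lincomb_L2 h fD)
    also have "?h \<ominus> ?f = lincomb \<alpha> (h1 \<ominus> f1) \<beta> (h2 \<ominus> f2)" by (simp add: lincomb_def algebra_simps)
    also have "L2_norm n M \<dots> \<le> cmod \<alpha> * L2_norm n M (h1 \<ominus> f1) + cmod \<beta> * L2_norm n M (h2 \<ominus> f2)"
      by (intro L2_norm_lincomb_le lincomb_L2 h D' f)
    also have "\<dots> \<le> cmod \<alpha> * d + cmod \<beta> * d"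
      using f by (intro add_mono mult_left_mono) auto
    finally have A: "L2_norm n N (ext ?h \<ominus> T ?f) \<le> cmod \<alpha> * d + cmod \<beta> * d" .
    have "?G \<ominus> ?F = lincomb \<alpha> (T f1 \<ominus> ext h1) \<beta> (T f2 \<ominus> ext h2)"
      by (simp add: lincomb_def algebra_simps)
    then have "L2_norm n N (?G \<ominus> ?F) \<le> cmod \<alpha> * L2_norm n N (T f1 \<ominus> ext h1) + cmod \<beta> * L2_norm n N (T f2 \<ominus> ext h2)"
      using L2_norm_lincomb_le[OF lincomb_L2[OF T[OF f(1)] ext(1)[OF h(1)]] lincomb_L2[OF T[OF f(2)] ext(1)[OF h(2)]]]
      by simp
    also have "\<dots> \<le> cmod \<alpha> * d + cmod \<beta> * d"
      using f ext(2)[OF h(1) f(1)] ext(2)[OF h(2) f(2)]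
      unfolding L2_norm_diff_commute[of n N "T f1"] L2_norm_diff_commute[of n N "T f2"]
      by (intro add_mono mult_left_mono) auto
    finally have C: "L2_norm n N (?G \<ominus> ?F) \<le> cmod \<alpha> * d + cmod \<beta> * d" .
    have "L2_eq n N (T ?f) ?G" by (intro T_lincomb f)
    then have "L2_eq n N (ext ?h \<ominus> T ?f) (ext ?h \<ominus> ?G)"
      by (intro L2_eq_lincomb) (auto simp: L2_eq_def)
    then have E: "L2_norm n N (ext ?h \<ominus> T ?f) = L2_norm n N (ext ?h \<ominus> ?G)"
      by (intro L2_norm_cong lincomb_L2 1 T fD GL)
    have "L2_norm n N (ext ?h \<ominus> ?F) \<le> L2_norm n N (ext ?h \<ominus> ?G) + L2_norm n N (?G \<ominus> ?F)"
      by (intro L2_norm_triangle 1 GL)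
    also have "\<dots> \<le> 2 * (cmod \<alpha> + cmod \<beta> + 1) * d"
      using A C E d by (simp add: algebra_simps)
    also have "\<dots> = e" using pos by (simp add: d_def)
    finally show ?thesis by simp
  qed
  then show "L2_norm n N (ext ?h \<ominus> ?F) = 0"
    using field_le_epsilon[of "L2_norm n N (ext ?h \<ominus> ?F)" 0] by (simp add: order_antisym)
qed

lemma ext_norm_le:
  assumes h: "h \<in> L2 n M"
  shows "L2_norm n N (ext h) \<le> L2_norm n M h"
proof (rule field_le_epsilon)
  fix e :: real assume "0 < e"
  then obtain f where f: "f \<in> D" "L2_norm n M (h \<ominus> f) < e / 2"
    using dense[OF h, of "e / 2"] by auto
  have "L2_norm n N (ext h) \<le> L2_norm n N (ext h \<ominus> T f) + L2_norm n N (T f)"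
    by (intro L2_norm_triangle' ext T h f)
  moreover have "L2_norm n M f \<le> L2_norm n M (f \<ominus> h) + L2_norm n M h"
    by (intro L2_norm_triangle' D' f h)
  ultimately show "L2_norm n N (ext h) \<le> L2_norm n M h + e"
    using ext(2)[OF h f(1)] f(2) T_le[OF f(1)] L2_norm_diff_commute[of n M f h] by linarith
qed

lemma ext_isometry:
  assumes iso: "\<And>f. f \<in> D \<Longrightarrow> L2_norm n N (T f) = L2_norm n M f" and h: "h \<in> L2 n M"
  shows "L2_norm n N (ext h) = L2_norm n M h"
proof (rule antisym[OF ext_norm_le[OF h]], rule field_le_epsilon)
  fix e :: real assume "0 < e"
  then obtain f where f: "f \<in> D" "L2_norm n M (h \<ominus> f) < e / 2"
    using dense[OF h, of "e / 2"] by auto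
  have "L2_norm n M h \<le> L2_norm n M (h \<ominus> f) + L2_norm n M f"
    by (intro L2_norm_triangle' D' f h)
  moreover have "L2_norm n N (T f) \<le> L2_norm n N (T f \<ominus> ext h) + L2_norm n N (ext h)"
    by (intro L2_norm_triangle' ext T h f)
  ultimately show "L2_norm n M h \<le> L2_norm n N (ext h) + e"
    using ext(2)[OF h f(1)] f(2) iso[OF f(1)] L2_norm_diff_commute[of n N "T f" "ext h"] by linarith
qed

end

text \<open>Both sides depend continuously on h and F by Cauchy-Schwarz, and on the dense domains
  they agree by \<open>adj\<close>.\<close>

lemma ext_adjoint:
  assumes T: "L2_extension n M N D T" and S: "L2_extension n N M E S"
    and adj: "\<And>f G. f \<in> D \<Longrightarrow> G \<in> E \<Longrightarrow> L2_inner n M (S G) f = L2_inner n N G (T f)"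
    and h: "h \<in> L2 n M" and F: "F \<in> L2 n N"
  shows "L2_inner n M (L2_extension.ext n N M E S F) h = L2_inner n N F (L2_extension.ext n M N D T h)"
proof -
  interpret T: L2_extension n M N D T by fact
  interpret S: L2_extension n N M E S by fact
  let ?l = "L2_inner n M (S.ext F) h" and ?r = "L2_inner n N F (T.ext h)"
  \<comment> \<open>The constant collects four error terms; requiring d \<le> 1 bounds the norm of
    the approximant \<open>G\<close> by that of \<open>F\<close> plus 1.\<close>
  let ?K = "2 * (L2_norm n M h + L2_norm n N F + 1)"
  have K: "0 < ?K" by (intro mult_pos_pos add_nonneg_pos add_nonneg_nonneg) auto
  have close: "cmod (L2_inner n P u v - L2_inner n P u' v') \<le> d * L2_norm n P v + L2_norm n P u' * d"
    if "u \<in> L2 n P" "v \<in> L2 n P" "u' \<in> L2 n P" "v' \<in> L2 n P"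
      "L2_norm n P (u \<ominus> u') \<le> d" "L2_norm n P (v \<ominus> v') \<le> d" for P u v u' v' d
  proof -
    have "L2_inner n P (u \<ominus> u') v = L2_inner n P u v - L2_inner n P u' v"
      using L2_inner_lincomb[OF that(1,3,2), of 1 "-1"] by simp
    moreover have "L2_inner n P u' (v \<ominus> v') = L2_inner n P u' v - L2_inner n P u' v'"
      using arg_cong[OF L2_inner_lincomb[OF that(2,4,3), of 1 "-1"], of cnj] by (simp add: L2_inner_cnj)
    ultimately have "cmod (L2_inner n P u v - L2_inner n P u' v')
        \<le> cmod (L2_inner n P (u \<ominus> u') v) + cmod (L2_inner n P u' (v \<ominus> v'))"
      using norm_triangle_ineq[of "L2_inner n P (u \<ominus> u') v" "L2_inner n P u' (v \<ominus> v')"] by simp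
    also have "\<dots> \<le> L2_norm n P (u \<ominus> u') * L2_norm n P v + L2_norm n P u' * L2_norm n P (v \<ominus> v')"
      by (intro add_mono L2_Cauchy_Schwarz lincomb_L2 that)
    also have "\<dots> \<le> d * L2_norm n P v + L2_norm n P u' * d"
      using that order_trans[OF L2_norm_nonneg that(5)] by (intro add_mono mult_mono) auto
    finally show ?thesis .
  qed
  have "cmod (?l - ?r) \<le> 0 + e" if e: "0 < e" for e
  proof -
    define d where "d = min 1 (e / ?K)"
    have d: "0 < d" "d \<le> 1" using divide_pos_pos[OF e K] unfolding d_def by auto
    have "?K * d \<le> ?K * (e / ?K)" unfolding d_def using K by (intro mult_left_mono) auto
    then have d3: "?K * d \<le> e" using K by simp
    obtain f where f: "f \<in> D" "L2_norm n M (h \<ominus> f) < d" using T.dense[OF h d(1)] by blast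
    obtain G where G: "G \<in> E" "L2_norm n N (F \<ominus> G) < d" using S.dense[OF F d(1)] by blast
    have "L2_norm n N G \<le> L2_norm n N (G \<ominus> F) + L2_norm n N F"
      by (intro L2_norm_triangle' S.D' G F)
    then have NG: "L2_norm n N G \<le> L2_norm n N F + 1"
      using G d by (simp add: L2_norm_diff_commute)
    have "cmod (?l - L2_inner n M (S G) f) \<le> d * L2_norm n M h + L2_norm n M (S G) * d"
      by (rule close[OF S.ext(1)[OF F] h S.T[OF G(1)] T.D'[OF f(1)]]) (use S.ext(2)[OF F G(1)] G f in auto)
    moreover have "cmod (?r - L2_inner n N G (T f)) \<le> d * L2_norm n N (T.ext h) + L2_norm n N G * d"
      by (rule close[OF F T.ext(1)[OF h] S.D'[OF G(1)] T.T[OF f(1)]]) (use T.ext(2)[OF h f(1)] G f in auto)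
    moreover have "cmod (?l - ?r) \<le> cmod (?l - L2_inner n M (S G) f) + cmod (?r - L2_inner n N G (T f))"
      using norm_triangle_ineq4[of "?l - L2_inner n M (S G) f" "?r - L2_inner n N G (T f)"] adj[OF f(1) G(1)]
      by simp
    moreover have "d * L2_norm n N (T.ext h) \<le> d * L2_norm n M h"
      using T.ext_norm_le[OF h] d by (intro mult_left_mono) auto
    moreover have "L2_norm n M (S G) * d \<le> (L2_norm n N F + 1) * d"
      using S.T_le[OF G(1)] NG d by (intro mult_right_mono) auto
    moreover have "L2_norm n N G * d \<le> (L2_norm n N F + 1) * d"
      using NG d by (intro mult_right_mono) auto
    moreover have "?K * d = d * L2_norm n M h + (L2_norm n N F + 1) * d + (d * L2_norm n M h + (L2_norm n N F + 1) * d)"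
      by (simp add: algebra_simps)
    ultimately show ?thesis using d3 by linarith
  qed
  then have "cmod (?l - ?r) \<le> 0" by (rule field_le_epsilon)
  then show ?thesis by simp
qed

text \<open>Expand the square of the distance from \<open>u\<close> to \<open>h\<close>.\<close>
lemma adjoint_inverts_isometry:
  assumes h: "h \<in> L2 n M" and F: "F \<in> L2 n N" and SF: "u \<in> L2 n M"
    and le: "L2_norm n M u \<le> L2_norm n N F" and iso: "L2_norm n N F = L2_norm n M h"
    and adj: "L2_inner n M u h = of_real ((L2_norm n N F)\<^sup>2)"
  shows "L2_eq n M u h"
proof (rule L2_norm_0_imp_eq[OF SF h])
  have "(L2_norm n M u)\<^sup>2 \<le> (L2_norm n M h)\<^sup>2" using le iso by (intro power_mono) auto
  then have "(L2_norm n M (u \<ominus> h))\<^sup>2 \<le> 0"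
    unfolding L2_norm_lincomb_square[OF SF h] using iso by (simp add: adj)
  then show "L2_norm n M (u \<ominus> h) = 0" by simp
qed


subsection \<open>Fourier transforms of compactly supported functions\<close>

text \<open>Every later exchange of integrals has a majorant of product form, which reduces joint
  integrability to two one-variable integrals.\<close>

lemma (in pair_sigma_finite) integrable_dominated_product:
  fixes f :: "'a \<Rightarrow> 'b \<Rightarrow> 'c :: {banach, second_countable_topology}"
  assumes f: "case_prod f \<in> borel_measurable (M1 \<Otimes>\<^sub>M M2)"
    and p: "integrable M1 p" and q: "integrable M2 q"
    and bd: "\<And>x y. x \<in> space M1 \<Longrightarrow> y \<in> space M2 \<Longrightarrow> norm (f x y) \<le> (p x :: real) * q y"
  shows "integrable (M1 \<Otimes>\<^sub>M M2) (case_prod f)"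
proof -
  have "integrable (M1 \<Otimes>\<^sub>M M2) (\<lambda>(x, y). p x * q y)"
  proof (rule Fubini_integrable)
    have [measurable]: "p \<in> borel_measurable M1" "q \<in> borel_measurable M2"
      using p q by auto
    show "(\<lambda>(x, y). p x * q y) \<in> borel_measurable (M1 \<Otimes>\<^sub>M M2)" by measurable
    show "integrable M1 (\<lambda>x. \<integral>y. norm (case (x, y) of (x, y) \<Rightarrow> p x * q y) \<partial>M2)"
      using p by (simp add: abs_mult)
    show "AE x in M1. integrable M2 (\<lambda>y. case (x, y) of (x, y) \<Rightarrow> p x * q y)"
      using q by simp
  qed
  then show ?thesis
  proof (rule Bochner_Integration.integrable_bound[OF _ f])
    show "AE z in M1 \<Otimes>\<^sub>M M2. norm (case_prod f z) \<le> norm (case z of (x, y) \<Rightarrow> p x * q y)"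
      using bd by (intro AE_I2) (force simp: space_pair_measure)
  qed
qed

text \<open>The frequency is complex, and the sign is such that an integrable function supported in
  x \<ge> 0 has a transform bounded on the closed upper half plane.\<close>

definition fourier :: "(real \<Rightarrow> complex) \<Rightarrow> complex \<Rightarrow> complex" where
  "fourier g \<eta> = (LINT x|lborel. g x * exp (\<i> * \<eta> * of_real x))"

text \<open>One continuous derivative pays for a single integration by parts, whose decay 1/|\<eta>|
  makes the transform square integrable on the real line. The values at the endpoints are left to
  continuity.\<close>

locale C1_bump =
  fixes \<alpha> \<beta> :: real and g g' :: "real \<Rightarrow> complex"
  assumes less: "\<alpha> < \<beta>"
    and deriv: "(g has_vector_derivative g' x) (at x)"
    and cont': "continuous_on UNIV g'"
    and zero: "x \<notin> {\<alpha>..\<beta>} \<Longrightarrow> g x = 0"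
begin

lemma cont: "continuous_on UNIV g"
  using deriv by (intro continuous_at_imp_continuous_on) (auto intro: has_vector_derivative_continuous)

lemma zero': "x \<notin> {\<alpha>..\<beta>} \<Longrightarrow> g' x = 0"
proof -
  assume x: "x \<notin> {\<alpha>..\<beta>}"
  have "(g has_vector_derivative 0) (at x)"
  proof (rule has_vector_derivative_transform_within_open[where f="\<lambda>_. 0" and S="- {\<alpha>..\<beta>}"])
    show "open (- {\<alpha>..\<beta>})" by (simp add: open_Compl)
  qed (use x zero in auto)
  then show ?thesis using deriv vector_derivative_at by metis
qed

lemma integrable_mult_cont:
  fixes k :: "real \<Rightarrow> complex"
  assumes k: "continuous_on {\<alpha>..\<beta>} k" and u: "continuous_on UNIV u" "\<And>x. x \<notin> {\<alpha>..\<beta>} \<Longrightarrow> u x = 0"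
  shows "integrable lborel (\<lambda>x. u x * k x)"
    and "(LINT x|lborel. u x * k x) = integral {\<alpha>..\<beta>} (\<lambda>x. u x * k x)"
proof -
  have si: "set_integrable lborel {\<alpha>..\<beta>} (\<lambda>x. u x * k x)"
    by (intro borel_integrable_atLeastAtMost' continuous_intros k continuous_on_subset[OF u(1)]) auto
  have eq: "(\<lambda>x. indicator {\<alpha>..\<beta>} x *\<^sub>R (u x * k x)) = (\<lambda>x. u x * k x)"
    using u(2) by (auto simp: indicator_def fun_eq_iff)
  show "integrable lborel (\<lambda>x. u x * k x)" using si by (simp add: set_integrable_def eq)
  show "(LINT x|lborel. u x * k x) = integral {\<alpha>..\<beta>} (\<lambda>x. u x * k x)"
    using set_borel_integral_eq_integral(2)[OF si] by (simp add: set_lebesgue_integral_def eq)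
qed

lemma integrable_g: "integrable lborel g" and integrable_g': "integrable lborel g'"
  using integrable_mult_cont(1)[OF continuous_on_const[of _ 1] cont zero]
    integrable_mult_cont(1)[OF continuous_on_const[of _ 1] cont' zero'] by auto

lemma measurable_g [measurable]: "g \<in> borel_measurable borel"
  using integrable_g by auto

lemma measurable_cnj_g [measurable]: "(\<lambda>x. cnj (g x)) \<in> borel_measurable borel"
  by (intro borel_measurable_continuous_onI continuous_on_cnj cont)

lemma integrable_exp: "integrable lborel (\<lambda>x. g x * exp (\<i> * \<eta> * of_real x))"
  by (intro integrable_mult_cont cont zero continuous_intros)

lemma fourier_eq_integral: "fourier g \<eta> = integral {\<alpha>..\<beta>} (\<lambda>x. g x * exp (\<i> * \<eta> * of_real x))"
  unfolding fourier_def by (intro integrable_mult_cont cont zero continuous_intros)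

lemma holomorphic_fourier: "fourier g holomorphic_on A"
proof -
  have "(\<lambda>\<eta>. integral (cbox \<alpha> \<beta>) (\<lambda>x. g x * exp (\<i> * \<eta> * of_real x))) holomorphic_on UNIV"
  proof (rule leibniz_rule_holomorphic)
    fix \<eta> :: complex and t :: real
    show "((\<lambda>\<eta>. g t * exp (\<i> * \<eta> * of_real t)) has_field_derivative
             g t * (exp (\<i> * \<eta> * of_real t) * (\<i> * of_real t))) (at \<eta> within UNIV)"
      by (auto intro!: derivative_eq_intros)
    show "(\<lambda>x. g x * exp (\<i> * \<eta> * of_real x)) integrable_on cbox \<alpha> \<beta>"
      by (intro integrable_continuous continuous_intros continuous_on_subset[OF cont]) auto
    show "continuous_on (UNIV \<times> cbox \<alpha> \<beta>)
        (\<lambda>(\<eta>, t). g t * (exp (\<i> * \<eta> * of_real t) * (\<i> * of_real t)))"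
      unfolding split_def
      by (intro continuous_intros continuous_on_compose2[OF cont]) auto
  qed auto
  then show ?thesis
    by (auto simp: fourier_eq_integral[abs_def] intro: holomorphic_on_subset)
qed

lemma continuous_fourier: "continuous_on A (fourier g)"
  using holomorphic_fourier holomorphic_on_imp_continuous_on by blast

text \<open>Two regimes: complex frequencies for functions on the positive axis, as in the contour
  argument, and real frequencies for arbitrary support, as for the odd extension behind the sine
  transform.\<close>

lemma norm_exp_le: "(0 \<le> \<alpha> \<and> 0 \<le> Im \<eta>) \<or> Im \<eta> = 0 \<Longrightarrow> x \<in> {\<alpha>..\<beta>} \<Longrightarrow> norm (exp (\<i> * \<eta> * of_real x)) \<le> 1"
  by auto

lemma norm_mult_exp_le:
  assumes "(0 \<le> \<alpha> \<and> 0 \<le> Im \<eta>) \<or> Im \<eta> = 0" and "\<And>x. x \<notin> {\<alpha>..\<beta>} \<Longrightarrow> u x = 0"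
  shows "norm (u x * exp (\<i> * \<eta> * of_real x)) \<le> norm (u x)"
  using norm_exp_le[OF assms(1), of x] assms(2)[of x]
  by (cases "x \<in> {\<alpha>..\<beta>}") (auto simp: norm_mult intro: mult_left_le)

lemma fourier_bound:
  assumes "(0 \<le> \<alpha> \<and> 0 \<le> Im \<eta>) \<or> Im \<eta> = 0"
  shows "norm (fourier g \<eta>) \<le> (LINT x|lborel. norm (g x))"
  unfolding fourier_def
  by (rule order_trans[OF integral_norm_bound], rule integral_mono)
    (use integrable_exp integrable_g norm_mult_exp_le[OF assms zero] in auto)

lemma fourier_decay:
  assumes "(0 \<le> \<alpha> \<and> 0 \<le> Im \<eta>) \<or> Im \<eta> = 0"
  shows "norm \<eta> * norm (fourier g \<eta>) \<le> (LINT x|lborel. norm (g' x))"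
proof -
  let ?e = "\<lambda>x. exp (\<i> * \<eta> * of_real x)"
  \<comment> \<open>\<open>zero\<close> speaks only of points outside the closed interval, so the
    interval is widened to make the boundary terms of the integration by parts vanish.\<close>
  interpret W: C1_bump "\<alpha> - 1" "\<beta> + 1" g g'
    using less deriv cont' zero by unfold_locales auto
  have ce: "continuous_on A ?e" for A by (intro continuous_intros)
  have "((\<lambda>x. g x * (?e x * (\<i> * \<eta>)) + g' x * ?e x) has_integral
          g (\<beta> + 1) * ?e (\<beta> + 1) - g (\<alpha> - 1) * ?e (\<alpha> - 1)) {\<alpha> - 1..\<beta> + 1}"
  proof (rule fundamental_theorem_of_calculus)
    fix x assume "x \<in> {\<alpha> - 1..\<beta> + 1}"
    have e: "(?e has_vector_derivative ?e x * (\<i> * \<eta>)) (at x within {\<alpha> - 1..\<beta> + 1})"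
      by (rule has_vector_derivative_real_field) (auto intro!: derivative_eq_intros)
    show "((\<lambda>x. g x * ?e x) has_vector_derivative g x * (?e x * (\<i> * \<eta>)) + g' x * ?e x)
        (at x within {\<alpha> - 1..\<beta> + 1})"
      by (intro has_vector_derivative_mult has_vector_derivative_at_within[OF deriv] e)
  qed (use less in auto)
  then have "integral {\<alpha> - 1..\<beta> + 1} (\<lambda>x. \<i> * \<eta> * (g x * ?e x) + g' x * ?e x) = 0"
    by (simp add: zero algebra_simps integral_unique)
  moreover have "integral {\<alpha> - 1..\<beta> + 1} (\<lambda>x. \<i> * \<eta> * (g x * ?e x) + g' x * ?e x)
      = \<i> * \<eta> * integral {\<alpha> - 1..\<beta> + 1} (\<lambda>x. g x * ?e x) + integral {\<alpha> - 1..\<beta> + 1} (\<lambda>x. g' x * ?e x)"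
    by (subst integral_add)
       (auto intro!: integrable_continuous_real continuous_intros continuous_on_subset[OF cont]
          continuous_on_subset[OF cont'])
  moreover have "fourier g \<eta> = integral {\<alpha> - 1..\<beta> + 1} (\<lambda>x. g x * ?e x)"
    by (rule W.fourier_eq_integral)
  moreover have "(LINT x|lborel. g' x * ?e x) = integral {\<alpha> - 1..\<beta> + 1} (\<lambda>x. g' x * ?e x)"
    by (rule W.integrable_mult_cont(2)[OF ce cont' W.zero'])
  ultimately have "\<i> * \<eta> * fourier g \<eta> = - (LINT x|lborel. g' x * ?e x)"
    by (simp only: eq_neg_iff_add_eq_0)
  then have "norm \<eta> * norm (fourier g \<eta>) = norm (LINT x|lborel. g' x * ?e x)"
    by (metis norm_minus_cancel norm_mult norm_ii mult_1)
  also have "\<dots> \<le> (LINT x|lborel. norm (g' x))"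
    by (rule order_trans[OF integral_norm_bound], rule integral_mono)
      (use integrable_mult_cont(1)[OF ce cont' zero'] integrable_g' norm_mult_exp_le[OF assms zero'] in auto)
  finally show ?thesis .
qed

lemma bounded_g: "\<exists>B. \<forall>x. norm (g x) \<le> B"
proof -
  have "compact (g ` {\<alpha>..\<beta>})"
    by (intro compact_continuous_image continuous_on_subset[OF cont]) auto
  then obtain B where B: "\<And>x. x \<in> {\<alpha>..\<beta>} \<Longrightarrow> norm (g x) \<le> B"
    using compact_imp_bounded bounded_iff by (metis imageI)
  have "norm (g x) \<le> max B 0" for x
    using B[of x] zero[of x] by (cases "x \<in> {\<alpha>..\<beta>}") auto
  then show ?thesis by blast
qed

end

section \<open>Plancherel's theorem by Gaussian regularization\<close>

text \<open>This is the characteristic function of the standard normal law after the substitution u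
  = s t.\<close>

lemma gaussian_fourier:
  fixes s v :: real
  assumes s: "0 < s"
  shows "(LINT t|lborel. exp (\<i> * of_real (t * v)) * of_real (exp (- (s * t)\<^sup>2 / 2)))
       = of_real (sqrt (2 * pi) / s * exp (- (v / s)\<^sup>2 / 2))"
proof -
  have "of_real (exp (- (v / s)\<^sup>2 / 2)) = char std_normal_distribution (v / s)"
    by (simp add: char_std_normal_distribution)
  also have "\<dots> = (LINT u|lborel. std_normal_density u *\<^sub>R iexp (v / s * u))"
    unfolding char_def by (subst integral_density) (auto simp: normal_density_nonneg)
  also have "\<dots> = \<bar>s\<bar> *\<^sub>R (LINT t|lborel. std_normal_density (0 + s * t) *\<^sub>R iexp (v / s * (0 + s * t)))"
    by (rule lborel_integral_real_affine) (use s in simp)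
  also have "(\<lambda>t. std_normal_density (0 + s * t) *\<^sub>R iexp (v / s * (0 + s * t)))
     = (\<lambda>t. of_real (1 / sqrt (2 * pi)) * (exp (\<i> * of_real (t * v)) * of_real (exp (- (s * t)\<^sup>2 / 2))))"
    using s by (auto simp: fun_eq_iff std_normal_density_def scaleR_conv_of_real mult_ac)
  finally show ?thesis
    using s by (simp add: scaleR_conv_of_real field_simps)
qed

lemma integrable_gaussian:
  fixes s :: real
  assumes "0 < s"
  shows "integrable lborel (\<lambda>t::real. exp (- (s * t)\<^sup>2 / 2))"
proof -
  have "integrable lborel (\<lambda>t. sqrt (2 * pi) * std_normal_density t)"
    by (intro integrable_mult_right integrable_normal_density) simp
  then have "integrable lborel (\<lambda>t::real. exp (- t\<^sup>2 / 2))"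
    by (simp add: std_normal_density_def)
  from lborel_integrable_real_affine[OF this, of s 0] assms show ?thesis by simp
qed

context C1_bump
begin

text \<open>Damping by a Gaussian makes Fubini's theorem applicable to the inversion integral. The
  inner integral is again Gaussian, so the right-hand side is 2 pi times an average of g around y at
  scale s, which tends to 2 pi g(y) as s goes to 0.\<close>

lemma gaussian_inversion:
  fixes s y :: real
  assumes s: "0 < s"
  shows "(LINT t|lborel. fourier g (of_real t) * exp (- \<i> * of_real (t * y)) * of_real (exp (- (s * t)\<^sup>2 / 2)))
    = of_real (2 * pi) * (LINT u|lborel. g (y + s * u) * of_real (std_normal_density u))"
proof -
  let ?E = "\<lambda>t::real. exp (- (s * t)\<^sup>2 / 2)"
  let ?f = "\<lambda>x t. g x * exp (\<i> * of_real (t * (x - y))) * of_real (?E t)"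
  have mE: "(\<lambda>x. exp (k x)) \<in> borel_measurable M" if "k \<in> borel_measurable M"
    for k :: "'z \<Rightarrow> complex" and M
    using that by measurable
  have fi: "integrable (lborel \<Otimes>\<^sub>M lborel) (case_prod ?f)"
    by (rule lborel_pair.integrable_dominated_product[OF _ integrable_norm[OF integrable_g] integrable_gaussian[OF s]])
       (auto simp: norm_mult)
  have "(LINT t|lborel. fourier g (of_real t) * exp (- \<i> * of_real (t * y)) * of_real (?E t))
      = (LINT t|lborel. LINT x|lborel. ?f x t)"
    by (simp add: fourier_def algebra_simps exp_diff exp_minus field_simps
        flip: integral_mult_left_zero integral_mult_right_zero)
  also have "\<dots> = (LINT x|lborel. LINT t|lborel. ?f x t)"
    by (rule lborel_pair.Fubini_integral[OF fi])
  also have "\<dots> = (LINT x|lborel. g x * of_real (sqrt (2 * pi) / s * exp (- ((x - y) / s)\<^sup>2 / 2)))"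
    by (simp only: mult.assoc integral_mult_right_zero gaussian_fourier[OF s])
  also have "\<dots> = \<bar>s\<bar> *\<^sub>R (LINT u|lborel. g (y + s * u) *
      of_real (sqrt (2 * pi) / s * exp (- ((y + s * u - y) / s)\<^sup>2 / 2)))"
    by (rule lborel_integral_real_affine) (use s in simp)
  also have "(\<lambda>u. g (y + s * u) * of_real (sqrt (2 * pi) / s * exp (- ((y + s * u - y) / s)\<^sup>2 / 2)))
      = (\<lambda>u. of_real (2 * pi / s) * (g (y + s * u) * of_real (std_normal_density u)))"
  proof -
    have key: "q / s * e = (q * q) / s * (1 / q * e)" if "0 < q" for q e :: real
      using that by simp
    have eqn: "sqrt (2 * pi) / s * exp (- ((y + s * u - y) / s)\<^sup>2 / 2) = 2 * pi / s * std_normal_density u" for u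
      using key[of "sqrt (2 * pi)" "exp (- u\<^sup>2 / 2)"] s by (simp add: std_normal_density_def)
    show ?thesis by (rule ext, subst eqn) (simp only: of_real_mult mult_ac)
  qed
  finally show ?thesis
    using s by (simp add: scaleR_conv_of_real)
qed

text \<open>The damped integrals \<open>?J s\<close> are evaluated in two ways as s goes to 0:
  dominated convergence gives the integral of the squared transform, and Fubini with the damped
  inversion formula gives 2 pi times the squared norm of g.\<close>

lemma plancherel:
  shows "integrable lborel (\<lambda>t. (norm (fourier g (of_real t)))\<^sup>2)"
    and "(LINT t|lborel. (norm (fourier g (of_real t)))\<^sup>2) = 2 * pi * (LINT x|lborel. (norm (g x))\<^sup>2)"
proof -
  let ?F = "\<lambda>t. fourier g (complex_of_real t)"
  let ?E = "\<lambda>s t::real. exp (- (s * t)\<^sup>2 / 2)"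
  define M where "M = (LINT x|lborel. norm (g x)) + (LINT x|lborel. norm (g' x))"
  have M0: "0 \<le> LINT x|lborel. norm (g x)" "0 \<le> LINT x|lborel. norm (g' x)" by auto
  have cF: "continuous_on UNIV ?F"
    by (intro continuous_on_compose2[OF continuous_fourier[of UNIV]] continuous_intros) auto
  have [measurable]: "?F \<in> borel_measurable borel"
    by (rule borel_measurable_continuous_onI[OF cF])
  have FM: "norm (?F t) \<le> M" for t
    using fourier_bound[OF disjI2[OF Im_complex_of_real], of t] M0 unfolding M_def by linarith
  \<comment> \<open>The bounds of |F| and |t F| by M are added in squared form, which yields an
    integrable majorant of Cauchy type.\<close>
  have bd: "(norm (?F t))\<^sup>2 \<le> 2 * M\<^sup>2 * inverse (1 + t\<^sup>2)" for t
  proof -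
    have "\<bar>t\<bar> * norm (?F t) \<le> M"
      using fourier_decay[OF disjI2[OF Im_complex_of_real], of t] M0 unfolding M_def norm_of_real by linarith
    then have "(\<bar>t\<bar> * norm (?F t))\<^sup>2 \<le> M\<^sup>2" by (intro power_mono) auto
    moreover have "(norm (?F t))\<^sup>2 \<le> M\<^sup>2" by (intro power_mono FM) auto
    ultimately have "(1 + t\<^sup>2) * (norm (?F t))\<^sup>2 \<le> 2 * M\<^sup>2"
      by (simp add: power_mult_distrib algebra_simps)
    moreover have "0 < 1 + t\<^sup>2" by (simp add: add_pos_nonneg)
    ultimately show ?thesis by (simp add: field_simps)
  qed
  have "integrable lborel (\<lambda>t::real. inverse (1 + t\<^sup>2))"
    using integrable_inverse_1_plus_square by (simp add: set_integrable_def einterval_def)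
  then have "integrable lborel (\<lambda>t. 2 * M\<^sup>2 * inverse (1 + t\<^sup>2))" by (rule integrable_mult_right)
  then show int: "integrable lborel (\<lambda>t. (norm (?F t))\<^sup>2)"
    by (rule Bochner_Integration.integrable_bound) (use bd in \<open>auto intro!: AE_I2 simp: abs_of_nonneg add_pos_nonneg less_imp_le intro: order_trans[OF _ abs_ge_self]\<close>)
  let ?s = "\<lambda>m. inverse (real (Suc m))"
  let ?J = "\<lambda>s. LINT t|lborel. (norm (?F t))\<^sup>2 * ?E s t"
  have s0: "?s \<longlonglongrightarrow> 0" by (rule LIMSEQ_inverse_real_of_nat)
  have J1: "(\<lambda>m. ?J (?s m)) \<longlonglongrightarrow> (LINT t|lborel. (norm (?F t))\<^sup>2)"
  proof (rule integral_dominated_convergence[OF _ _ int])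
    show "AE t in lborel. (\<lambda>m. (norm (?F t))\<^sup>2 * ?E (?s m) t) \<longlonglongrightarrow> (norm (?F t))\<^sup>2"
    proof (rule AE_I2)
      fix t
      have "(\<lambda>m. (norm (?F t))\<^sup>2 * ?E (?s m) t) \<longlonglongrightarrow> (norm (?F t))\<^sup>2 * exp (- (0 * t)\<^sup>2 / 2)"
        by (intro tendsto_intros s0) auto
      then show "(\<lambda>m. (norm (?F t))\<^sup>2 * ?E (?s m) t) \<longlonglongrightarrow> (norm (?F t))\<^sup>2" by simp
    qed
    show "AE t in lborel. norm ((norm (?F t))\<^sup>2 * ?E (?s m) t) \<le> (norm (?F t))\<^sup>2" for m
      by (rule AE_I2) (auto simp: abs_mult intro!: mult_left_le)
  qed measurable
  let ?I = "\<lambda>s y. LINT u|lborel. g (y + s * u) * of_real (std_normal_density u)"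
  obtain B where B: "\<And>x. norm (g x) \<le> B" using bounded_g by blast
  have sd: "integrable lborel std_normal_density" by simp
  have iu: "integrable lborel (\<lambda>u. g (y + s * u) * of_real (std_normal_density u))" for s y
    by (rule Bochner_Integration.integrable_bound[OF integrable_mult_right[OF sd, of B]])
       (use B in \<open>auto intro!: AE_I2 mult_right_mono simp: norm_mult abs_mult intro: order_trans[OF B abs_ge_self]\<close>)
  have IB: "norm (?I s y) \<le> B" for s y
  proof -
    have "norm (?I s y) \<le> (LINT u|lborel. B * std_normal_density u)"
      by (rule order_trans[OF integral_norm_bound],
          rule integral_mono[OF integrable_norm[OF iu] integrable_mult_right[OF sd]])
         (use B in \<open>auto simp: norm_mult intro!: mult_right_mono\<close>)
    then show ?thesis by simp
  qed
  have Ilim: "(\<lambda>m. ?I (?s m) y) \<longlonglongrightarrow> g y" for y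
  proof -
    have "(\<lambda>m. ?I (?s m) y) \<longlonglongrightarrow> (LINT u|lborel. g y * of_real (std_normal_density u))"
    proof (rule integral_dominated_convergence[OF _ _ integrable_mult_right[OF sd, of B]])
      show "AE u in lborel. (\<lambda>m. g (y + ?s m * u) * of_real (std_normal_density u))
          \<longlonglongrightarrow> g y * of_real (std_normal_density u)"
      proof (rule AE_I2)
        fix u
        have "(\<lambda>m. y + ?s m * u) \<longlonglongrightarrow> y + 0 * u" by (intro tendsto_intros s0)
        then have "(\<lambda>m. g (y + ?s m * u)) \<longlonglongrightarrow> g y"
          by (intro continuous_on_tendsto_compose[OF cont]) auto
        then show "(\<lambda>m. g (y + ?s m * u) * of_real (std_normal_density u))
          \<longlonglongrightarrow> g y * of_real (std_normal_density u)" by (rule tendsto_mult_right)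
      qed
    qed (use B in \<open>auto intro!: AE_I2 mult_right_mono simp: norm_mult\<close>)
    then show ?thesis
      by (simp add: integral_mult_right_zero integral_complex_of_real)
  qed
  \<comment> \<open>One factor of the squared modulus is written out as an integral over y; after
    the exchange of integrals the inner one is the damped inversion integral at y.\<close>
  have J2: "of_real (?J s) = of_real (2 * pi) * (LINT y|lborel. cnj (g y) * ?I s y)" if s: "0 < s" for s
  proof -
    let ?f = "\<lambda>t y. cnj (g y) * (?F t * exp (- \<i> * of_real (t * y)) * of_real (?E s t))"
    have c: "cnj (?F t) = (LINT y|lborel. cnj (g y) * exp (- \<i> * of_real (t * y)))" for t
      unfolding fourier_def Bochner_Integration.integral_cnj[symmetric] by (simp add: exp_cnj mult_ac)
    have fi: "integrable (lborel \<Otimes>\<^sub>M lborel) (case_prod ?f)"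
    proof (rule lborel_pair.integrable_dominated_product[OF _ integrable_mult_right[OF integrable_gaussian[OF s], of M]
               integrable_norm[OF integrable_g]])
      show "case_prod ?f \<in> borel_measurable (lborel \<Otimes>\<^sub>M lborel)" by simp
      show "norm (?f t y) \<le> M * ?E s t * norm (g y)" for t y
        using mult_right_mono[OF FM[of t], of "?E s t * norm (g y)"] by (simp add: norm_mult mult_ac)
    qed
    have "complex_of_real (?J s) = (LINT t|lborel. complex_of_real ((norm (?F t))\<^sup>2 * ?E s t))"
      by (simp only: integral_complex_of_real)
    also have "\<dots> = (LINT t|lborel. LINT y|lborel. ?f t y)"
    proof (rule Bochner_Integration.integral_cong[OF refl])
      fix t
      have "of_real ((norm (?F t))\<^sup>2 * ?E s t) = ?F t * of_real (?E s t) * cnj (?F t)"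
        by (simp only: of_real_mult complex_norm_square) (simp add: mult_ac)
      also have "\<dots> = (LINT y|lborel. ?F t * of_real (?E s t) * (cnj (g y) * exp (- \<i> * of_real (t * y))))"
        by (simp only: c integral_mult_right_zero)
      finally show "of_real ((norm (?F t))\<^sup>2 * ?E s t) = (LINT y|lborel. ?f t y)"
        by (simp only: mult_ac)
    qed
    also have "\<dots> = (LINT y|lborel. LINT t|lborel. ?f t y)"
      by (rule lborel_pair.Fubini_integral[OF fi, symmetric])
    also have "\<dots> = (LINT y|lborel. of_real (2 * pi) * (cnj (g y) * ?I s y))"
      by (simp only: integral_mult_right_zero gaussian_inversion[OF s] mult.left_commute)
    finally show ?thesis by (simp only: integral_mult_right_zero)
  qed
  have "(\<lambda>m. LINT y|lborel. cnj (g y) * ?I (?s m) y) \<longlonglongrightarrow> (LINT y|lborel. cnj (g y) * g y)"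
  proof (rule integral_dominated_convergence[OF _ _ integrable_mult_right[OF integrable_norm[OF integrable_g], of B]])
    show "AE y in lborel. (\<lambda>m. cnj (g y) * ?I (?s m) y) \<longlonglongrightarrow> cnj (g y) * g y"
      by (intro AE_I2 tendsto_mult_left Ilim)
    show "AE y in lborel. norm (cnj (g y) * ?I (?s m) y) \<le> B * norm (g y)" for m
      using IB by (intro AE_I2) (auto simp: norm_mult mult.commute[of _ "norm (g _)"] intro!: mult_left_mono)
      have "(\<lambda>y. cnj (g y) * ?I (?s m) y) \<in> borel_measurable borel" for m by measurable
    then show "(\<lambda>y. cnj (g y) * ?I (?s m) y) \<in> borel_measurable lborel" for m by simp
    show "(\<lambda>y. cnj (g y) * g y) \<in> borel_measurable lborel" by simp
  qed
  then have "(\<lambda>m. of_real (2 * pi) * (LINT y|lborel. cnj (g y) * ?I (?s m) y))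
      \<longlonglongrightarrow> of_real (2 * pi) * (LINT y|lborel. cnj (g y) * g y)"
    by (rule tendsto_mult_left)
  moreover have "(LINT y|lborel. cnj (g y) * g y) = of_real (LINT y|lborel. (norm (g y))\<^sup>2)"
    by (subst integral_complex_of_real[symmetric]) (simp only: complex_norm_square mult.commute)
  moreover have "(\<lambda>m. complex_of_real (?J (?s m))) = (\<lambda>m. of_real (2 * pi) * (LINT y|lborel. cnj (g y) * ?I (?s m) y))"
    by (rule ext, rule J2) simp
  ultimately have "(\<lambda>m. complex_of_real (?J (?s m))) \<longlonglongrightarrow> of_real (2 * pi * (LINT y|lborel. (norm (g y))\<^sup>2))"
    by simp
  then have "(\<lambda>m. ?J (?s m)) \<longlonglongrightarrow> 2 * pi * (LINT y|lborel. (norm (g y))\<^sup>2)"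
    by (simp only: tendsto_of_real_iff)
  from LIMSEQ_unique[OF J1 this]
  show "(LINT t|lborel. (norm (?F t))\<^sup>2) = 2 * pi * (LINT x|lborel. (norm (g x))\<^sup>2)" .
qed

lemma cnj_bump: "C1_bump \<alpha> \<beta> (\<lambda>x. cnj (g x)) (\<lambda>x. cnj (g' x))"
  by unfold_locales
    (use less zero in \<open>auto intro!: has_vector_derivative_cnj deriv continuous_intros continuous_on_subset[OF cont']\<close>)

text \<open>Plancherel for the odd extension of \<open>g\<close>.\<close>
lemma sine_plancherel:
  assumes \<alpha>: "0 < \<alpha>"
  defines "B \<equiv> \<lambda>t. (fourier g (complex_of_real t) - fourier g (- complex_of_real t)) / (2 * \<i>)"
  shows "integrable lborel (\<lambda>t. (norm (B t))\<^sup>2)"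
    and "(LINT t|lborel. indicator {0<..} t * (norm (B t))\<^sup>2) = pi / 2 * (LINT x|lborel. (norm (g x))\<^sup>2)"
proof -
  \<comment> \<open>The transform of the odd extension is 2i times the sine transform
    \<open>B\<close>, on the whole real line.\<close>
  let ?G = "\<lambda>x. g x - g (- x)"
  have dm: "((\<lambda>x. g (- x)) has_vector_derivative - g' (- x)) (at x)" for x
  proof -
    have "(uminus has_vector_derivative -1) (at x)"
      by (auto intro!: derivative_eq_intros)
    from vector_diff_chain_at[OF this deriv] show ?thesis by (simp add: o_def)
  qed
  interpret G: C1_bump "- \<beta>" \<beta> ?G "\<lambda>x. g' x - (- g' (- x))"
  proof
    show "(?G has_vector_derivative g' x - (- g' (- x))) (at x)" for x
      by (intro has_vector_derivative_diff deriv dm)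
    show "continuous_on UNIV (\<lambda>x. g' x - (- g' (- x)))"
      by (intro continuous_intros continuous_on_compose2[OF cont']) auto
  qed (use less \<alpha> zero in auto)
  have "fourier (\<lambda>x. g (- x)) \<eta> = fourier g (- \<eta>)" for \<eta>
    unfolding fourier_def
    using lborel_integral_real_affine[of "-1" "\<lambda>x. g x * exp (\<i> * (- \<eta>) * of_real x)" 0] by simp
  moreover have "integrable lborel (\<lambda>x. g (- x) * exp (\<i> * \<eta> * of_real x))" for \<eta>
    using lborel_integrable_real_affine[OF integrable_exp[of "- \<eta>"], of "-1" 0] by simp
  ultimately have "fourier ?G \<eta> = fourier g \<eta> - fourier g (- \<eta>)" for \<eta>
    using integrable_exp[of \<eta>] by (simp add: fourier_def left_diff_distrib)
  then have GB: "(norm (fourier ?G (of_real t)))\<^sup>2 = 4 * (norm (B t))\<^sup>2" for t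
    by (simp add: B_def norm_divide norm_mult power_divide)
  show int: "integrable lborel (\<lambda>t. (norm (B t))\<^sup>2)"
    using G.plancherel(1) by (simp add: GB)
  have g2: "integrable lborel (\<lambda>x. (norm (g x))\<^sup>2)"
  proof -
    have "integrable lborel (\<lambda>x. g x * cnj (g x))"
      by (intro integrable_mult_cont cont zero continuous_intros continuous_on_subset[OF cont]) auto
    then have "integrable lborel (\<lambda>x. norm (g x * cnj (g x)))" by (rule integrable_norm)
    then show ?thesis by (simp add: norm_mult power2_eq_square)
  qed
  have g2m: "integrable lborel (\<lambda>x. (norm (g (- x)))\<^sup>2)"
    "(LINT x|lborel. (norm (g (- x)))\<^sup>2) = (LINT x|lborel. (norm (g x))\<^sup>2)"
    using lborel_integrable_real_affine[OF g2, of "-1" 0]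
      lborel_integral_real_affine[of "-1" "\<lambda>x. (norm (g x))\<^sup>2" 0] by auto
  \<comment> \<open>Since 0 < \<alpha>, at most one of x and -x lies in the support, so the square
    has no cross term.\<close>
  have "(norm (?G x))\<^sup>2 = (norm (g x))\<^sup>2 + (norm (g (- x)))\<^sup>2" for x
    using zero[of x] zero[of "- x"] \<alpha> by (cases "0 < x") auto
  then have "(LINT x|lborel. (norm (?G x))\<^sup>2) = 2 * (LINT x|lborel. (norm (g x))\<^sup>2)"
    using g2 g2m by simp
  then have tot: "(LINT t|lborel. (norm (B t))\<^sup>2) = pi * (LINT x|lborel. (norm (g x))\<^sup>2)"
    using G.plancherel(2) by (simp add: GB)
  let ?b = "\<lambda>t. (norm (B t))\<^sup>2"
  have i1: "integrable lborel (\<lambda>t. indicator {0<..} t * ?b t)"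
    by (rule Bochner_Integration.integrable_bound[OF int]) (use int in \<open>auto intro!: AE_I2 simp: indicator_def\<close>)
  have even: "?b (- t) = ?b t" for t
  proof -
    have "B (- t) = - B t"
      by (simp only: B_def of_real_minus minus_minus minus_divide_left minus_diff_eq)
    then show ?thesis by simp
  qed
  have i2: "integrable lborel (\<lambda>t. indicator {0<..} (- t) * ?b t)"
    "(LINT t|lborel. indicator {0<..} (- t) * ?b t) = (LINT t|lborel. indicator {0<..} t * ?b t)"
    using lborel_integrable_real_affine[OF i1, of "-1" 0]
      lborel_integral_real_affine[of "-1" "\<lambda>t. indicator {0<..} t * ?b t" 0] by (auto simp: even)
  have "(LINT t|lborel. ?b t) = (LINT t|lborel. indicator {0<..} t * ?b t + indicator {0<..} (- t) * ?b t)"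
  proof (rule integral_cong_AE)
    show "AE t in lborel. ?b t = indicator {0<..} t * ?b t + indicator {0<..} (- t) * ?b t"
      using AE_lborel_singleton[of 0] by eventually_elim (auto simp: indicator_def)
  qed (use int i1 i2 in auto)
  also have "\<dots> = 2 * (LINT t|lborel. indicator {0<..} t * ?b t)"
    using i1 i2 by simp
  finally show "(LINT t|lborel. indicator {0<..} t * ?b t) = pi / 2 * (LINT x|lborel. (norm (g x))\<^sup>2)"
    using tot by simp
qed

text \<open>The substitution \<mu> = c t^2 + a has Jacobian 2 c t, and the weight 1 / (c t) reduces
  it to the constant 2. This turns the pi / 2 of the half line into the pi by which
  \<open>sigma\<close> divides.\<close>

lemma sine_plancherel_spectral:
  fixes a c :: real
  assumes \<alpha>: "0 < \<alpha>" and c: "0 < c"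
  defines "B \<equiv> \<lambda>t. (fourier g (complex_of_real t) - fourier g (- complex_of_real t)) / (2 * \<i>)"
  defines "h \<equiv> \<lambda>\<mu>. (norm (B (sqrt ((\<mu> - a) / c))))\<^sup>2 / (c * sqrt ((\<mu> - a) / c))"
  shows "integrable lborel (\<lambda>\<mu>. indicator {a<..} \<mu> * h \<mu>)"
    and "(LINT \<mu>|lborel. indicator {a<..} \<mu> * h \<mu>) = pi * (LINT x|lborel. (norm (g x))\<^sup>2)"
proof -
  have sp: "integrable lborel (\<lambda>t. (norm (B t))\<^sup>2)"
    "(LINT t|lborel. indicator {0<..} t * (norm (B t))\<^sup>2) = pi / 2 * (LINT x|lborel. (norm (g x))\<^sup>2)"
    unfolding B_def by (rule sine_plancherel[OF \<alpha>])+
  have cB: "continuous_on UNIV B"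
    unfolding B_def
    by (intro continuous_intros continuous_on_compose2[OF continuous_fourier[of UNIV]]) auto
  have hg: "h (c * x\<^sup>2 + a) * (2 * c * x) = 2 * (norm (B x))\<^sup>2" if "0 < x" for x
  proof -
    have "sqrt ((c * x\<^sup>2 + a - a) / c) = x" using that c by simp
    then show ?thesis unfolding h_def using that c by simp
  qed
  have i1: "integrable lborel (\<lambda>t. indicator {0<..} t * (2 * (norm (B t))\<^sup>2))"
  proof (rule Bochner_Integration.integrable_bound[OF integrable_mult_right[OF sp(1), of 2]])
    have [measurable]: "(\<lambda>t. (norm (B t))\<^sup>2) \<in> borel_measurable borel" using sp(1) by auto
    show "(\<lambda>t. indicator {0<..} t * (2 * (norm (B t))\<^sup>2)) \<in> borel_measurable lborel" by simp
  qed (auto simp: indicator_def)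
  have si: "set_integrable lborel (einterval 0 \<infinity>) (\<lambda>x. h (c * x\<^sup>2 + a) * (2 * c * x))"
    unfolding set_integrable_def
  proof (rule iffD1[OF Bochner_Integration.integrable_cong i1])
    show "indicator {0<..} x * (2 * (norm (B x))\<^sup>2)
        = indicator (einterval 0 \<infinity>) x *\<^sub>R (h (c * x\<^sup>2 + a) * (2 * c * x))" for x
      using hg[of x] by (cases "0 < x") (auto simp: einterval_def indicator_def zero_ereal_def)
  qed simp
  have sub: "set_integrable lborel (einterval (ereal a) \<infinity>) h"
    "(LBINT x=ereal a..\<infinity>. h x) = (LBINT x=0..\<infinity>. h (c * x\<^sup>2 + a) * (2 * c * x))"
  proof -
    have A: "((ereal \<circ> (\<lambda>x. c * x\<^sup>2 + a) \<circ> real_of_ereal) \<longlongrightarrow> ereal a) (at_right 0)"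
      unfolding zero_ereal_def ereal_tendsto_simps
    proof -
      have "((\<lambda>x. c * x\<^sup>2 + a) \<longlongrightarrow> c * 0\<^sup>2 + a) (at_right 0)" by (intro tendsto_intros)
      then show "((\<lambda>x. c * x\<^sup>2 + a) \<longlongrightarrow> a) (at_right 0)" by simp
    qed
    have Binf: "((ereal \<circ> (\<lambda>x. c * x\<^sup>2 + a) \<circ> real_of_ereal) \<longlongrightarrow> \<infinity>) (at_left \<infinity>)"
      unfolding ereal_tendsto_simps
      using c by real_asymp
    note * = interval_integral_substitution_nonneg[OF _ _ _ _ _ _ A Binf si]
    have d: "DERIV (\<lambda>x. c * x\<^sup>2 + a) x :> 2 * c * x" for x
      by (auto intro!: derivative_eq_intros)
    have ch: "isCont h (c * x\<^sup>2 + a)" if "0 < ereal x" for x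
    proof -
      have x: "0 < x" using that by (simp add: zero_ereal_def)
      have "open {a<..}" by simp
      moreover have "continuous_on {a<..} h"
        unfolding h_def using c
        by (intro continuous_intros continuous_on_compose2[OF cB]) auto
      moreover have "c * x\<^sup>2 + a \<in> {a<..}" using x c by simp
      ultimately show ?thesis by (simp add: continuous_on_eq_continuous_at)
    qed
    have hn: "0 \<le> h (c * x\<^sup>2 + a)" if "0 < ereal x" for x
      using that c by (auto simp: h_def zero_ereal_def intro!: divide_nonneg_nonneg)
    show "set_integrable lborel (einterval (ereal a) \<infinity>) h"
      "(LBINT x=ereal a..\<infinity>. h x) = (LBINT x=0..\<infinity>. h (c * x\<^sup>2 + a) * (2 * c * x))"
      by (rule *; use d ch hn c in \<open>auto intro!: continuous_intros simp: zero_ereal_def\<close>)+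
  qed
  show "integrable lborel (\<lambda>\<mu>. indicator {a<..} \<mu> * h \<mu>)"
    using sub(1) by (simp add: set_integrable_def einterval_def greaterThan_def)
  have "(LINT \<mu>|lborel. indicator {a<..} \<mu> * h \<mu>) = (LBINT x=ereal a..\<infinity>. h x)"
    by (simp add: interval_lebesgue_integral_def set_lebesgue_integral_def einterval_def greaterThan_def)
  also have "\<dots> = (LINT t|lborel. indicator {0<..} t * (2 * (norm (B t))\<^sup>2))"
    unfolding sub(2)
  proof -
    have "indicator (einterval 0 \<infinity>) x *\<^sub>R (h (c * x\<^sup>2 + a) * (2 * c * x))
        = indicator {0<..} x * (2 * (norm (B x))\<^sup>2)" for x
      using hg[of x] by (cases "0 < x") (auto simp: einterval_def indicator_def zero_ereal_def)
    then show "(LBINT x=0..\<infinity>. h (c * x\<^sup>2 + a) * (2 * c * x))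
        = (LINT t|lborel. indicator {0<..} t * (2 * (norm (B t))\<^sup>2))"
      by (simp only: interval_lebesgue_integral_def set_lebesgue_integral_def) simp
  qed
  also have "\<dots> = 2 * (LINT t|lborel. indicator {0<..} t * (norm (B t))\<^sup>2)"
    by (simp add: mult.left_commute)
  finally show "(LINT \<mu>|lborel. indicator {a<..} \<mu> * h \<mu>) = pi * (LINT x|lborel. (norm (g x))\<^sup>2)"
    using sp(2) by simp
qed

end


subsection \<open>Integrals over the boundary of a half plane\<close>

text \<open>The antiderivative on the positive axis is 2 arctan (sqrt x). The kernel combines the
  singularity of 1/W at the bottom of the spectrum with the decay |x|^(-3/2) at infinity.\<close>

lemma integrable_inverse_sqrt_kernel:
  "integrable lborel (\<lambda>x::real. 1 / (sqrt \<bar>x - a\<bar> * (1 + \<bar>x - a\<bar>)))"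
proof -
  let ?g = "\<lambda>x::real. 1 / (sqrt \<bar>x\<bar> * (1 + \<bar>x\<bar>))"
  have "set_integrable lborel (einterval 0 \<infinity>) (\<lambda>x::real. 1 / (sqrt x * (1 + x)))"
  proof (rule interval_integral_FTC_nonneg(1))
    show "DERIV (\<lambda>x. 2 * arctan (sqrt x)) x :> 1 / (sqrt x * (1 + x))"
      if "0 < ereal x" "ereal x < \<infinity>" for x
    proof -
      from that have x: "0 < x" by (simp add: zero_ereal_def)
      have "DERIV (\<lambda>x. 2 * arctan (sqrt x)) x :> 2 * (inverse (1 + (sqrt x)\<^sup>2) * (inverse (sqrt x) / 2))"
        using x by (auto intro!: derivative_eq_intros)
      also have "2 * (inverse (1 + (sqrt x)\<^sup>2) * (inverse (sqrt x) / 2)) = 1 / (sqrt x * (1 + x))"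
        using x by (simp add: inverse_eq_divide)
      finally show ?thesis .
    qed
    show "isCont (\<lambda>x. 1 / (sqrt x * (1 + x))) x"
      if "0 < ereal x" "ereal x < \<infinity>" for x
      using that by (intro continuous_intros) (auto simp: zero_ereal_def)
    show "(((\<lambda>x. 2 * arctan (sqrt x)) \<circ> real_of_ereal) \<longlongrightarrow> 2 * arctan (sqrt 0)) (at_right 0)"
      unfolding zero_ereal_def ereal_tendsto_simps
      by (intro tendsto_intros)
    have "((\<lambda>x. arctan (sqrt x)) \<longlongrightarrow> pi / 2) at_top"
      using filterlim_compose[OF tendsto_arctan_at_top sqrt_at_top] .
    then have "((\<lambda>x. 2 * arctan (sqrt x)) \<longlongrightarrow> 2 * (pi / 2)) at_top"
      by (intro tendsto_intros)
    then show "(((\<lambda>x. 2 * arctan (sqrt x)) \<circ> real_of_ereal) \<longlongrightarrow> 2 * (pi / 2)) (at_left \<infinity>)"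
      unfolding ereal_tendsto_simps .
  qed (auto simp: zero_ereal_def)
  then have 1: "integrable lborel (\<lambda>x. indicator {0<..} x * ?g x)"
    unfolding set_integrable_def
    by (rule integrable_cong_AE_imp)
       (auto simp: einterval_def indicator_def zero_ereal_def intro!: AE_I2)
  then have "integrable lborel (\<lambda>x. indicator {0<..} (0 + (-1) * x) * ?g (0 + (-1) * x))"
    by (rule lborel_integrable_real_affine) simp
  from Bochner_Integration.integrable_add[OF 1 this]
  have "integrable lborel ?g"
    by (rule integrable_cong_AE_imp) (auto simp: indicator_def intro!: AE_I2)
  from lborel_integrable_real_affine[OF this, of 1 "-a"] show ?thesis
    by simp
qed

text \<open>Cauchy's theorem is applied on horizontal segments above the axis, where h is
  holomorphic, closed by half circles. The axis itself is reached by dominated convergence, since h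
  is only continuous there and may blow up at a.\<close>

lemma half_plane_integral:
  fixes h :: "complex \<Rightarrow> complex" and a C :: real
  assumes hol: "h holomorphic_on {z. 0 < Im z}"
    and cont: "continuous_on ({z. 0 \<le> Im z} - {of_real a}) h"
    and bd: "\<And>z. 0 \<le> Im z \<Longrightarrow> z \<noteq> of_real a \<Longrightarrow>
               norm (h z) \<le> C / (sqrt (norm (z - of_real a)) * (1 + norm (z - of_real a)))"
  shows "integrable lborel (\<lambda>x. h (of_real x))"
    and "(LINT x|lborel. h (of_real x)) = 0"
proof -
  have C: "0 \<le> C"
  proof -
    have "0 \<le> norm (h (of_real a + 1))" by simp
    also have "\<dots> \<le> C / 2" using bd[of "of_real a + 1"] by simp
    finally show ?thesis by simp
  qed
  let ?G = "\<lambda>x::real. C * (1 / (sqrt \<bar>x - a\<bar> * (1 + \<bar>x - a\<bar>)))"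
  have Gint: "integrable lborel ?G"
    by (intro integrable_mult_right integrable_inverse_sqrt_kernel)
  \<comment> \<open>The kernel decreases in the distance to a, so replacing that distance by |x - a|
    gives one majorant for all heights y.\<close>
  have kmono: "C / (sqrt s * (1 + s)) \<le> C / (sqrt r * (1 + r))" if "0 < r" "r \<le> s" for r s
    using that C by (intro divide_left_mono mult_mono mult_pos_pos) auto
  have bdG: "norm (h (of_real x + \<i> * of_real y)) \<le> ?G x" if "0 \<le> y" "x \<noteq> a" for x y
  proof -
    have "\<bar>x - a\<bar> \<le> norm (of_real x + \<i> * of_real y - of_real a)"
      using abs_Re_le_cmod[of "of_real x + \<i> * of_real y - of_real a"] by simp
    from kmono[OF _ this] bd[of "of_real x + \<i> * of_real y"] that
    show ?thesis by (force simp: complex_eq_iff)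
  qed
  have meas: "(\<lambda>x. h (of_real x + \<i> * of_real y)) \<in> borel_measurable lborel" if "0 \<le> y" for y
  proof -
    have "(\<lambda>x. h (of_real x + \<i> * of_real y)) \<in> borel_measurable borel"
      by (rule borel_measurable_continuous_countable_exceptions[of "{a}"])
         (use that in \<open>auto intro!: continuous_intros continuous_on_compose2[OF cont] simp: complex_eq_iff\<close>)
    then show ?thesis by simp
  qed
  have AEa: "AE x in lborel. x \<noteq> a" using AE_lborel_singleton .
  have int: "integrable lborel (\<lambda>x. h (of_real x + \<i> * of_real y))" if "0 \<le> y" for y
    by (rule Bochner_Integration.integrable_bound[OF Gint meas[OF that]])
       (use AEa in eventually_elim, use bdG[OF that] C in \<open>auto\<close>)
  from int[of 0] show "integrable lborel (\<lambda>x. h (of_real x))" by simp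
  have zero: "(LINT x|lborel. h (of_real x + \<i> * of_real y)) = 0" if y: "0 < y" for y
  proof -
    let ?k = "\<lambda>z. h (z + \<i> * of_real y)"
    let ?S = "{z. - y < Im z}"
    have hk: "?k holomorphic_on ?S"
    proof -
      have "h \<circ> (\<lambda>z. z + \<i> * of_real y) holomorphic_on ?S"
        by (rule holomorphic_on_compose_gen[OF _ hol]) (auto intro!: holomorphic_intros)
      then show ?thesis by (simp add: o_def)
    qed
    have cS: "convex ?S" by (simp add: convex_halfspace_Im_gt)
    \<comment> \<open>The half circle has length R pi and the kernel is of order R^(-3/2) on it, so
      the bound is of order R^(-1/2).\<close>
    have est: "norm (integral {a - R..a + R} (\<lambda>x. h (of_real x + \<i> * of_real y)))
        \<le> C / (sqrt R * (1 + R)) * R * pi" if R: "0 < R" for R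
    proof -
      let ?l = "linepath (of_real (a - R)) (of_real (a + R))"
      let ?p = "part_circlepath (of_real a) R 0 pi"
      have Imp: "0 \<le> Im z" "norm (z - of_real a) = R" if "z \<in> path_image ?p" for z
        using that R by (auto simp: path_image_part_circlepath closed_segment_eq_real_ivl
            Im_exp sin_ge_zero norm_mult)
      have pp: "path_image ?p \<subseteq> ?S" using Imp y by force
      have pl: "path_image ?l \<subseteq> ?S"
      proof -
        have "closed_segment (of_real (a - R)) (of_real (a + R)) \<subseteq> ?S"
          using closed_segment_subset[OF _ _ cS] y by force
        then show ?thesis by simp
      qed
      have fin: "pathfinish ?l = pathstart ?p" "pathfinish ?p = pathstart ?l"
        by (auto simp: exp_eq_polar)
      have "(?k has_contour_integral 0) (?l +++ ?p)"
      proof (rule Cauchy_theorem_convex_simple[OF hk cS])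
        show "valid_path (?l +++ ?p)" using fin by (intro valid_path_join) auto
        show "path_image (?l +++ ?p) \<subseteq> ?S"
          using path_image_join_subset[of ?l ?p] pp pl by blast
        show "pathfinish (?l +++ ?p) = pathstart (?l +++ ?p)" using fin by auto
      qed
      then have "contour_integral (?l +++ ?p) ?k = 0"
        by (rule contour_integral_unique)
      moreover have oS: "open ?S" by (simp add: open_halfspace_Im_gt)
      have il: "?k contour_integrable_on ?l" 
        by (rule contour_integrable_holomorphic_simple[OF hk oS _ pl]) simp
      have ip: "?k contour_integrable_on ?p"
        by (rule contour_integrable_holomorphic_simple[OF hk oS _ pp]) simp
      ultimately have "contour_integral ?l ?k = - contour_integral ?p ?k"
        using contour_integral_join[OF il ip] by (simp add: eq_neg_iff_add_eq_0)
      moreover have "contour_integral ?l ?k = integral {a - R..a + R} (\<lambda>x. ?k (of_real x))"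
        by (subst contour_integral_linepath_Reals_eq) (use R in auto)
      moreover have "norm (contour_integral ?p ?k) \<le> C / (sqrt R * (1 + R)) * R * \<bar>pi - 0\<bar>"
      proof (rule contour_integral_bound_part_circlepath[OF ip])
        fix z assume "z \<in> path_image ?p"
        note z = Imp[OF this]
        have "R\<^sup>2 \<le> (norm (z + \<i> * of_real y - of_real a))\<^sup>2"
          unfolding z(2)[symmetric] cmod_power2 using z(1) y by (auto intro!: power_mono)
        then have le: "R \<le> norm (z + \<i> * of_real y - of_real a)"
          by (rule power2_le_imp_le) simp
        have "norm (?k z) \<le> C / (sqrt (norm (z + \<i> * of_real y - of_real a)) *
              (1 + norm (z + \<i> * of_real y - of_real a)))"
          using z y by (intro bd) (auto simp: complex_eq_iff)
        also have "\<dots> \<le> C / (sqrt R * (1 + R))" using kmono[OF R le] .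
        finally show "norm (?k z) \<le> C / (sqrt R * (1 + R))" .
      qed (use R C in auto)
      ultimately show ?thesis using pi_gt_zero by (simp only: norm_minus_cancel diff_zero abs_of_pos)
    qed
    let ?f = "\<lambda>x. h (of_real x + \<i> * of_real y)"
    have eqI: "integral {a - R..a + R} ?f = (LINT x|lborel. indicator {a - R..a + R} x *\<^sub>R ?f x)" for R
    proof -
      have "set_integrable lborel {a - R..a + R} ?f"
      proof -
        have "set_integrable lborel UNIV ?f" using int[of y] y by (simp add: set_integrable_def)
        then show ?thesis by (rule set_integrable_subset) auto
      qed
      from set_borel_integral_eq_integral(2)[OF this] show ?thesis
        by (simp add: set_lebesgue_integral_def)
    qed
    have l1: "(\<lambda>m. integral {a - real m..a + real m} ?f) \<longlonglongrightarrow> (LINT x|lborel. ?f x)"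
      unfolding eqI
    proof (rule integral_dominated_convergence[where w="\<lambda>x. norm (?f x)"])
      show "AE x in lborel. (\<lambda>m. indicator {a - real m..a + real m} x *\<^sub>R ?f x) \<longlonglongrightarrow> ?f x"
      proof (rule AE_I2)
        fix x
        have "\<forall>\<^sub>F m in sequentially. indicator {a - real m..a + real m} x *\<^sub>R ?f x = ?f x"
          using eventually_ge_at_top[of "nat \<lceil>\<bar>x - a\<bar>\<rceil>"]
        proof eventually_elim
          case (elim m)
          then have "\<bar>x - a\<bar> \<le> real m" by linarith
          then have "x \<in> {a - real m..a + real m}" by (auto simp: abs_le_iff)
          then show ?case by simp
        qed
        then show "(\<lambda>m. indicator {a - real m..a + real m} x *\<^sub>R ?f x) \<longlonglongrightarrow> ?f x"
          by (rule tendsto_eventually)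
      qed
      show "integrable lborel (\<lambda>x. norm (?f x))" using int[of y] y by auto
      show "(\<lambda>x. indicator {a - real m..a + real m} x *\<^sub>R ?f x) \<in> borel_measurable lborel" for m
        using meas[of y] y by auto
    qed (use meas[of y] y in \<open>auto simp: indicator_def\<close>)
    have l2: "(\<lambda>m. integral {a - real m..a + real m} ?f) \<longlonglongrightarrow> 0"
    proof (rule Lim_null_comparison)
      show "\<forall>\<^sub>F m in sequentially. norm (integral {a - real m..a + real m} ?f)
              \<le> C * pi * (1 / sqrt (real m))"
        using eventually_gt_at_top[of 0]
      proof eventually_elim
        case (elim m)
        have "C / (sqrt (real m) * (1 + real m)) * real m * pi
           = C * pi * (1 / sqrt (real m)) * (real m / (1 + real m))"
          using elim by (simp add: field_simps)
        also have "\<dots> \<le> C * pi * (1 / sqrt (real m)) * 1"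
          using C by (intro mult_left_mono) auto
        finally show ?case using est[of "real m"] elim by simp
      qed
      have "(\<lambda>m. 1 / sqrt (real m)) \<longlonglongrightarrow> 0"
        using filterlim_compose[OF sqrt_at_top filterlim_real_sequentially]
        by (intro tendsto_divide_0[OF tendsto_const] filterlim_at_top_imp_at_infinity)
      from tendsto_mult_right[OF this, of "C * pi"]
      show "(\<lambda>m. C * pi * (1 / sqrt (real m))) \<longlonglongrightarrow> 0" by simp
    qed
    show ?thesis using LIMSEQ_unique[OF l1 l2] .
  qed
  have "(\<lambda>m. LINT x|lborel. h (of_real x + \<i> * of_real (inverse (real (Suc m)))))
          \<longlonglongrightarrow> (LINT x|lborel. h (of_real x))"
  proof (rule integral_dominated_convergence[OF _ _ Gint])
    show "AE x in lborel. (\<lambda>m. h (of_real x + \<i> * of_real (inverse (real (Suc m))))) \<longlonglongrightarrow> h (of_real x)"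
      using AEa
    proof eventually_elim
      case (elim x)
      show ?case
      proof (rule continuous_on_tendsto_compose[OF cont])
        have "(\<lambda>m. of_real x + \<i> * of_real (inverse (real (Suc m)))) \<longlonglongrightarrow>
                complex_of_real x + \<i> * of_real 0"
          by (intro tendsto_intros LIMSEQ_inverse_real_of_nat)
        then show "(\<lambda>m. of_real x + \<i> * of_real (inverse (real (Suc m)))) \<longlonglongrightarrow> complex_of_real x"
          by simp
      qed (use elim in \<open>auto simp: complex_eq_iff\<close>)
    qed
    show "(\<lambda>x. h (complex_of_real x)) \<in> borel_measurable lborel"
      using meas[of 0] by simp
    show "(\<lambda>x. h (of_real x + \<i> * of_real (inverse (real (Suc m))))) \<in> borel_measurable lborel" for m
      by (rule meas) simp
    show "AE x in lborel. norm (h (of_real x + \<i> * of_real (inverse (real (Suc m))))) \<le> ?G x" for m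
      using AEa by eventually_elim (rule bdG, auto)
  qed
  moreover have "(LINT x|lborel. h (of_real x + \<i> * of_real (inverse (real (Suc m))))) = 0" for m
    by (rule zero) simp
  ultimately show "(LINT x|lborel. h (of_real x)) = 0"
    by (simp only: LIMSEQ_const_iff)
qed


subsection \<open>The isometry on test functions\<close>

text \<open>The coordinate formula is visibly continuous up to the negative axis: the principal
  branch takes there its limit from above, so no cut is met in the closed upper half plane.\<close>

lemma csqrt_upper:
  assumes "0 \<le> Im z"
  shows "csqrt z = Complex (sqrt ((cmod z + Re z) / 2)) (sqrt ((cmod z - Re z) / 2))"
  using assms by (auto simp: csqrt.simps complex_eq_iff sgn_if)

lemma continuous_on_csqrt_upper: "continuous_on {z. 0 \<le> Im z} csqrt"
proof -
  have "continuous_on {z. 0 \<le> Im z}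
     (\<lambda>z. Complex (sqrt ((cmod z + Re z) / 2)) (sqrt ((cmod z - Re z) / 2)))"
    by (intro continuous_intros) auto
  then show ?thesis
    by (rule continuous_on_eq) (simp add: csqrt_upper)
qed

lemma csqrt_upper_nonneg: "0 \<le> Re (csqrt z)" "0 \<le> Im z \<Longrightarrow> 0 \<le> Im (csqrt z)"
  using abs_Re_le_cmod[of z] by (auto simp: csqrt_upper Re_csqrt)

text \<open>On the negative axis the two branches give -i sqrt |x| and i sqrt |x|; on the positive
  axis they agree and are real.\<close>

lemma nsqrt_of_real: "nsqrt (of_real x) = cnj (csqrt (of_real x))"
proof (cases "0 \<le> x")
  case True
  then show ?thesis by (cases "x = 0") (auto simp: nsqrt_def)
next
  case False
  then have "nsqrt (of_real x) = of_real (sqrt (- x)) * cis (- pi / 2)"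
    by (simp add: nsqrt_def)
  moreover have "cis (- pi / 2) = - \<i>" by (simp add: cis.ctr complex_eq_iff)
  ultimately show ?thesis
    using False csqrt_of_real_nonpos[of "of_real x"] by simp
qed

definition eta :: "(nat \<Rightarrow> real) \<Rightarrow> (nat \<Rightarrow> real) \<Rightarrow> nat \<Rightarrow> complex \<Rightarrow> complex" where
  "eta c a k z = csqrt ((z - of_real (a k)) / of_real (c k))"

definition eta_sum :: "nat \<Rightarrow> (nat \<Rightarrow> real) \<Rightarrow> (nat \<Rightarrow> real) \<Rightarrow> complex \<Rightarrow> complex" where
  "eta_sum n c a z = (\<Sum>j=1..n. of_real (c j) * eta c a j z)"

section \<open>Boundary values of the spectral quantities\<close>

locale network =
  fixes n :: nat and c a :: "nat \<Rightarrow> real"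
  assumes n: "1 \<le> n" and c: "k \<in> {1..n} \<Longrightarrow> 0 < c k" and a: "k \<in> {1..n} \<Longrightarrow> a 1 \<le> a k"
begin

abbreviation "\<eta> \<equiv> eta c a"
abbreviation "W \<equiv> eta_sum n c a"

lemma one: "1 \<in> {1..n}" using n by simp

lemma xi_eq: "xi c a k (of_real \<mu>) = cnj (\<eta> k (of_real \<mu>))"
  using nsqrt_of_real[of "(\<mu> - a k) / c k"] by (simp add: xi_def eta_def)

lemma w_eq: "w n c a \<mu> = - \<i> * cnj (W (of_real \<mu>))"
  by (simp add: w_def eta_sum_def xi_eq)

lemma sigma_eq_eta: "sigma n c a k \<mu> = c k * Re (\<eta> k (of_real \<mu>)) / (cmod (W (of_real \<mu>)))\<^sup>2 / pi"
  by (simp add: sigma_def w_eq xi_eq norm_mult)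

text \<open>All components share the wave exp(i \<eta>_j x). Completing the sum in
  \<open>s_coeff\<close> to W gives cnj s_k = 1 - W / (c_k \<eta>_k), so only branch k carries a
  sine correction.\<close>

lemma cnj_F_minus:
  assumes k: "k \<in> {1..n}"
  shows "cnj (F_minus n c a k (of_real \<mu>) j x) =
     exp (\<i> * \<eta> j (of_real \<mu>) * of_real x) -
     (if j = k then \<i> * (W (of_real \<mu>) / (of_real (c k) * \<eta> k (of_real \<mu>)))
        * sin (\<eta> k (of_real \<mu>) * of_real x) else 0)"
proof (cases "j = k")
  case False
  then show ?thesis by (simp add: F_minus_def xi_eq exp_cnj)
next
  case True
  let ?e = "\<eta> k (of_real \<mu>)"
  have ex: "exp (\<i> * ?e * of_real x) = cos (?e * of_real x) + \<i> * sin (?e * of_real x)"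
    by (simp add: exp_Euler mult.assoc)
  show ?thesis
  \<comment> \<open>For \<open>?e = 0\<close> the quotients in \<open>s_coeff\<close> and in the
    claim are 0 by the convention on division, and the sine vanishes; both sides are 1.\<close>
  proof (cases "?e = 0")
    case False
    have "W (of_real \<mu>) = of_real (c k) * ?e + (\<Sum>l\<in>{1..n} - {k}. of_real (c l) * \<eta> l (of_real \<mu>))"
      unfolding eta_sum_def using k by (simp add: sum.remove)
    then have "cnj (s_coeff n c a k (of_real \<mu>)) = 1 - W (of_real \<mu>) / (of_real (c k) * ?e)"
      using False c[OF k] by (simp add: s_coeff_def xi_eq field_simps)
    moreover have "cnj (F_minus n c a k (of_real \<mu>) j x) = cos (?e * of_real x)
        + \<i> * cnj (s_coeff n c a k (of_real \<mu>)) * sin (?e * of_real x)"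
      using True by (simp add: F_minus_def xi_eq cnj_cos cnj_sin)
    ultimately show ?thesis
      unfolding True ex by (simp only: if_True) (simp add: ring_distribs mult_ac)
  qed (use True in \<open>simp add: F_minus_def xi_eq\<close>)
qed

lemma eta_arg_upper: "k \<in> {1..n} \<Longrightarrow> 0 \<le> Im z \<Longrightarrow> 0 \<le> Im ((z - of_real (a k)) / of_real (c k))"
  using c[of k] by simp

lemma eta_nonneg: "0 \<le> Re (\<eta> k z)" "k \<in> {1..n} \<Longrightarrow> 0 \<le> Im z \<Longrightarrow> 0 \<le> Im (\<eta> k z)"
  unfolding eta_def by (rule csqrt_upper_nonneg, rule csqrt_upper_nonneg(2)[OF eta_arg_upper])

lemma continuous_eta: "k \<in> {1..n} \<Longrightarrow> continuous_on {z. 0 \<le> Im z} (\<eta> k)"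
  unfolding eta_def using c[of k]
  by (intro continuous_on_compose2[OF continuous_on_csqrt_upper] continuous_intros) auto

lemma holomorphic_eta: "k \<in> {1..n} \<Longrightarrow> \<eta> k holomorphic_on {z. 0 < Im z}"
  unfolding eta_def using c[of k]
  by (intro holomorphic_on_csqrt' holomorphic_intros) (auto simp: complex_nonpos_Reals_iff)

lemma norm_eta: "k \<in> {1..n} \<Longrightarrow> norm (\<eta> k z) = sqrt (norm (z - of_real (a k)) / c k)"
  using c[of k] by (simp add: eta_def norm_divide)

text \<open>Every \<eta>_j lies in the closed first quadrant, so real and imaginary parts add up
  without cancellation and branch 1 alone bounds |W| from below.\<close>

lemma norm_W_ge:
  assumes z: "0 \<le> Im z"
  shows "sqrt (c 1) * sqrt (norm (z - of_real (a 1))) \<le> norm (W z)"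
proof -
  have c1: "0 < c 1" using c[OF one] .
  have r: "c 1 * Re (\<eta> 1 z) \<le> Re (W z)"
    using member_le_sum[OF one, of "\<lambda>j. c j * Re (\<eta> j z)"] eta_nonneg(1) c
    by (simp add: eta_sum_def less_imp_le)
  have i: "c 1 * Im (\<eta> 1 z) \<le> Im (W z)"
    using member_le_sum[OF one, of "\<lambda>j. c j * Im (\<eta> j z)"] eta_nonneg(2)[OF _ z] c
    by (simp add: eta_sum_def less_imp_le)
  have "(c 1 * norm (\<eta> 1 z))\<^sup>2 = (c 1 * Re (\<eta> 1 z))\<^sup>2 + (c 1 * Im (\<eta> 1 z))\<^sup>2"
    by (simp add: power_mult_distrib cmod_power2 algebra_simps)
  also have "\<dots> \<le> (Re (W z))\<^sup>2 + (Im (W z))\<^sup>2"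
    using r i eta_nonneg(1) eta_nonneg(2)[OF one z] c1 by (intro add_mono power_mono) auto
  also have "\<dots> = (norm (W z))\<^sup>2" by (simp add: cmod_power2)
  finally have "c 1 * norm (\<eta> 1 z) \<le> norm (W z)"
    by (rule power2_le_imp_le) simp
  moreover have "c 1 * norm (\<eta> 1 z) = sqrt (c 1) * sqrt (norm (z - of_real (a 1)))"
  proof -
    have "c 1 * sqrt (d / c 1) = c 1 / sqrt (c 1) * sqrt d" for d
      by (simp add: real_sqrt_divide)
    also have "c 1 / sqrt (c 1) = sqrt (c 1)" using c1 by (intro real_div_sqrt) simp
    finally show ?thesis unfolding norm_eta[OF one] .
  qed
  ultimately show ?thesis by simp
qed

lemma W_nonzero: "0 \<le> Im z \<Longrightarrow> z \<noteq> of_real (a 1) \<Longrightarrow> W z \<noteq> 0"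
  using norm_W_ge[of z] c[OF one] by (auto simp: mult_le_0_iff)

lemma eta_active: "k \<in> {1..n} \<Longrightarrow> a k \<le> \<mu> \<Longrightarrow> \<eta> k (of_real \<mu>) = of_real (sqrt ((\<mu> - a k) / c k))"
  using c[of k] csqrt_of_real_nonneg[of "of_real ((\<mu> - a k) / c k)"] by (simp add: eta_def)

lemma eta_inactive: "k \<in> {1..n} \<Longrightarrow> \<mu> \<le> a k \<Longrightarrow> Re (\<eta> k (of_real \<mu>)) = 0"
  using c[of k] csqrt_of_real_nonpos[of "of_real ((\<mu> - a k) / c k)"]
  by (simp add: eta_def divide_nonpos_pos)

lemma sigma_nonneg: "k \<in> {1..n} \<Longrightarrow> 0 \<le> sigma n c a k \<mu>"
  using c[of k] eta_nonneg(1) by (simp add: sigma_eq_eta)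

lemma sigma_inactive: "k \<in> {1..n} \<Longrightarrow> \<mu> \<le> a k \<Longrightarrow> sigma n c a k \<mu> = 0"
  by (simp add: sigma_eq_eta eta_inactive)

lemma sigma_pos: "k \<in> {1..n} \<Longrightarrow> a k < \<mu> \<Longrightarrow> 0 < sigma n c a k \<mu>"
  using c[of k] a[of k] W_nonzero[of "of_real \<mu>"]
  by (simp add: sigma_eq_eta eta_active)

lemma continuous_eta_real: "k \<in> {1..n} \<Longrightarrow> continuous_on UNIV (\<lambda>\<mu>. \<eta> k (of_real \<mu>))"
  by (rule continuous_on_compose2[OF continuous_eta]) (auto intro!: continuous_intros)

lemma measurable_eta: "k \<in> {1..n} \<Longrightarrow> (\<lambda>\<mu>. \<eta> k (of_real \<mu>)) \<in> borel_measurable borel"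
  by (intro borel_measurable_continuous_onI continuous_eta_real)

lemma measurable_W: "(\<lambda>\<mu>. W (of_real \<mu>)) \<in> borel_measurable borel"
  unfolding eta_sum_def
  by (intro borel_measurable_sum borel_measurable_times measurable_eta) auto

lemma measurable_sigma: "k \<in> {1..n} \<Longrightarrow> sigma n c a k \<in> borel_measurable borel"
  unfolding sigma_eq_eta[abs_def] using measurable_eta measurable_W by measurable

end

section \<open>Algebra of the pointwise spectral identity\<close>

text \<open>Here q stands for c_k \<eta>_k on an active branch. In the cross term q cancels and B
  enters linearly, so the cross terms of all branches combine into one that contains only the sum of
  the B_k.\<close>

lemma norm_square_expand:
  fixes A B W :: complex and q :: real
  assumes "0 < q" "W \<noteq> 0"
  shows "q / (cmod W)\<^sup>2 * (cmod (A - \<i> * (W / of_real q) * B))\<^sup>2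
       = q * (cmod A)\<^sup>2 / (cmod W)\<^sup>2 + 2 * Re (- \<i> * cnj A * B / cnj W) + (cmod B)\<^sup>2 / q"
proof -
  have "complex_of_real (q / (cmod W)\<^sup>2 * (cmod (A - \<i> * (W / of_real q) * B))\<^sup>2)
      = of_real q / (W * cnj W) * ((A - \<i> * (W / of_real q) * B) * (cnj A + \<i> * (cnj W / of_real q) * cnj B))"
    by (simp only: of_real_mult of_real_divide complex_norm_square) simp
  also have "\<dots> = of_real q * (A * cnj A) / (W * cnj W) + (- \<i> * cnj A * B / cnj W + \<i> * A * cnj B / W)
      + B * cnj B / of_real q"
    using assms by (simp add: field_simps)
  also have "- \<i> * cnj A * B / cnj W + \<i> * A * cnj B / W = of_real (2 * Re (- \<i> * cnj A * B / cnj W))"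
    unfolding complex_add_cnj[symmetric] by simp
  finally show ?thesis
    by (simp only: complex_norm_square[symmetric] of_real_mult[symmetric] of_real_add[symmetric]
        of_real_divide[symmetric] of_real_eq_iff)
qed

text \<open>The quotient (A - cnj S) / (2i) is the sum of the B_k. Its A part produces -|A|^2 Re W /
  |W|^2, which cancels the first summand; its S part is what remains. For W = 0 both sides are
  0.\<close>

lemma Re_cross_term:
  fixes A S W :: complex
  shows "Re W * (cmod A)\<^sup>2 / (cmod W)\<^sup>2 + 2 * Re (- \<i> * cnj A * ((A - cnj S) / (2 * \<i>)) / cnj W)
       = Re (A * S / W)"
proof -
  have *: "2 * (- \<i> * cnj A * ((A - cnj S) / (2 * \<i>)) / cnj W) = - (cnj A * (A - cnj S) / cnj W)"
    by (cases "W = 0") (simp_all add: field_simps)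
  have R: "2 * Re x = Re (2 * x)" for x by simp
  have "2 * Re (- \<i> * cnj A * ((A - cnj S) / (2 * \<i>)) / cnj W)
      = - Re (cnj A * (A - cnj S) / cnj W)"
    unfolding R * by simp
  also have "cnj A * (A - cnj S) / cnj W = (A * cnj A) / cnj W - cnj (A * S / W)"
    by (simp add: algebra_simps diff_divide_distrib)
  also have "- Re \<dots> = - Re ((A * cnj A) / cnj W) + Re (A * S / W)"
  proof -
    have "- Re (u - cnj v) = - Re u + Re v" for u v by simp
    then show ?thesis .
  qed
  also have "(A * cnj A) / cnj W = of_real ((cmod A)\<^sup>2) * (W / (W * cnj W))"
    unfolding complex_norm_square by (cases "W = 0") simp_all
  also have "\<dots> = of_real ((cmod A)\<^sup>2 / (cmod W)\<^sup>2) * W"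
    unfolding of_real_divide complex_norm_square by simp
  finally show ?thesis by simp
qed

section \<open>Transforms of compactly supported data on the network\<close>

locale network_bump = network +
  fixes \<alpha> \<beta> :: "nat \<Rightarrow> real" and g g' :: "nat \<Rightarrow> real \<Rightarrow> complex"
  assumes bump: "j \<in> {1..n} \<Longrightarrow> C1_bump (\<alpha> j) (\<beta> j) (g j) (g' j)"
    and alpha: "j \<in> {1..n} \<Longrightarrow> 0 < \<alpha> j"
begin

definition A :: "complex \<Rightarrow> complex" where
  "A z = (\<Sum>j=1..n. fourier (g j) (\<eta> j z))"

definition B :: "nat \<Rightarrow> complex \<Rightarrow> complex" where
  "B k t = (fourier (g k) t - fourier (g k) (- t)) / (2 * \<i>)"

definition Vg :: "nat \<Rightarrow> real \<Rightarrow> complex" where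
  "Vg k \<mu> = A (of_real \<mu>) -
     \<i> * (W (of_real \<mu>) / (of_real (c k) * \<eta> k (of_real \<mu>))) * B k (\<eta> k (of_real \<mu>))"

lemma Vg_eq:
  assumes k: "k \<in> {1..n}"
  shows "(\<Sum>j=1..n. LINT x|lborel. g j x * cnj (F_minus n c a k (of_real \<mu>) j x)) = Vg k \<mu>"
proof -
  let ?q = "\<i> * (W (of_real \<mu>) / (of_real (c k) * \<eta> k (of_real \<mu>)))"
  let ?e = "\<eta> k (of_real \<mu>)"
  have s: "(LINT x|lborel. g k x * sin (?e * of_real x)) = B k ?e"
    "integrable lborel (\<lambda>x. g k x * sin (?e * of_real x))"
  proof -
    interpret C1_bump "\<alpha> k" "\<beta> k" "g k" "g' k" using bump k .
    have "(\<lambda>x. g k x * sin (?e * of_real x)) =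
        (\<lambda>x. (g k x * exp (\<i> * ?e * of_real x) - g k x * exp (\<i> * (- ?e) * of_real x)) / (2 * \<i>))"
      by (simp add: fun_eq_iff sin_exp_eq mult.assoc right_diff_distrib)
    then show "(LINT x|lborel. g k x * sin (?e * of_real x)) = B k ?e"
      "integrable lborel (\<lambda>x. g k x * sin (?e * of_real x))"
      using integrable_exp[of ?e] integrable_exp[of "- ?e"] by (simp_all add: B_def fourier_def)
  qed
  have "(LINT x|lborel. g j x * cnj (F_minus n c a k (of_real \<mu>) j x)) =
     fourier (g j) (\<eta> j (of_real \<mu>)) - (if j = k then ?q * B k ?e else 0)" if j: "j \<in> {1..n}" for j
  proof -
    interpret C1_bump "\<alpha> j" "\<beta> j" "g j" "g' j" using bump j .
    show ?thesis
    proof (cases "j = k")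
      case True
      have "(\<lambda>x. g j x * cnj (F_minus n c a k (of_real \<mu>) j x)) =
          (\<lambda>x. g j x * exp (\<i> * \<eta> j (of_real \<mu>) * of_real x) - ?q * (g k x * sin (?e * of_real x)))"
        using True by (simp add: fun_eq_iff cnj_F_minus[OF k] algebra_simps)
      then show ?thesis
        using True integrable_exp s by (simp add: fourier_def)
    qed (simp add: cnj_F_minus[OF k] fourier_def)
  qed
  then show ?thesis
    using k by (simp add: Vg_def A_def sum_subtractf sum.delta)
qed

lemma cnj_network_bump: "network_bump n c a \<alpha> \<beta> (\<lambda>j x. cnj (g j x)) (\<lambda>j x. cnj (g' j x))"
  using bump alpha
  by (intro network_bump.intro network_axioms network_bump_axioms.intro C1_bump.cnj_bump)

text \<open>Since |\<eta>_j|^2 = |z - a_j| / c_j, the decay 1/|\<eta>_j| is of order |z|^(-1/2). The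
  factor 1 + |a_j - a_1| in \<open>K\<close> pays for moving the centre from a_j to a_1, which is
  common to all branches.\<close>

lemma fourier_bound_upper:
  assumes j: "j \<in> {1..n}"
  obtains K where "0 \<le> K"
    "\<And>z. 0 \<le> Im z \<Longrightarrow> norm (fourier (g j) (\<eta> j z)) \<le> K / sqrt (1 + norm (z - of_real (a 1)))"
proof -
  interpret C1_bump "\<alpha> j" "\<beta> j" "g j" "g' j" using bump j .
  define M where "M = (LINT x|lborel. norm (g j x)) + (LINT x|lborel. norm (g' j x))"
  have M0: "0 \<le> LINT x|lborel. norm (g j x)" "0 \<le> LINT x|lborel. norm (g' j x)" by auto
  define K where "K = (1 + \<bar>a j - a 1\<bar>) * (M\<^sup>2 * (1 + c j))"
  have cj: "0 < c j" using c j .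
  have M: "0 \<le> M" using M0 unfolding M_def by linarith
  have bd: "norm (fourier (g j) (\<eta> j z)) \<le> sqrt K / sqrt (1 + norm (z - of_real (a 1)))" if z: "0 \<le> Im z" for z
  proof -
    let ?F = "norm (fourier (g j) (\<eta> j z))"
    let ?r = "norm (z - of_real (a j))"
    have h: "(0 \<le> \<alpha> j \<and> 0 \<le> Im (\<eta> j z)) \<or> Im (\<eta> j z) = 0"
      using alpha[OF j] eta_nonneg(2)[OF j z] by auto
    have F: "?F \<le> M" "norm (\<eta> j z) * ?F \<le> M"
      using fourier_bound[OF h] fourier_decay[OF h] M0 unfolding M_def by linarith+
    have "?F\<^sup>2 \<le> M\<^sup>2" using F(1) by (intro power_mono) auto
    moreover have "(norm (\<eta> j z) * ?F)\<^sup>2 \<le> M\<^sup>2" using F(2) by (intro power_mono) auto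
    then have "?r / c j * ?F\<^sup>2 \<le> M\<^sup>2"
      using cj by (simp add: power_mult_distrib norm_eta[OF j])
    then have "?r * ?F\<^sup>2 \<le> c j * M\<^sup>2" using cj by (simp add: field_simps)
    ultimately have 1: "?F\<^sup>2 * (1 + ?r) \<le> M\<^sup>2 * (1 + c j)" by (simp add: algebra_simps)
    have "norm (z - of_real (a 1)) \<le> ?r + \<bar>a j - a 1\<bar>"
    proof -
      have e: "z - of_real (a 1) = (z - of_real (a j)) + of_real (a j - a 1)" by simp
      show ?thesis
        by (subst e, rule order_trans[OF norm_triangle_ineq]) (simp only: norm_of_real)
    qed
    moreover have "0 \<le> \<bar>a j - a 1\<bar> * ?r" by simp
    moreover have "(1 + \<bar>a j - a 1\<bar>) * (1 + ?r) = 1 + \<bar>a j - a 1\<bar> + ?r + \<bar>a j - a 1\<bar> * ?r"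
      by (simp add: algebra_simps)
    ultimately have "1 + norm (z - of_real (a 1)) \<le> (1 + \<bar>a j - a 1\<bar>) * (1 + ?r)"
      by linarith
    then have "?F\<^sup>2 * (1 + norm (z - of_real (a 1))) \<le> ?F\<^sup>2 * ((1 + \<bar>a j - a 1\<bar>) * (1 + ?r))"
      by (intro mult_left_mono) auto
    also have "\<dots> \<le> K"
      unfolding K_def using mult_left_mono[OF 1, of "1 + \<bar>a j - a 1\<bar>"] by (simp add: mult_ac)
    finally have "sqrt (?F\<^sup>2 * (1 + norm (z - of_real (a 1)))) \<le> sqrt K"
      by (rule real_sqrt_le_mono)
    then have "?F * sqrt (1 + norm (z - of_real (a 1))) \<le> sqrt K"
      by (simp only: real_sqrt_mult real_sqrt_abs abs_norm_cancel)
    moreover have "0 < sqrt (1 + norm (z - of_real (a 1)))" by (simp add: add_pos_nonneg)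
    ultimately show ?thesis by (simp only: pos_le_divide_eq)
  qed
  show ?thesis by (rule that[OF _ bd]) (auto simp: K_def less_imp_le[OF cj])
qed

lemma A_bound_upper:
  obtains K where "0 \<le> K" "\<And>z. 0 \<le> Im z \<Longrightarrow> norm (A z) \<le> K / sqrt (1 + norm (z - of_real (a 1)))"
proof -
  have "\<forall>j\<in>{1..n}. \<exists>K. 0 \<le> K \<and> (\<forall>z. 0 \<le> Im z \<longrightarrow>
      norm (fourier (g j) (\<eta> j z)) \<le> K / sqrt (1 + norm (z - of_real (a 1))))"
    using fourier_bound_upper by metis
  then obtain K where K: "\<And>j. j \<in> {1..n} \<Longrightarrow> 0 \<le> K j"
    "\<And>j z. j \<in> {1..n} \<Longrightarrow> 0 \<le> Im z \<Longrightarrow>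
      norm (fourier (g j) (\<eta> j z)) \<le> K j / sqrt (1 + norm (z - of_real (a 1)))"
    by metis
  show ?thesis
  proof (rule that[of "\<Sum>j=1..n. K j"])
    show "norm (A z) \<le> (\<Sum>j=1..n. K j) / sqrt (1 + norm (z - of_real (a 1)))" if "0 \<le> Im z" for z
      unfolding A_def sum_divide_distrib by (intro sum_norm_le K that)
  qed (use K in \<open>auto intro!: sum_nonneg\<close>)
qed

lemma continuous_A: "continuous_on {z. 0 \<le> Im z} A"
  unfolding A_def
  by (intro continuous_on_sum continuous_on_compose2[OF C1_bump.continuous_fourier[OF bump, of _ UNIV] continuous_eta]) auto

lemma holomorphic_A: "A holomorphic_on {z. 0 < Im z}"
  unfolding A_def
proof (intro holomorphic_on_sum)
  fix j assume j: "j \<in> {1..n}"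
  have "fourier (g j) \<circ> \<eta> j holomorphic_on {z. 0 < Im z}"
    by (rule holomorphic_on_compose_gen[OF holomorphic_eta[OF j] C1_bump.holomorphic_fourier[OF bump[OF j], of UNIV]]) simp
  then show "(\<lambda>z. fourier (g j) (\<eta> j z)) holomorphic_on {z. 0 < Im z}" by (simp add: o_def)
qed

lemma measurable_A: "(\<lambda>\<mu>. A (of_real \<mu>)) \<in> borel_measurable borel"
  by (intro borel_measurable_continuous_onI continuous_on_compose2[OF continuous_A] continuous_intros) auto

lemma measurable_B: "k \<in> {1..n} \<Longrightarrow> (\<lambda>\<mu>. B k (\<eta> k (of_real \<mu>))) \<in> borel_measurable borel"
  unfolding B_def
  by (intro borel_measurable_continuous_onI continuous_intros continuous_eta_real
      continuous_on_compose2[OF C1_bump.continuous_fourier[OF bump, of _ UNIV] continuous_eta_real]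
      continuous_on_compose2[OF C1_bump.continuous_fourier[OF bump, of _ UNIV]]) auto

lemma measurable_Vg: "k \<in> {1..n} \<Longrightarrow> Vg k \<in> borel_measurable borel"
  unfolding Vg_def[abs_def] using measurable_A measurable_B[of k] measurable_eta[of k] measurable_W by measurable

end

text \<open>It expresses cnj S by transforms of g at the frequencies -cnj \<eta>_k, ready for
  comparison with those at \<eta>_k in A.\<close>

lemma (in C1_bump) cnj_fourier_cnj: "cnj (fourier (\<lambda>x. cnj (g x)) z) = fourier g (- cnj z)"
  unfolding fourier_def Bochner_Integration.integral_cnj[symmetric] by (simp add: exp_cnj)

context network_bump
begin

interpretation S: network_bump n c a \<alpha> \<beta> "\<lambda>j x. cnj (g j x)" "\<lambda>j x. cnj (g' j x)"
  by (rule cnj_network_bump)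

definition h :: "complex \<Rightarrow> complex" where
  "h z = A z * S.A z / W z"

text \<open>\<open>A\<close>, \<open>S.A\<close> and 1/W each decay like |z|^(-1/2), while near a_1
  only 1/W is singular, of order |z - a_1|^(-1/2). Conjugating the data and not the frequency keeps
  \<open>S.A\<close> holomorphic.\<close>

lemma h_integral:
  shows "integrable lborel (\<lambda>\<mu>. h (of_real \<mu>))" "(LINT \<mu>|lborel. h (of_real \<mu>)) = 0"
proof -
  obtain K1 where K1: "0 \<le> K1" "\<And>z. 0 \<le> Im z \<Longrightarrow> norm (A z) \<le> K1 / sqrt (1 + norm (z - of_real (a 1)))"
    using A_bound_upper by metis
  obtain K2 where K2: "0 \<le> K2" "\<And>z. 0 \<le> Im z \<Longrightarrow> norm (S.A z) \<le> K2 / sqrt (1 + norm (z - of_real (a 1)))"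
    using S.A_bound_upper by metis
  have hol: "h holomorphic_on {z. 0 < Im z}"
    unfolding h_def
  proof (intro holomorphic_intros holomorphic_A S.holomorphic_A)
    show "W holomorphic_on {z. 0 < Im z}"
      unfolding eta_sum_def by (intro holomorphic_intros holomorphic_eta)
    show "W z \<noteq> 0" if "z \<in> {z. 0 < Im z}" for z
      using that by (intro W_nonzero) auto
  qed
  have cont: "continuous_on ({z. 0 \<le> Im z} - {of_real (a 1)}) h"
    unfolding h_def
  proof (intro continuous_intros continuous_on_subset[OF continuous_A] continuous_on_subset[OF S.continuous_A])
    show "continuous_on ({z. 0 \<le> Im z} - {of_real (a 1)}) W"
      unfolding eta_sum_def
      by (intro continuous_intros continuous_on_subset[OF continuous_eta]) auto
    show "\<forall>z\<in>{z. 0 \<le> Im z} - {of_real (a 1)}. W z \<noteq> 0"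
      using W_nonzero by auto
  qed auto
  have bd: "norm (h z) \<le> (K1 * K2 / sqrt (c 1)) /
      (sqrt (norm (z - of_real (a 1))) * (1 + norm (z - of_real (a 1))))"
    if z: "0 \<le> Im z" "z \<noteq> of_real (a 1)" for z
  proof -
    let ?r = "norm (z - of_real (a 1))"
    have r: "0 < ?r" using z by simp
    have "norm (h z) = norm (A z) * norm (S.A z) / norm (W z)"
      by (simp add: h_def norm_mult norm_divide)
    also have "\<dots> \<le> (K1 / sqrt (1 + ?r)) * (K2 / sqrt (1 + ?r)) / (sqrt (c 1) * sqrt ?r)"
      using K1 K2 z norm_W_ge[OF z(1)] r c[OF one]
      by (intro frac_le mult_mono) auto
    also have "\<dots> = (K1 * K2 / sqrt (c 1)) / (sqrt ?r * (sqrt (1 + ?r) * sqrt (1 + ?r)))"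
      by simp
    also have "sqrt (1 + ?r) * sqrt (1 + ?r) = 1 + ?r" using r by simp
    finally show ?thesis .
  qed
  show "integrable lborel (\<lambda>\<mu>. h (of_real \<mu>))" "(LINT \<mu>|lborel. h (of_real \<mu>)) = 0"
    using half_plane_integral[OF hol cont bd] by blast+
qed

lemma spectral_identity:
  assumes \<mu>: "\<And>k. k \<in> {1..n} \<Longrightarrow> \<mu> \<noteq> a k"
  shows "(\<Sum>k=1..n. sigma n c a k \<mu> * (cmod (Vg k \<mu>))\<^sup>2) = 1 / pi * (Re (h (of_real \<mu>)) +
     (\<Sum>k=1..n. indicator {a k<..} \<mu> *
        ((cmod (B k (of_real (sqrt ((\<mu> - a k) / c k)))))\<^sup>2 / (c k * sqrt ((\<mu> - a k) / c k)))))"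
proof -
  let ?A = "A (of_real \<mu>)" and ?S = "S.A (of_real \<mu>)" and ?W = "W (of_real \<mu>)"
  let ?e = "\<lambda>k. sqrt ((\<mu> - a k) / c k)"
  let ?B = "\<lambda>k. B k (\<eta> k (of_real \<mu>))"
  \<comment> \<open>\<open>P\<close> collects the active branches; on the others Re \<eta>_k = 0 and
    \<open>sigma\<close> vanishes.\<close>
  define P where "P = {k\<in>{1..n}. a k < \<mu>}"
  have P: "finite P" "P \<subseteq> {1..n}" by (auto simp: P_def)
  have W0: "?W \<noteq> 0" using \<mu>[OF one] by (intro W_nonzero) auto
  have act: "\<eta> k (of_real \<mu>) = of_real (?e k)" "0 < ?e k" "0 < c k * ?e k" if "k \<in> P" for k
    using that eta_active[of k \<mu>] c[of k] by (auto simp: P_def)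
  have inact: "Re (\<eta> k (of_real \<mu>)) = 0" if "k \<in> {1..n} - P" for k
    using that by (intro eta_inactive) (auto simp: P_def)
  have one_k: "pi * (sigma n c a k \<mu> * (cmod (Vg k \<mu>))\<^sup>2) =
      c k * ?e k * (cmod ?A)\<^sup>2 / (cmod ?W)\<^sup>2 + 2 * Re (- \<i> * cnj ?A * ?B k / cnj ?W)
      + (cmod (?B k))\<^sup>2 / (c k * ?e k)" if k: "k \<in> P" for k
  proof -
    have "pi * (sigma n c a k \<mu> * (cmod (Vg k \<mu>))\<^sup>2) =
        c k * ?e k / (cmod ?W)\<^sup>2 * (cmod (?A - \<i> * (?W / of_real (c k * ?e k)) * ?B k))\<^sup>2"
      by (simp add: sigma_eq_eta Vg_def act(1)[OF k])
    then show ?thesis by (simp only: norm_square_expand[OF act(3)[OF k] W0])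
  qed
  have ReW: "(\<Sum>k\<in>P. c k * ?e k) = Re ?W"
  proof -
    have "Re ?W = (\<Sum>k\<in>{1..n}. c k * Re (\<eta> k (of_real \<mu>)))" by (simp add: eta_sum_def)
    also have "\<dots> = (\<Sum>k\<in>P. c k * Re (\<eta> k (of_real \<mu>)))"
      using P inact by (intro sum.mono_neutral_right) auto
    finally show ?thesis by (simp add: act(1))
  qed
  \<comment> \<open>On an active branch \<eta>_k is real and -cnj \<eta>_k = -\<eta>_k gives B_k; on
    an inactive one -cnj \<eta>_k = \<eta>_k and the two transforms cancel.\<close>
  have sumB: "(\<Sum>k\<in>P. ?B k) = (?A - cnj ?S) / (2 * \<i>)"
  proof -
    have cS: "cnj ?S = (\<Sum>k=1..n. fourier (g k) (- cnj (\<eta> k (of_real \<mu>))))"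
      unfolding S.A_def cnj_sum
      by (rule sum.cong[OF refl], rule C1_bump.cnj_fourier_cnj[OF bump])
    have "(?A - cnj ?S) / (2 * \<i>) =
      (\<Sum>k=1..n. (fourier (g k) (\<eta> k (of_real \<mu>)) - fourier (g k) (- cnj (\<eta> k (of_real \<mu>)))) / (2 * \<i>))"
      unfolding cS A_def sum_subtractf[symmetric] sum_divide_distrib ..
    also have "\<dots> = (\<Sum>k\<in>P. (fourier (g k) (\<eta> k (of_real \<mu>)) - fourier (g k) (- cnj (\<eta> k (of_real \<mu>)))) / (2 * \<i>))"
    proof (rule sum.mono_neutral_right)
      show "\<forall>k\<in>{1..n} - P. (fourier (g k) (\<eta> k (of_real \<mu>)) - fourier (g k) (- cnj (\<eta> k (of_real \<mu>)))) / (2 * \<i>) = 0"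
      proof
        fix k assume "k \<in> {1..n} - P"
        then have "- cnj (\<eta> k (of_real \<mu>)) = \<eta> k (of_real \<mu>)"
          using inact[of k] by (simp add: complex_eq_iff)
        then show "(fourier (g k) (\<eta> k (of_real \<mu>)) - fourier (g k) (- cnj (\<eta> k (of_real \<mu>)))) / (2 * \<i>) = 0"
          by simp
      qed
    qed (use P in auto)
    also have "\<dots> = (\<Sum>k\<in>P. ?B k)"
      by (rule sum.cong) (simp_all add: B_def act(1))
    finally show ?thesis by simp
  qed
  have "pi * (\<Sum>k=1..n. sigma n c a k \<mu> * (cmod (Vg k \<mu>))\<^sup>2)
      = (\<Sum>k\<in>P. pi * (sigma n c a k \<mu> * (cmod (Vg k \<mu>))\<^sup>2))"
    unfolding sum_distrib_left
    using P by (intro sum.mono_neutral_right) (auto simp: P_def not_less intro: sigma_inactive)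
  also have "\<dots> = (\<Sum>k\<in>P. c k * ?e k) * (cmod ?A)\<^sup>2 / (cmod ?W)\<^sup>2
      + 2 * Re (- \<i> * cnj ?A * (\<Sum>k\<in>P. ?B k) / cnj ?W) + (\<Sum>k\<in>P. (cmod (?B k))\<^sup>2 / (c k * ?e k))"
    by (simp only: sum.cong[OF refl one_k] sum.distrib sum_distrib_right sum_distrib_left sum_divide_distrib Re_sum)
  also have "\<dots> = Re (h (of_real \<mu>)) + (\<Sum>k\<in>P. (cmod (?B k))\<^sup>2 / (c k * ?e k))"
    unfolding ReW sumB Re_cross_term h_def ..
  also have "(\<Sum>k\<in>P. (cmod (?B k))\<^sup>2 / (c k * ?e k)) =
     (\<Sum>k=1..n. indicator {a k<..} \<mu> * ((cmod (B k (of_real (?e k))))\<^sup>2 / (c k * ?e k)))"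
    using P by (intro sum.mono_neutral_cong_left) (auto simp: act(1), auto simp: P_def)
  finally show ?thesis by (simp add: field_simps)
qed

text \<open>The factor 1/pi in \<open>sigma\<close> absorbs the pi that each sine transform
  contributes.\<close>

theorem isometry:
  shows "k \<in> {1..n} \<Longrightarrow> integrable lborel (\<lambda>\<mu>. sigma n c a k \<mu> * (cmod (Vg k \<mu>))\<^sup>2)"
    and "(\<Sum>k=1..n. LINT \<mu>|lborel. sigma n c a k \<mu> * (cmod (Vg k \<mu>))\<^sup>2)
       = (\<Sum>k=1..n. LINT x|lborel. (cmod (g k x))\<^sup>2)"
proof -
  let ?b = "\<lambda>k \<mu>. indicator {a k<..} \<mu> *
        ((cmod (B k (of_real (sqrt ((\<mu> - a k) / c k)))))\<^sup>2 / (c k * sqrt ((\<mu> - a k) / c k)))"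
  let ?R = "\<lambda>\<mu>. 1 / pi * (Re (h (of_real \<mu>)) + (\<Sum>k=1..n. ?b k \<mu>))"
  let ?s = "\<lambda>k \<mu>. sigma n c a k \<mu> * (cmod (Vg k \<mu>))\<^sup>2"
  have b: "integrable lborel (?b k)" "(LINT \<mu>|lborel. ?b k \<mu>) = pi * (LINT x|lborel. (cmod (g k x))\<^sup>2)"
    if k: "k \<in> {1..n}" for k
    unfolding B_def
    by (rule C1_bump.sine_plancherel_spectral[OF bump[OF k] alpha[OF k] c[OF k]])+
  have R: "integrable lborel ?R"
    using b h_integral(1) by (intro integrable_mult_right Bochner_Integration.integrable_add Bochner_Integration.integrable_sum integrable_Re) auto
  have AEa: "AE \<mu> in lborel. \<forall>k\<in>{1..n}. \<mu> \<noteq> a k"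
    by (intro AE_finite_allI AE_lborel_singleton) auto
  have id: "AE \<mu> in lborel. (\<Sum>k=1..n. ?s k \<mu>) = ?R \<mu>"
    using AEa by eventually_elim (rule spectral_identity, auto)
  \<comment> \<open>The summands are nonnegative, so their sum, which equals the integrable
    \<open>?R\<close> almost everywhere, dominates each of them.\<close>
  have int: "integrable lborel (?s k)" if k: "k \<in> {1..n}" for k
  proof (rule Bochner_Integration.integrable_bound[OF R])
    have "?s k \<in> borel_measurable borel"
      using measurable_Vg[OF k] measurable_sigma[OF k] by measurable
    then show "?s k \<in> borel_measurable lborel" by simp
    show "AE \<mu> in lborel. norm (?s k \<mu>) \<le> norm (?R \<mu>)"
      using id
    proof eventually_elim
      case (elim \<mu>)
      have "?s k \<mu> \<le> (\<Sum>k=1..n. ?s k \<mu>)"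
        using k sigma_nonneg by (intro member_le_sum) auto
      moreover have "0 \<le> ?s k \<mu>" using sigma_nonneg[OF k] by simp
      ultimately show ?case using elim unfolding real_norm_def by linarith
    qed
  qed
  then show "k \<in> {1..n} \<Longrightarrow> integrable lborel (?s k)" .
  have "(\<Sum>k=1..n. LINT \<mu>|lborel. ?s k \<mu>) = (LINT \<mu>|lborel. (\<Sum>k=1..n. ?s k \<mu>))"
    by (rule Bochner_Integration.integral_sum[symmetric]) (rule int)
  also have "\<dots> = (LINT \<mu>|lborel. ?R \<mu>)"
    by (rule integral_cong_AE) (use id R int in \<open>auto intro!: borel_measurable_sum\<close>)
  also have "\<dots> = 1 / pi * (Re (LINT \<mu>|lborel. h (of_real \<mu>)) + (\<Sum>k=1..n. LINT \<mu>|lborel. ?b k \<mu>))"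
  proof -
    have "(LINT \<mu>|lborel. ?R \<mu>) = 1 / pi * (LINT \<mu>|lborel. Re (h (of_real \<mu>)) + (\<Sum>k=1..n. ?b k \<mu>))"
      by (rule integral_mult_right_zero)
    also have "(LINT \<mu>|lborel. Re (h (of_real \<mu>)) + (\<Sum>k=1..n. ?b k \<mu>))
        = (LINT \<mu>|lborel. Re (h (of_real \<mu>))) + (LINT \<mu>|lborel. (\<Sum>k=1..n. ?b k \<mu>))"
      by (intro Bochner_Integration.integral_add Bochner_Integration.integrable_sum b integrable_Re h_integral)
    also have "(LINT \<mu>|lborel. (\<Sum>k=1..n. ?b k \<mu>)) = (\<Sum>k=1..n. LINT \<mu>|lborel. ?b k \<mu>)"
      by (intro Bochner_Integration.integral_sum b)
    also have "(LINT \<mu>|lborel. Re (h (of_real \<mu>))) = Re (LINT \<mu>|lborel. h (of_real \<mu>))"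
      by (rule integral_Re[OF h_integral(1)])
    finally show ?thesis .
  qed
  also have "\<dots> = 1 / pi * (\<Sum>k=1..n. pi * (LINT x|lborel. (cmod (g k x))\<^sup>2))"
    by (simp only: h_integral(2) sum.cong[OF refl b(2)]) simp
  finally show "(\<Sum>k=1..n. LINT \<mu>|lborel. ?s k \<mu>) = (\<Sum>k=1..n. LINT x|lborel. (cmod (g k x))\<^sup>2)"
    by (simp flip: sum_distrib_left)
qed

end


subsection \<open>Density of test functions\<close>

lemma C_inf_on_subset: "C_inf_on UNIV f \<Longrightarrow> C_inf_on S f"
  unfolding C_inf_on_def derivs_on_def by (blast intro: has_vector_derivative_at_within)

lemma C_inf_on_lincomb:
  fixes f g :: "real \<Rightarrow> complex"
  assumes "C_inf_on S f" "C_inf_on S g"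
  shows "C_inf_on S (\<lambda>x. \<alpha> * f x + \<beta> * g x)"
proof -
  obtain D E where "derivs_on S f D" "derivs_on S g E" using assms by (auto simp: C_inf_on_def)
  then have "derivs_on S (\<lambda>x. \<alpha> * f x + \<beta> * g x) (\<lambda>j x. \<alpha> * D j x + \<beta> * E j x)"
    by (auto simp: derivs_on_def intro!: has_vector_derivative_add has_vector_derivative_mult_right)
  then show ?thesis by (auto simp: C_inf_on_def)
qed

lemma C_inf_on_affine:
  assumes "C_inf_on UNIV f"
  shows "C_inf_on UNIV (\<lambda>x. f (r * x + t))"
proof -
  obtain D where D: "derivs_on UNIV f D" using assms by (auto simp: C_inf_on_def)
  have "((\<lambda>x. r ^ j *\<^sub>R D j (r * x + t)) has_vector_derivative r ^ Suc j *\<^sub>R D (Suc j) (r * x + t)) (at x)" for j x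
  proof -
    have "((\<lambda>x. r * x + t) has_vector_derivative r) (at x)"
      by (auto intro!: derivative_eq_intros)
    from vector_diff_chain_at[OF this, of "D j" "D (Suc j) (r * x + t)"] D
    have "((\<lambda>x. D j (r * x + t)) has_vector_derivative r *\<^sub>R D (Suc j) (r * x + t)) (at x)"
      by (simp add: derivs_on_def o_def)
    from has_vector_derivative_scaleR[OF DERIV_const[of "r ^ j"] this] show ?thesis
      by (simp add: mult.commute)
  qed
  then have "derivs_on UNIV (\<lambda>x. f (r * x + t)) (\<lambda>j x. r ^ j *\<^sub>R D j (r * x + t))"
    using D by (simp add: derivs_on_def)
  then show ?thesis by (auto simp: C_inf_on_def)
qed

lemma C_inf_on_of_real:
  assumes "C_inf_on S f"
  shows "C_inf_on S (\<lambda>x. complex_of_real (f x))"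
proof -
  obtain D where "derivs_on S f D" using assms by (auto simp: C_inf_on_def)
  then have "derivs_on S (\<lambda>x. complex_of_real (f x)) (\<lambda>j x. of_real (D j x))"
    by (auto simp: derivs_on_def intro!: bounded_linear.has_vector_derivative[OF bounded_linear_of_real])
  then show ?thesis by (auto simp: C_inf_on_def)
qed

lemma C_inf_on_continuous: "C_inf_on S f \<Longrightarrow> continuous_on S f"
proof -
  assume "C_inf_on S f"
  then obtain D where D: "derivs_on S f D" by (auto simp: C_inf_on_def)
  then have "continuous_on S (D 0)"
    unfolding derivs_on_def continuous_on_eq_continuous_within
    using has_vector_derivative_continuous by blast
  then show ?thesis
    by (rule continuous_on_eq) (use D in \<open>auto simp: derivs_on_def\<close>)
qed

section \<open>Mean-square approximation by smooth functions on an interval\<close>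

definition bumps :: "real \<Rightarrow> real \<Rightarrow> (real \<Rightarrow> complex) set" where
  "bumps p q = {\<phi>. C_inf_on UNIV \<phi> \<and> (\<forall>x. x \<notin> {p..q} \<longrightarrow> \<phi> x = 0)}"

lemma bumps_lincomb: "\<phi> \<in> bumps p q \<Longrightarrow> \<psi> \<in> bumps p q \<Longrightarrow> (\<lambda>x. \<alpha> * \<phi> x + \<beta> * \<psi> x) \<in> bumps p q"
  by (auto simp: bumps_def intro: C_inf_on_lincomb)

text \<open>Tuples with a single branch: the scalar approximation argument on the line thereby
  reuses the norm inequalities for \<open>L2\<close>.\<close>

abbreviation Leb :: "nat \<Rightarrow> real measure" where "Leb \<equiv> \<lambda>_. lebesgue"

lemma L2_Leb_iff:
  "(\<lambda>_. u) \<in> L2 1 Leb \<longleftrightarrow> u \<in> borel_measurable lebesgue \<and> integrable lebesgue (\<lambda>x. (cmod (u x))\<^sup>2)"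
  by (simp add: L2_def)

lemma borel_imp_lebesgue: "f \<in> borel_measurable borel \<Longrightarrow> f \<in> borel_measurable lebesgue"
  by (intro measurable_completion) simp

lemma integrable_lebesgue_interval: "integrable lebesgue (indicator {p..q} :: real \<Rightarrow> real)"
  by (subst integrable_completion) (auto intro!: integrable_real_indicator simp: emeasure_lborel_Icc_eq)

lemma bounded_L2:
  assumes u: "u \<in> borel_measurable lebesgue" and bd: "\<And>x. cmod (u x) \<le> B * indicator {p..q} x"
  shows "(\<lambda>_. u) \<in> L2 1 Leb"
  unfolding L2_Leb_iff
proof
  have "integrable lebesgue (\<lambda>x. B\<^sup>2 * indicator {p..q} x :: real)"
    by (intro integrable_mult_right integrable_lebesgue_interval)
  then show "integrable lebesgue (\<lambda>x. (cmod (u x))\<^sup>2)"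
  proof (rule Bochner_Integration.integrable_bound)
    show "AE x in lebesgue. norm ((cmod (u x))\<^sup>2) \<le> norm (B\<^sup>2 * indicator {p..q} x :: real)"
    proof (rule AE_I2)
      fix x
      have "(cmod (u x))\<^sup>2 \<le> (B * indicator {p..q} x)\<^sup>2" using bd by (intro power_mono) auto
      then show "norm ((cmod (u x))\<^sup>2) \<le> norm (B\<^sup>2 * indicator {p..q} x :: real)"
        by (cases "x \<in> {p..q}") auto
    qed
  qed (use u in measurable)
qed (rule u)

lemma bumps_bounded:
  assumes "\<phi> \<in> bumps p q"
  obtains B where "0 \<le> B" "\<And>x. cmod (\<phi> x) \<le> B * indicator {p..q} x"
proof -
  have "continuous_on UNIV \<phi>" using assms C_inf_on_continuous by (auto simp: bumps_def)
  then have "compact (\<phi> ` {p..q})"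
    by (intro compact_continuous_image) (auto intro: continuous_on_subset)
  then obtain B where B: "\<And>x. x \<in> {p..q} \<Longrightarrow> norm (\<phi> x) \<le> B"
    using compact_imp_bounded bounded_iff by (metis imageI)
  have "cmod (\<phi> x) \<le> max B 0 * indicator {p..q} x" for x
    using B[of x] assms by (cases "x \<in> {p..q}") (auto simp: bumps_def)
  then show ?thesis by (intro that[of "max B 0"]) auto
qed

lemma bumps_measurable: "\<phi> \<in> bumps p q \<Longrightarrow> \<phi> \<in> borel_measurable borel"
  using C_inf_on_continuous by (auto simp: bumps_def intro!: borel_measurable_continuous_onI)

lemma bumps_L2: "\<phi> \<in> bumps p q \<Longrightarrow> (\<lambda>_. \<phi>) \<in> L2 1 Leb"
  using bumps_bounded bounded_L2 bumps_measurable borel_imp_lebesgue by metis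

definition approximable :: "real \<Rightarrow> real \<Rightarrow> (real \<Rightarrow> complex) \<Rightarrow> bool" where
  "approximable p q u \<longleftrightarrow> (\<lambda>_. u) \<in> L2 1 Leb \<and>
     (\<forall>e>0. \<exists>\<phi>\<in>bumps p q. L2_norm 1 Leb ((\<lambda>_. u) \<ominus> (\<lambda>_. \<phi>)) < e)"

lemma approximable_bumps: "\<phi> \<in> bumps p q \<Longrightarrow> approximable p q \<phi>"
  unfolding approximable_def
proof (intro conjI allI impI bumps_L2)
  fix e :: real assume a: "\<phi> \<in> bumps p q" "0 < e"
  have "(L2_norm 1 Leb ((\<lambda>_. \<phi>) \<ominus> (\<lambda>_. \<phi>)))\<^sup>2 = 0"
    unfolding L2_norm_square by (simp add: lincomb_def)
  then show "\<exists>\<psi>\<in>bumps p q. L2_norm 1 Leb ((\<lambda>_. \<phi>) \<ominus> (\<lambda>_. \<psi>)) < e"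
    using a by (intro bexI[of _ \<phi>]) auto
qed

lemma approximable_add:
  assumes u: "approximable p q u" and v: "approximable p q v"
  shows "approximable p q (\<lambda>x. u x + \<beta> * v x)"
  unfolding approximable_def
proof (intro conjI allI impI)
  let ?u = "\<lambda>_::nat. u" and ?v = "\<lambda>_::nat. v"
  have L: "?u \<in> L2 1 Leb" "?v \<in> L2 1 Leb" using u v by (auto simp: approximable_def)
  have eq: "(\<lambda>_::nat. \<lambda>x. u x + \<beta> * v x) = lincomb 1 ?u \<beta> ?v" by (simp add: lincomb_def)
  show "(\<lambda>_. \<lambda>x. u x + \<beta> * v x) \<in> L2 1 Leb" unfolding eq by (intro lincomb_L2 L)
  fix e :: real assume e: "0 < e"
  have pos: "0 < 1 + cmod \<beta>" by (simp add: add_pos_nonneg)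
  then have e': "0 < e / (1 + cmod \<beta>)" using e by simp
  obtain \<phi> \<psi> where ph: "\<phi> \<in> bumps p q" "L2_norm 1 Leb (?u \<ominus> (\<lambda>_. \<phi>)) < e / (1 + cmod \<beta>)"
    and ps: "\<psi> \<in> bumps p q" "L2_norm 1 Leb (?v \<ominus> (\<lambda>_. \<psi>)) < e / (1 + cmod \<beta>)"
    using u v e' unfolding approximable_def by blast
  let ?w = "\<lambda>x. 1 * \<phi> x + \<beta> * \<psi> x"
  have "(\<lambda>_::nat. \<lambda>x. u x + \<beta> * v x) \<ominus> (\<lambda>_. ?w) = lincomb 1 (?u \<ominus> (\<lambda>_. \<phi>)) \<beta> (?v \<ominus> (\<lambda>_. \<psi>))"
    by (simp add: lincomb_def algebra_simps)
  then have "L2_norm 1 Leb ((\<lambda>_. \<lambda>x. u x + \<beta> * v x) \<ominus> (\<lambda>_. ?w))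
      \<le> 1 * L2_norm 1 Leb (?u \<ominus> (\<lambda>_. \<phi>)) + cmod \<beta> * L2_norm 1 Leb (?v \<ominus> (\<lambda>_. \<psi>))"
    using L2_norm_lincomb_le[OF lincomb_L2[OF L(1) bumps_L2[OF ph(1)]] lincomb_L2[OF L(2) bumps_L2[OF ps(1)]],
        where \<alpha>=1] by simp
  also have "\<dots> < 1 * (e / (1 + cmod \<beta>)) + cmod \<beta> * (e / (1 + cmod \<beta>))"
    using ph ps by (intro add_less_le_mono mult_left_mono) auto
  also have "\<dots> = (1 + cmod \<beta>) * (e / (1 + cmod \<beta>))" by (simp only: distrib_right)
  also have "\<dots> = e" using pos by simp
  finally show "\<exists>\<phi>\<in>bumps p q. L2_norm 1 Leb ((\<lambda>_. \<lambda>x. u x + \<beta> * v x) \<ominus> (\<lambda>_. \<phi>)) < e"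
    using bumps_lincomb[OF ph(1) ps(1), of 1 \<beta>] by blast
qed

text \<open>Dominated convergence: the difference is bounded by 2 B on the fixed interval [p, q].
  Each passage below, from smooth steps to indicators, to continuous and then to measurable
  functions, is one use of it.\<close>

lemma approximable_limit:
  assumes u: "\<And>m. approximable p q (u m)"
    and bd: "\<And>m x. cmod (u m x) \<le> B * indicator {p..q} x"
    and v: "v \<in> borel_measurable lebesgue" "\<And>x. cmod (v x) \<le> B * indicator {p..q} x"
    and lim: "AE x in lebesgue. (\<lambda>m. u m x) \<longlonglongrightarrow> v x"
  shows "approximable p q v"
  unfolding approximable_def
proof (intro conjI allI impI)
  show vL: "(\<lambda>_. v) \<in> L2 1 Leb" by (rule bounded_L2[OF v])
  have uL: "(\<lambda>_. u m) \<in> L2 1 Leb" for m using u by (simp add: approximable_def)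
  have um [measurable]: "u m \<in> borel_measurable lebesgue" for m using uL L2_Leb_iff by blast
  note v(1) [measurable]
  have "(\<lambda>m. LINT x|lebesgue. (cmod (v x - u m x))\<^sup>2) \<longlonglongrightarrow> (LINT x|(lebesgue :: real measure). (0::real))"
  proof (rule integral_dominated_convergence[OF _ _ integrable_mult_right[OF integrable_lebesgue_interval, where c="4 * B\<^sup>2"]])
    show "AE x in lebesgue. (\<lambda>m. (cmod (v x - u m x))\<^sup>2) \<longlonglongrightarrow> 0"
      using lim
    proof eventually_elim
      case (elim x)
      have "(\<lambda>m. (cmod (v x - u m x))\<^sup>2) \<longlonglongrightarrow> (cmod (v x - v x))\<^sup>2"
        by (intro tendsto_intros elim)
      then show ?case by simp
    qed
    show "AE x in lebesgue. norm ((cmod (v x - u m x))\<^sup>2) \<le> 4 * B\<^sup>2 * indicator {p..q} x" for m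
    proof (rule AE_I2)
      fix x
      have "cmod (v x - u m x) \<le> 2 * B * indicator {p..q} x"
        using norm_triangle_ineq4[of "v x" "u m x"] v(2)[of x] bd[of m x] by simp
      then have "(cmod (v x - u m x))\<^sup>2 \<le> (2 * B * indicator {p..q} x)\<^sup>2" by (intro power_mono) auto
      then show "norm ((cmod (v x - u m x))\<^sup>2) \<le> 4 * B\<^sup>2 * indicator {p..q} x"
        by (cases "x \<in> {p..q}") (auto simp: power_mult_distrib)
    qed
  qed measurable
  then have lim2: "(\<lambda>m. (L2_norm 1 Leb ((\<lambda>_. v) \<ominus> (\<lambda>_. u m)))\<^sup>2) \<longlonglongrightarrow> 0"
    unfolding L2_norm_square by (simp add: lincomb_def)
  fix e :: real assume e: "0 < e"
  have "\<forall>\<^sub>F m in sequentially. (L2_norm 1 Leb ((\<lambda>_. v) \<ominus> (\<lambda>_. u m)))\<^sup>2 < (e / 2)\<^sup>2"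
    using e by (intro order_tendstoD(2)[OF lim2]) auto
  then obtain m where "(L2_norm 1 Leb ((\<lambda>_. v) \<ominus> (\<lambda>_. u m)))\<^sup>2 < (e / 2)\<^sup>2"
    by (auto simp: eventually_sequentially)
  then have m: "L2_norm 1 Leb ((\<lambda>_. v) \<ominus> (\<lambda>_. u m)) < e / 2"
    by (rule power2_less_imp_less) (use e in simp)
  obtain \<phi> where ph: "\<phi> \<in> bumps p q" "L2_norm 1 Leb ((\<lambda>_. u m) \<ominus> (\<lambda>_. \<phi>)) < e / 2"
    using u[of m] half_gt_zero[OF e] unfolding approximable_def by blast
  have "L2_norm 1 Leb ((\<lambda>_. v) \<ominus> (\<lambda>_. \<phi>)) \<le>
      L2_norm 1 Leb ((\<lambda>_. v) \<ominus> (\<lambda>_. u m)) + L2_norm 1 Leb ((\<lambda>_. u m) \<ominus> (\<lambda>_. \<phi>))"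
    by (intro L2_norm_triangle vL uL bumps_L2[OF ph(1)])
  then show "\<exists>\<phi>\<in>bumps p q. L2_norm 1 Leb ((\<lambda>_. v) \<ominus> (\<lambda>_. \<phi>)) < e"
    using m ph by (intro bexI[of _ \<phi>]) auto
qed

text \<open>The step will be a translate of \<open>chi\<close>. Between 0 and 1 nothing but
  smoothness is known, neither monotonicity nor values in [0, 1], so bounds come from
  compactness.\<close>

locale smooth_step =
  fixes \<theta> :: "real \<Rightarrow> real"
  assumes smooth: "C_inf_on UNIV \<theta>"
    and left: "x < 0 \<Longrightarrow> \<theta> x = 0"
    and right: "1 < x \<Longrightarrow> \<theta> x = 1"
begin

lemma bounded_step: obtains B where "\<And>x. \<bar>\<theta> x\<bar> \<le> B"
proof -
  have "compact (\<theta> ` {0..1})"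
    by (intro compact_continuous_image continuous_on_subset[OF C_inf_on_continuous[OF smooth]]) auto
  then obtain B where B: "\<And>x. x \<in> {0..1} \<Longrightarrow> norm (\<theta> x) \<le> B"
    using compact_imp_bounded bounded_iff by (metis imageI)
  have "\<bar>\<theta> x\<bar> \<le> max B 1" for x
    using B[of x] left[of x] right[of x] by (cases "x \<in> {0..1}") auto
  then show ?thesis by (rule that)
qed

text \<open>The difference of two compressed steps, one with its ramp just right of r and one with
  its ramp just left of s, converges to the indicator off r and s.\<close>

lemma approximable_interval:
  assumes "p \<le> r" "r < s" "s \<le> q"
  shows "approximable p q (indicator {r..<s})"
proof -
  obtain B where B: "\<And>x. \<bar>\<theta> x\<bar> \<le> B" using bounded_step by blast
  \<comment> \<open>The ramp width stays below s - r, so both ramps [r, r + d] and [s - d, s] lie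
    inside [r, s].\<close>
  define d where "d m = (s - r) / (2 * real (Suc m))" for m
  have d: "0 < d m" "d m < s - r" for m
  proof -
    show "0 < d m" using assms by (simp add: d_def)
    have "(s - r) * 1 < (s - r) * (2 * real (Suc m))" using assms by (intro mult_strict_left_mono) auto
    then show "d m < s - r" using assms by (simp add: d_def field_simps)
  qed
  define b where "b m x = complex_of_real (\<theta> ((x - r) / d m)) - complex_of_real (\<theta> ((x - s + d m) / d m))" for m x
  have supp: "b m x = 0" if "x \<notin> {r..s}" for m x
  proof (cases "x < r")
    case True
    then have "(x - r) / d m < 0" "(x - s + d m) / d m < 0"
      using d[of m] by (auto simp: divide_neg_pos)
    then show ?thesis by (simp add: b_def left)
  next
    case False
    then have "1 < (x - r) / d m" "1 < (x - s + d m) / d m"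
      using d[of m] that by (auto simp: less_divide_eq_1)
    then show ?thesis by (simp add: b_def right)
  qed
  have aff: "C_inf_on UNIV (\<lambda>x. complex_of_real (\<theta> ((x - t) / e)))" for t e
    using C_inf_on_of_real[OF C_inf_on_affine[OF smooth, of "1 / e" "- t / e"]]
    by (simp add: diff_divide_distrib)
  have bb: "b m \<in> bumps p q" for m
  proof -
    have "C_inf_on UNIV (\<lambda>x. 1 * complex_of_real (\<theta> ((x - r) / d m)) +
        (-1) * complex_of_real (\<theta> ((x - (s - d m)) / d m)))"
      by (intro C_inf_on_lincomb aff)
    then have "C_inf_on UNIV (b m)" unfolding b_def by (simp add: algebra_simps)
    then show ?thesis using supp assms by (auto simp: bumps_def)
  qed
  have lim: "(\<lambda>m. b m x) \<longlonglongrightarrow> indicator {r..<s} x" if x: "x \<noteq> r" "x \<noteq> s" for x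
  proof (cases "x \<in> {r..s}")
    case False
    then show ?thesis using supp by (auto simp: indicator_def)
  next
    case True
    have "(\<lambda>m. (s - r) / 2 * inverse (real (Suc m))) \<longlonglongrightarrow> (s - r) / 2 * 0"
      by (intro tendsto_intros LIMSEQ_inverse_real_of_nat)
    moreover have "d = (\<lambda>m. (s - r) / 2 * inverse (real (Suc m)))"
      unfolding d_def[abs_def] divide_inverse inverse_mult_distrib by (simp only: mult_ac)
    ultimately have d0: "d \<longlonglongrightarrow> 0" by (simp only: mult_zero_right)
    have "0 < min (x - r) (s - x)" using True x by simp
    from order_tendstoD(2)[OF d0 this]
    have "\<forall>\<^sub>F m in sequentially. b m x = indicator {r..<s} x"
    proof eventually_elim
      case (elim m)
      then have "d m < x - r" "d m < s - x" by auto
      then have "1 < (x - r) / d m" "(x - s + d m) / d m < 0"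
        using d(1)[of m] by (auto simp only: less_divide_eq_1_pos intro!: divide_neg_pos)
      then show ?case using True x by (simp add: b_def left right)
    qed
    then show ?thesis by (rule tendsto_eventually)
  qed
  \<comment> \<open>2 B bounds the difference of the steps and 1 bounds the limiting indicator; one
    constant has to serve both.\<close>
  have bd: "cmod (b m x) \<le> max 1 (2 * B) * indicator {p..q} x" for m x
  proof (cases "x \<in> {r..s}")
    case True
    have "cmod (b m x) \<le> \<bar>\<theta> ((x - r) / d m)\<bar> + \<bar>\<theta> ((x - s + d m) / d m)\<bar>"
      unfolding b_def by (rule order_trans[OF norm_triangle_ineq4]) simp
    also have "\<dots> \<le> B + B" by (intro add_mono B)
    finally show ?thesis using True assms by simp
  qed (simp add: supp)
  show ?thesis
  proof (rule approximable_limit[OF approximable_bumps[OF bb] bd])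
    show "indicator {r..<s} \<in> borel_measurable lebesgue"
      by (rule borel_imp_lebesgue[OF borel_measurable_indicator]) simp
    show "cmod (indicator {r..<s} x) \<le> max 1 (2 * B) * indicator {p..q} x" for x
      using assms by (auto simp: indicator_def)
    have "AE x in lborel. x \<noteq> r \<and> x \<noteq> s"
      using AE_lborel_singleton[of r] AE_lborel_singleton[of s] by eventually_elim simp
    then have "AE x in lborel. (\<lambda>m. b m x) \<longlonglongrightarrow> indicator {r..<s} x"
      by eventually_elim (rule lim, auto)
    then show "AE x in lebesgue. (\<lambda>m. b m x) \<longlonglongrightarrow> indicator {r..<s} x"
      by (rule AE_completion)
  qed
qed

lemma approximable_sum:
  assumes "finite I" "\<And>i. i \<in> I \<Longrightarrow> approximable p q (u i)"
  shows "approximable p q (\<lambda>x. \<Sum>i\<in>I. \<beta> i * u i x)"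
  using assms
proof (induction I rule: finite_induct)
  case empty
  have "(\<lambda>x. 0) \<in> bumps p q"
    by (auto simp: bumps_def C_inf_on_def derivs_on_def intro!: exI[of _ "\<lambda>_ _. 0"])
  from approximable_bumps[OF this] show ?case by simp
next
  case (insert i I)
  from approximable_add[OF insert.IH insert.prems(1), of i "\<beta> i"] insert
  show ?case by (simp add: add.commute)
qed

text \<open>Step functions with left-endpoint values on a uniform grid converge pointwise on [p, q)
  by continuity.\<close>

lemma approximable_continuous:
  assumes g: "continuous_on UNIV g" and bd: "\<And>x. cmod (g x) \<le> B" and pq: "p < q"
  shows "approximable p q (\<lambda>x. g x * indicator {p..<q} x)"
proof -
  define h where "h N = (q - p) / real (Suc N)" for N
  let ?t = "\<lambda>N i. p + real i * h N"
  let ?I = "\<lambda>N i. indicator {?t N i..<?t N (Suc i)} :: real \<Rightarrow> complex"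
  define u where "u N x = (\<Sum>i<Suc N. g (?t N i) * ?I N i x)" for N x
  have h: "0 < h N" for N using pq by (simp add: h_def)
  have tq: "?t N (Suc N) = q" for N by (simp add: h_def)
  \<comment> \<open>Half-open cells tile [p, q) without overlap, so the cell of x is read off from a
    floor and the sum defining \<open>u\<close> reduces to one term.\<close>
  have inI: "x \<in> {?t N i..<?t N (Suc i)} \<longleftrightarrow> i = nat \<lfloor>(x - p) / h N\<rfloor>" if x: "p \<le> x" for x i N
  proof -
    have "x \<in> {?t N i..<?t N (Suc i)} \<longleftrightarrow> real i \<le> (x - p) / h N \<and> (x - p) / h N < real i + 1"
      using h[of N] by (simp add: pos_le_divide_eq pos_divide_less_eq algebra_simps del: of_nat_Suc) 
         (simp add: algebra_simps)
    also have "\<dots> \<longleftrightarrow> \<lfloor>(x - p) / h N\<rfloor> = int i"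
      by (simp add: floor_eq_iff)
    also have "\<dots> \<longleftrightarrow> i = nat \<lfloor>(x - p) / h N\<rfloor>"
    proof -
      have "0 \<le> (x - p) / h N" using x h[of N] by simp
      then have "0 \<le> \<lfloor>(x - p) / h N\<rfloor>" by simp
      then show ?thesis by (metis int_nat_eq nat_int)
    qed
    finally show ?thesis .
  qed
  have uval: "\<exists>i. u N x = g (?t N i) \<and> \<bar>?t N i - x\<bar> \<le> h N" if x: "x \<in> {p..<q}" for N x
  proof -
    let ?i = "nat \<lfloor>(x - p) / h N\<rfloor>"
    have mem: "x \<in> {?t N ?i..<?t N (Suc ?i)}" using inI[of x ?i N] x by simp
    have "?t N ?i < ?t N (Suc N)" unfolding tq using mem x by simp
    then have "real ?i * h N < real (Suc N) * h N" by linarith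
    then have iN: "?i < Suc N" using h[of N] by (simp only: mult_less_cancel_right_pos of_nat_less_iff)
    have "u N x = (\<Sum>i<Suc N. if i = ?i then g (?t N i) else 0)"
      unfolding u_def using inI[of x _ N] x by (intro sum.cong) (auto simp: indicator_def)
    also have "\<dots> = g (?t N ?i)" using iN by (subst sum.delta) auto
    finally have "u N x = g (?t N ?i)" .
    moreover have "\<bar>?t N ?i - x\<bar> \<le> h N"
      using mem by (simp add: algebra_simps add_divide_distrib abs_le_iff del: of_nat_Suc) (simp add: algebra_simps)
    ultimately show ?thesis by blast
  qed
  have u0: "u N x = 0" if "x \<notin> {p..<q}" for N x
    unfolding u_def
  proof (rule sum.neutral, rule ballI)
    fix i assume i: "i \<in> {..<Suc N}"
    have "real (Suc i) * h N \<le> real (Suc N) * h N" using i h[of N] by (intro mult_right_mono) auto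
    then have "?t N (Suc i) \<le> q" using tq[of N] by linarith
    moreover have "p \<le> ?t N i" using h[of N] by simp
    ultimately have "x \<notin> {?t N i..<?t N (Suc i)}" using that by auto
    then show "g (?t N i) * ?I N i x = 0" by simp
  qed
  show ?thesis
  proof (rule approximable_limit[of p q u])
    show "approximable p q (u N)" for N
      unfolding u_def
    proof (rule approximable_sum)
      fix i assume i: "i \<in> {..<Suc N}"
      have "real (Suc i) * h N \<le> real (Suc N) * h N" using i h[of N] by (intro mult_right_mono) auto
      then have "?t N (Suc i) \<le> q" using tq[of N] by linarith
      moreover have "p \<le> ?t N i" using h[of N] by simp
      moreover have "?t N i < ?t N (Suc i)"
        using mult_strict_right_mono[of "real i" "real (Suc i)" "h N"] h[of N] by simp
      ultimately show "approximable p q (?I N i)" by (intro approximable_interval)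
    qed simp
    show "cmod (u N x) \<le> B * indicator {p..q} x" for N x
      using uval[of x N] u0[of x N] bd order_trans[OF norm_ge_zero bd[of 0]]
      by (cases "x \<in> {p..<q}") (auto simp: indicator_def)
    have "g \<in> borel_measurable borel" by (rule borel_measurable_continuous_onI[OF g])
    then have "(\<lambda>x. g x * indicator {p..<q} x) \<in> borel_measurable borel" by measurable
    then show "(\<lambda>x. g x * indicator {p..<q} x) \<in> borel_measurable lebesgue"
      by (rule borel_imp_lebesgue)
    show "cmod (g x * indicator {p..<q} x) \<le> B * indicator {p..q} x" for x
      using bd[of x] order_trans[OF norm_ge_zero bd[of 0]] by (auto simp: indicator_def)
    show "AE x in lebesgue. (\<lambda>N. u N x) \<longlonglongrightarrow> g x * indicator {p..<q} x"
    proof (rule AE_I2)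
      fix x
      show "(\<lambda>N. u N x) \<longlonglongrightarrow> g x * indicator {p..<q} x"
      proof (cases "x \<in> {p..<q}")
        case True
        then obtain i where i: "\<And>N. u N x = g (?t N (i N))" "\<And>N. \<bar>?t N (i N) - x\<bar> \<le> h N"
          using uval by metis
        have "(\<lambda>N. (q - p) * inverse (real (Suc N))) \<longlonglongrightarrow> (q - p) * 0"
          by (intro tendsto_intros LIMSEQ_inverse_real_of_nat)
        then have "h \<longlonglongrightarrow> 0" by (simp add: h_def[abs_def] divide_inverse)
        then have "(\<lambda>N. ?t N (i N) - x) \<longlonglongrightarrow> 0"
          by (rule Lim_null_comparison[rotated]) (use i(2) in \<open>auto simp del: of_nat_Suc\<close>)
        then have "(\<lambda>N. ?t N (i N)) \<longlonglongrightarrow> x" by (simp only: LIM_zero_iff)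
        then have "(\<lambda>N. g (?t N (i N))) \<longlonglongrightarrow> g x"
          by (rule continuous_on_tendsto_compose[OF g]) auto
        then show ?thesis using True i(1) by simp
      qed (simp add: u0)
    qed
  qed
qed

text \<open>A measurable function is an almost everywhere limit of continuous ones, which need not
  respect the bound B; scaling them radially back into the ball of radius B restores it.\<close>

lemma approximable_bounded:
  assumes u: "u \<in> borel_measurable lebesgue" and bd: "\<And>x. cmod (u x) \<le> B * indicator {p..q} x"
    and pq: "p < q" and B: "0 < B"
  shows "approximable p q u"
proof -
  have "u \<in> borel_measurable (lebesgue_on UNIV)" using u by simp
  then have "u measurable_on UNIV"
    by (subst measurable_on_iff_borel_measurable) auto
  then obtain N g where N: "negligible N" and g: "\<And>m. continuous_on UNIV (g m)"
    and lim: "\<And>x. x \<notin> N \<Longrightarrow> (\<lambda>m. g m x) \<longlonglongrightarrow> u x"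
    unfolding measurable_on_def by auto
  \<comment> \<open>The factor is 1 where |g| \<le> B and B / |g| elsewhere. It depends continuously
    on g, and at the limit it is 1 on [p, q] because |u| \<le> B.\<close>
  define h where "h m x = of_real (B / max B (cmod (g m x))) * g m x" for m x
  have ch: "continuous_on UNIV (h m)" for m
    unfolding h_def using B by (intro continuous_intros g) auto
  have hB: "cmod (h m x) \<le> B" for m x
  proof -
    have "cmod (h m x) = B * (cmod (g m x) / max B (cmod (g m x)))"
      unfolding h_def norm_mult norm_of_real using B by simp
    also have "\<dots> \<le> B * 1" using B by (intro mult_left_mono) (auto simp: divide_le_eq)
    finally show ?thesis by simp
  qed
  show ?thesis
  proof (rule approximable_limit[of p q "\<lambda>m x. h m x * indicator {p..<q} x"])
    show "approximable p q (\<lambda>x. h m x * indicator {p..<q} x)" for m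
      by (rule approximable_continuous[OF ch hB pq])
    show "cmod (h m x * indicator {p..<q} x) \<le> B * indicator {p..q} x" for m x
      using hB[of m x] B by (auto simp: indicator_def)
    have "N \<in> null_sets lebesgue" using N by (simp add: negligible_iff_null_sets)
    \<comment> \<open>The approximants vanish at q, where u need not.\<close>
    moreover have "{q} \<in> null_sets lebesgue" by simp
    ultimately have "AE x in lebesgue. x \<notin> N \<and> x \<noteq> q"
      using AE_not_in[of N lebesgue] AE_not_in[of "{q}" lebesgue] by auto
    then show "AE x in lebesgue. (\<lambda>m. h m x * indicator {p..<q} x) \<longlonglongrightarrow> u x"
    proof eventually_elim
      case (elim x)
      show ?case
      proof (cases "x \<in> {p..<q}")
        case True
        have ux: "max B (cmod (u x)) = B" using bd[of x] True by simp
        have "(\<lambda>m. h m x) \<longlonglongrightarrow> of_real (B / max B (cmod (u x))) * u x"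
          unfolding h_def using elim B by (intro tendsto_intros lim) auto
        then show ?thesis using True B ux by simp
      next
        case False
        then have "u x = 0" using bd[of x] elim by (auto simp: indicator_def)
        then show ?thesis using False by simp
      qed
    qed
  qed (rule u bd)+
qed

end

section \<open>Density of test functions on the network\<close>

abbreviation half_line :: "nat \<Rightarrow> real measure" where "half_line \<equiv> \<lambda>_. lebesgue_on {0<..}"

lemma H_space_eq: "H_space n = L2 n half_line"
  and H_inner_eq: "H_inner n = L2_inner n half_line"
  and H_norm_eq: "H_norm n = L2_norm n half_line"
  and H_eq_eq: "H_eq n = L2_eq n half_line"
  by (auto simp: fun_eq_iff H_space_def L2_def H_inner_def L2_inner_def H_norm_def L2_norm_def H_eq_def L2_eq_def)

lemma bumps_test_functions:
  assumes "\<And>k. k \<in> {1..n} \<Longrightarrow> \<phi> k \<in> bumps p q" "0 < p"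
  shows "\<phi> \<in> test_functions n"
  unfolding test_functions_def
proof (intro CollectI ballI conjI)
  fix k assume "k \<in> {1..n}"
  then have k: "\<phi> k \<in> bumps p q" using assms by blast
  show "C_inf_on {0<..} (\<phi> k)" using k by (auto simp: bumps_def intro: C_inf_on_subset)
  show "\<exists>K. compact K \<and> K \<subseteq> {0<..} \<and> (\<forall>x\<in>{0<..} - K. \<phi> k x = 0)"
    using k assms by (intro exI[of _ "{p..q}"]) (auto simp: bumps_def)
qed

lemma test_functions_lincomb:
  assumes f: "f \<in> test_functions n" and g: "g \<in> test_functions n"
  shows "lincomb \<alpha> f \<beta> g \<in> test_functions n"
  unfolding test_functions_def
proof (intro CollectI ballI conjI)
  fix k assume k: "k \<in> {1..n}"
  show "C_inf_on {0<..} (lincomb \<alpha> f \<beta> g k)"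
    using f g k unfolding lincomb_def test_functions_def by (intro C_inf_on_lincomb) auto
  obtain K L where KL: "compact K" "K \<subseteq> {0<..}" "\<forall>x\<in>{0<..} - K. f k x = 0"
     "compact L" "L \<subseteq> {0<..}" "\<forall>x\<in>{0<..} - L. g k x = 0"
    using f g k unfolding test_functions_def by blast
  show "\<exists>K. compact K \<and> K \<subseteq> {0<..} \<and> (\<forall>x\<in>{0<..} - K. lincomb \<alpha> f \<beta> g k x = 0)"
    using KL by (intro exI[of _ "K \<union> L"]) (auto simp: lincomb_def)
qed

text \<open>A test function is not constrained at \<open>x \<le> 0\<close>.\<close>
definition zero_extension :: "tuple \<Rightarrow> tuple" where
  "zero_extension f k x = (if 0 < x then f k x else 0)"

lemma test_function_bump:
  assumes f: "f \<in> test_functions n" and k: "k \<in> {1..n}"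
  shows "\<exists>\<alpha> \<beta> g'. 0 < \<alpha> \<and> C1_bump \<alpha> \<beta> (zero_extension f k) g'"
proof -
  let ?g = "zero_extension f k"
  obtain D K where D: "derivs_on {0<..} (f k) D"
    and K: "compact K" "K \<subseteq> {0<..}" "\<forall>x\<in>{0<..} - K. f k x = 0"
    using f k unfolding test_functions_def C_inf_on_def by blast
  \<comment> \<open>K may be empty; the point 1 guarantees that infimum and supremum are
    attained.\<close>
  have cK: "compact (insert 1 K)" using K(1) by simp
  obtain \<alpha> where \<alpha>: "\<alpha> \<in> insert 1 K" "\<And>x. x \<in> insert 1 K \<Longrightarrow> \<alpha> \<le> x"
    using compact_attains_inf[OF cK] by auto
  obtain b where b: "b \<in> insert 1 K" "\<And>x. x \<in> insert 1 K \<Longrightarrow> x \<le> b"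
    using compact_attains_sup[OF cK] by auto
  \<comment> \<open>The extra 1 ensures \<alpha> < \<beta> even when the enlarged set is a single
    point.\<close>
  let ?\<beta> = "b + 1"
  have pos: "0 < \<alpha>" using \<alpha>(1) K(2) by auto
  have sub: "K \<subseteq> {\<alpha>..?\<beta>}" using \<alpha>(2) b(2) by (force intro: order_trans)
  have zero: "?g x = 0" if "x \<notin> {\<alpha>..?\<beta>}" for x
    using that sub K(3) by (auto simp: zero_extension_def)
  have dpos: "(?g has_vector_derivative D (Suc 0) x) (at x)" if x: "0 < x" for x
  proof (rule has_vector_derivative_transform_within_open)
    have "(D 0 has_vector_derivative D (Suc 0) x) (at x within {0<..})"
      using D x unfolding derivs_on_def by blast
    then show "(D 0 has_vector_derivative D (Suc 0) x) (at x)"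
      using x at_within_open[of x "{0<..}"] by simp
    show "D 0 y = ?g y" if "y \<in> {0<..}" for y
      using D that unfolding derivs_on_def zero_extension_def by simp
  qed (use x in auto)
  have dneg: "(?g has_vector_derivative 0) (at x)" if x: "x < \<alpha>" for x
    by (rule has_vector_derivative_transform_within_open[where f="\<lambda>_. 0" and S="{..<\<alpha>}"])
       (use x zero in auto)
  let ?g' = "\<lambda>x. if 0 < x then D (Suc 0) x else 0"
  have d: "(?g has_vector_derivative ?g' x) (at x)" for x
    using dpos[of x] dneg[of x] pos by (cases "0 < x") auto
  have g'0: "?g' x = 0" if "x < \<alpha>" for x
    using vector_derivative_unique_at[OF d dneg[OF that]] .
  have "continuous_on {0<..} (D (Suc 0))"
    using D unfolding derivs_on_def continuous_on_eq_continuous_within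
    using has_vector_derivative_continuous by blast
  then have c1: "continuous_on {0<..} ?g'" by (rule continuous_on_eq) auto
  have c2: "continuous_on {..<\<alpha>} ?g'"
    using g'0 by (intro continuous_on_eq[OF continuous_on_const[of _ 0]]) auto
  \<comment> \<open>The two open sets overlap because 0 < \<alpha>, so they cover the line and
    continuity at 0 is not a separate case.\<close>
  have "continuous_on ({0<..} \<union> {..<\<alpha>}) ?g'"
    by (rule continuous_on_open_Un[OF _ _ c1 c2]) auto
  moreover have "{0<..} \<union> {..<\<alpha>} = UNIV" using pos by auto
  ultimately have c': "continuous_on UNIV ?g'" by simp
  have "C1_bump \<alpha> ?\<beta> ?g ?g'"
    by unfold_locales (use \<alpha>(2)[of b] b d c' zero in auto)
  then show ?thesis using pos by blast
qed

text \<open>The factor u may be any continuous function: eigenfunctions, a conjugated test function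
  and linear majorants all occur in this place.\<close>

lemma half_line_integral:
  assumes f: "f \<in> test_functions n" and k: "k \<in> {1..n}" and u: "continuous_on UNIV u"
  shows "integrable (lebesgue_on {0<..}) (\<lambda>x. f k x * u x)"
    and "(LINT x|lebesgue_on {0<..}. f k x * u x) = (LINT x|lborel. zero_extension f k x * u x)"
proof -
  let ?g = "zero_extension f k"
  obtain \<alpha> \<beta> g' where "0 < \<alpha>" "C1_bump \<alpha> \<beta> ?g g'"
    using test_function_bump[OF f k] by blast
  then interpret C1_bump \<alpha> \<beta> ?g g' by simp
  have i: "integrable lborel (\<lambda>x. ?g x * u x)"
    by (intro integrable_mult_cont cont zero continuous_on_subset[OF u]) auto
  have eq: "(\<lambda>x. indicator {0<..} x *\<^sub>R (f k x * u x)) = (\<lambda>x. ?g x * u x)"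
    by (auto simp: zero_extension_def indicator_def fun_eq_iff)
  have il: "integrable lebesgue (\<lambda>x. indicator {0<..} x *\<^sub>R (f k x * u x))"
    unfolding eq using i by (subst integrable_completion) auto
  show "integrable (lebesgue_on {0<..}) (\<lambda>x. f k x * u x)"
    using il by (subst integrable_restrict_space) auto
  have "(LINT x|lebesgue_on {0<..}. f k x * u x) = (LINT x|lebesgue. indicator {0<..} x *\<^sub>R (f k x * u x))"
    by (rule integral_restrict_space) auto
  also have "\<dots> = (LINT x|lborel. ?g x * u x)"
    unfolding eq using i by (subst integral_completion) auto
  finally show "(LINT x|lebesgue_on {0<..}. f k x * u x) = (LINT x|lborel. ?g x * u x)" .
qed

lemma test_function_continuous: "f \<in> test_functions n \<Longrightarrow> k \<in> {1..n} \<Longrightarrow> continuous_on UNIV (zero_extension f k)"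
  using test_function_bump C1_bump.cont by blast

lemma test_functions_H:
  assumes f: "f \<in> test_functions n"
  shows "f \<in> L2 n half_line"
    and "(L2_norm n half_line f)\<^sup>2 = (\<Sum>k=1..n. LINT x|lborel. (cmod (zero_extension f k x))\<^sup>2)"
proof -
  have i: "integrable (lebesgue_on {0<..}) (\<lambda>x. f k x * cnj (f k x))"
    "(LINT x|lebesgue_on {0<..}. f k x * cnj (f k x)) = (LINT x|lborel. zero_extension f k x * cnj (zero_extension f k x))"
    if k: "k \<in> {1..n}" for k
  proof -
    have c: "continuous_on UNIV (\<lambda>x. cnj (zero_extension f k x))"
      by (intro continuous_on_cnj test_function_continuous[OF f k])
    show "integrable (lebesgue_on {0<..}) (\<lambda>x. f k x * cnj (f k x))"
      by (rule iffD1[OF Bochner_Integration.integrable_cong half_line_integral(1)[OF f k c]])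
         (auto simp: zero_extension_def)
    have "(LINT x|lebesgue_on {0<..}. f k x * cnj (f k x)) = (LINT x|lebesgue_on {0<..}. f k x * cnj (zero_extension f k x))"
      by (rule Bochner_Integration.integral_cong) (auto simp: zero_extension_def)
    then show "(LINT x|lebesgue_on {0<..}. f k x * cnj (f k x)) = (LINT x|lborel. zero_extension f k x * cnj (zero_extension f k x))"
      using half_line_integral(2)[OF f k c] by simp
  qed
  have sq: "(\<lambda>x. u x * cnj (u x)) = (\<lambda>x. complex_of_real ((cmod (u x))\<^sup>2))" for u :: "real \<Rightarrow> complex"
    by (simp only: complex_norm_square)
  show "f \<in> L2 n half_line"
    unfolding L2_def
  proof (intro CollectI ballI conjI)
    fix k assume k: "k \<in> {1..n}"
    show "f k \<in> borel_measurable (lebesgue_on {0<..})"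
      using half_line_integral(1)[OF f k continuous_on_const[of _ 1]] by auto
    show "integrable (lebesgue_on {0<..}) (\<lambda>x. (cmod (f k x))\<^sup>2)"
      using i(1)[OF k] unfolding sq by (simp only: complex_of_real_integrable_eq)
  qed
  have "complex_of_real ((L2_norm n half_line f)\<^sup>2) = L2_inner n half_line f f"
    by (simp only: L2_inner_self_norm)
  also have "\<dots> = (\<Sum>k=1..n. LINT x|lborel. zero_extension f k x * cnj (zero_extension f k x))"
    unfolding L2_inner_def by (rule sum.cong[OF refl i(2)])
  also have "\<dots> = of_real (\<Sum>k=1..n. LINT x|lborel. (cmod (zero_extension f k x))\<^sup>2)"
    unfolding sq of_real_sum integral_complex_of_real ..
  finally show "(L2_norm n half_line f)\<^sup>2 = (\<Sum>k=1..n. LINT x|lborel. (cmod (zero_extension f k x))\<^sup>2)"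
    by (simp only: of_real_eq_iff)
qed

context smooth_step
begin

lemma bumps_dense_bounded:
  assumes h: "\<And>k. k \<in> {1..n} \<Longrightarrow> h k \<in> borel_measurable (lebesgue_on {0<..})"
    and bd: "\<And>k x. k \<in> {1..n} \<Longrightarrow> 0 < x \<Longrightarrow> cmod (h k x) \<le> B * indicator {p..q} x"
    and pq: "0 < p" "p < q" and e: "0 < e"
  shows "\<exists>\<phi>. (\<forall>k\<in>{1..n}. \<phi> k \<in> bumps p q) \<and> L2_norm n half_line (h \<ominus> \<phi>) < e"
proof -
  \<comment> \<open>The squared errors of the n branches add up to at most n d^2, which is below ((n
    + 1) d)^2 = e^2.\<close>
  define d where "d = e / (real n + 1)"
  have d: "0 < d" using e by (simp add: d_def)
  have "\<exists>\<phi>. \<phi> \<in> bumps p q \<and> (LINT x|lebesgue_on {0<..}. (cmod (h k x - \<phi> x))\<^sup>2) < d\<^sup>2" if k: "k \<in> {1..n}" for k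
  proof -
    let ?u = "zero_extension h k"
    have um: "?u \<in> borel_measurable lebesgue"
    proof -
      have "(\<lambda>x. if x \<in> {0<..} then h k x else 0) \<in> borel_measurable lebesgue"
        using h[OF k] by (subst borel_measurable_if) auto
      then show ?thesis by (simp add: zero_extension_def[abs_def])
    qed
    \<comment> \<open>\<open>approximable_bounded\<close> asks for a positive bound, whereas B may
      be 0.\<close>
    have "cmod (?u x) \<le> max B 1 * indicator {p..q} x" for x
    proof (cases "0 < x")
      case True
      then have "cmod (?u x) \<le> B * indicator {p..q} x" using bd[OF k] by (simp add: zero_extension_def)
      also have "\<dots> \<le> max B 1 * indicator {p..q} x" by (intro mult_right_mono) auto
      finally show ?thesis .
    qed (simp add: zero_extension_def)
    then have "approximable p q ?u"
      by (rule approximable_bounded[OF um _ pq(2)]) simp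
    then obtain \<phi> where ph: "\<phi> \<in> bumps p q" "L2_norm 1 Leb ((\<lambda>_. ?u) \<ominus> (\<lambda>_. \<phi>)) < d"
      using d unfolding approximable_def by blast
    have uL: "(\<lambda>_. ?u) \<ominus> (\<lambda>_. \<phi>) \<in> L2 1 Leb"
      using \<open>approximable p q ?u\<close> by (intro lincomb_L2 bumps_L2[OF ph(1)]) (simp add: approximable_def)
    have "(LINT x|lebesgue_on {0<..}. (cmod (h k x - \<phi> x))\<^sup>2)
        = (LINT x|lebesgue. indicator {0<..} x *\<^sub>R (cmod (h k x - \<phi> x))\<^sup>2)"
      by (rule integral_restrict_space) auto
    also have "\<dots> = (LINT x|lebesgue. (cmod (?u x - \<phi> x))\<^sup>2)"
      using ph(1) pq by (intro Bochner_Integration.integral_cong) (auto simp: zero_extension_def bumps_def indicator_def)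
    also have "\<dots> = (L2_norm 1 Leb ((\<lambda>_. ?u) \<ominus> (\<lambda>_. \<phi>)))\<^sup>2"
      unfolding L2_norm_square by (simp add: lincomb_def)
    also have "\<dots> < d\<^sup>2" by (rule power_strict_mono[OF ph(2)]) auto
    finally show ?thesis using ph(1) by blast
  qed
  then obtain \<phi> where ph: "\<And>k. k \<in> {1..n} \<Longrightarrow> \<phi> k \<in> bumps p q"
    "\<And>k. k \<in> {1..n} \<Longrightarrow> (LINT x|lebesgue_on {0<..}. (cmod (h k x - \<phi> k x))\<^sup>2) < d\<^sup>2"
    by metis
  have "(L2_norm n half_line (h \<ominus> \<phi>))\<^sup>2 \<le> (\<Sum>k=1..n. d\<^sup>2)"
    unfolding L2_norm_square
    by (rule sum_mono) (use less_imp_le[OF ph(2)] in \<open>simp add: lincomb_def\<close>)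
  also have "\<dots> = real n * d\<^sup>2" by simp
  also have "\<dots> < (real n + 1)\<^sup>2 * d\<^sup>2"
  proof (rule mult_strict_right_mono)
    have "real n \<le> real n * (real n + 1)" by (simp add: distrib_left)
    then show "real n < (real n + 1)\<^sup>2" by (simp add: power2_eq_square distrib_right)
  qed (use d in simp)
  also have "\<dots> = e\<^sup>2" by (simp add: d_def power_divide)
  finally have "L2_norm n half_line (h \<ominus> \<phi>) < e"
    by (rule power2_less_imp_less) (use e in simp)
  then show ?thesis using ph(1) by blast
qed

lemma test_functions_dense:
  assumes h: "h \<in> L2 n half_line" and e: "0 < e"
  shows "\<exists>f\<in>test_functions n. L2_norm n half_line (h \<ominus> f) < e"
proof -
  \<comment> \<open>Cut-off in space and in height. The shift by 2 makes the interval nondegenerate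
    for every m, including 0.\<close>
  let ?P = "\<lambda>m k x. x \<in> {1 / real (m + 2)..real (m + 2)} \<and> cmod (h k x) \<le> real m"
  define t where "t m k x = (if ?P m k x then h k x else 0)" for m k x
  have e2: "0 < e / 2" using e by simp
  have P: "Measurable.pred (lebesgue_on {0<..}) (?P m k)" if k: "k \<in> {1..n}" for m k
  proof -
    note [measurable] = L2D(1)[OF h k]
    have [measurable]: "(\<lambda>x. x) \<in> borel_measurable (lebesgue_on {0<..})"
      by (intro measurable_restrict_space1 borel_imp_lebesgue) simp
    show ?thesis by measurable
  qed
  have ev: "\<forall>\<^sub>F m in sequentially. ?P m k x \<or> h k x = 0"
    if "x \<in> space (lebesgue_on {0<..})" for k and x :: real
    using eventually_ge_at_top[of "nat \<lceil>max (max x (1 / x)) (cmod (h k x))\<rceil>"]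
  proof eventually_elim
    case (elim m)
    have x: "0 < x" using that by simp
    have "max (max x (1 / x)) (cmod (h k x)) \<le> real m" using elim by linarith
    then have m: "x \<le> real m" "1 / x \<le> real (m + 2)" "cmod (h k x) \<le> real m" by auto
    then have "1 / real (m + 2) \<le> x" using x by (simp add: field_simps)
    then show ?case using m by simp
  qed
  note trunc = L2_truncation[where P="?P", OF h e2 P ev]
  have tL: "t m \<in> L2 n half_line" for m using trunc(1) unfolding t_def[abs_def] .
  obtain m where m: "L2_norm n half_line (h \<ominus> t m) < e / 2"
    using trunc(2) unfolding t_def[abs_def] by blast
  have "\<exists>\<phi>. (\<forall>k\<in>{1..n}. \<phi> k \<in> bumps (1 / real (m + 2)) (real (m + 2))) \<and> L2_norm n half_line (t m \<ominus> \<phi>) < e / 2"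
  proof (rule bumps_dense_bounded[where B="real m"])
    have "1 / real (m + 2) < 1" by simp
    also have "1 < real (m + 2)" by simp
    finally show "1 / real (m + 2) < real (m + 2)" .
  qed (use L2D(1)[OF tL] e in \<open>auto simp: t_def\<close>)
  then obtain \<phi> where ph: "\<And>k. k \<in> {1..n} \<Longrightarrow> \<phi> k \<in> bumps (1 / real (m + 2)) (real (m + 2))"
    "L2_norm n half_line (t m \<ominus> \<phi>) < e / 2"
    by blast
  have pt: "\<phi> \<in> test_functions n" by (rule bumps_test_functions[OF ph(1)]) simp_all
  have "L2_norm n half_line (h \<ominus> \<phi>) \<le> L2_norm n half_line (h \<ominus> t m) + L2_norm n half_line (t m \<ominus> \<phi>)"
    by (intro L2_norm_triangle h tL test_functions_H pt)
  then show ?thesis using m ph(2) pt by (intro bexI[of _ \<phi>]) auto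
qed

end


subsection \<open>The spectral side\<close>

lemma AE_half_line_neq: "AE \<mu> in lebesgue_on {b..}. \<mu> \<noteq> (b::real)"
proof -
  have "AE \<mu> in lebesgue. \<mu> \<noteq> b" by (rule AE_completion[OF AE_lborel_singleton])
  then show ?thesis by (subst AE_restrict_space_iff) auto
qed

lemma integrable_lborel_imp_lebesgue_on:
  fixes u :: "real \<Rightarrow> 'b :: {banach, second_countable_topology}"
  assumes "integrable lborel u" "S \<in> sets lebesgue"
  shows "integrable (lebesgue_on S) u"
proof -
  have "integrable lebesgue u" using assms(1) by (subst integrable_completion) auto
  then show ?thesis using assms(2) by (simp add: integrable_restrict_space integrable_mult_indicator)
qed

context network
begin

text \<open>Absorbing the weight into the measure makes the spectral space another instance of
  \<open>L2\<close>, with a different measure on each branch.\<close>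

abbreviation Msig :: "nat \<Rightarrow> real measure" where
  "Msig \<equiv> \<lambda>k. density (lebesgue_on {a k..}) (\<lambda>\<mu>. ennreal (sigma n c a k \<mu>))"

lemma borel_imp_lebesgue_on: "u \<in> borel_measurable borel \<Longrightarrow> u \<in> borel_measurable (lebesgue_on S)"
  by (intro measurable_restrict_space1 borel_imp_lebesgue)

lemma measurable_sigma_on: "k \<in> {1..n} \<Longrightarrow> sigma n c a k \<in> borel_measurable (lebesgue_on {a k..})"
  by (intro borel_imp_lebesgue_on measurable_sigma)

lemma integrable_Msig:
  fixes u :: "real \<Rightarrow> 'b :: {banach, second_countable_topology}"
  assumes "k \<in> {1..n}" "u \<in> borel_measurable (lebesgue_on {a k..})"
  shows "integrable (Msig k) u \<longleftrightarrow> integrable (lebesgue_on {a k..}) (\<lambda>\<mu>. sigma n c a k \<mu> *\<^sub>R u \<mu>)"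
  using assms by (intro integrable_density measurable_sigma_on) (auto intro!: AE_I2 sigma_nonneg)

lemma integral_Msig:
  fixes u :: "real \<Rightarrow> 'b :: {banach, second_countable_topology}"
  assumes "k \<in> {1..n}" "u \<in> borel_measurable (lebesgue_on {a k..})"
  shows "integral\<^sup>L (Msig k) u = (LINT \<mu>|lebesgue_on {a k..}. sigma n c a k \<mu> *\<^sub>R u \<mu>)"
  using assms by (intro integral_density measurable_sigma_on) (auto intro!: AE_I2 sigma_nonneg)

lemma L2_sigma_eq: "L2_sigma n c a = L2 n Msig"
proof -
  have "(\<lambda>\<mu>. (cmod (F \<mu>))\<^sup>2) \<in> borel_measurable (lebesgue_on S)"
    if "F \<in> borel_measurable (lebesgue_on S)" for F :: "real \<Rightarrow> complex" and S
    using that by measurable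
  then show ?thesis
    unfolding L2_sigma_def L2_def by (auto simp: integrable_Msig)
qed

lemma sigma_inner_eq:
  assumes F: "F \<in> L2 n Msig" and G: "G \<in> L2 n Msig"
  shows "sigma_inner n c a F G = L2_inner n Msig F G"
  unfolding sigma_inner_def L2_inner_def
proof (rule sum.cong[OF refl])
  fix k assume k: "k \<in> {1..n}"
  have "(\<lambda>\<mu>. F k \<mu> * cnj (G k \<mu>)) \<in> borel_measurable (lebesgue_on {a k..})"
    using integrable_L2_mult[OF F G k] by auto
  from integral_Msig[OF k this]
  show "(LINT \<mu>|lebesgue_on {a k..}. of_real (sigma n c a k \<mu>) * F k \<mu> * cnj (G k \<mu>))
      = (LINT \<mu>|Msig k. F k \<mu> * cnj (G k \<mu>))"
    by (simp add: scaleR_conv_of_real mult.assoc)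
qed

lemma sigma_norm_eq: "F \<in> L2 n Msig \<Longrightarrow> sigma_norm n c a F = L2_norm n Msig F"
  by (simp add: sigma_norm_def L2_norm_def sigma_inner_eq)

lemma AE_Msig_iff:
  assumes k: "k \<in> {1..n}"
  shows "(AE \<mu> in Msig k. P \<mu>) \<longleftrightarrow> (AE \<mu> in lebesgue_on {a k..}. P \<mu>)"
proof -
  have m: "(\<lambda>\<mu>. ennreal (sigma n c a k \<mu>)) \<in> borel_measurable (lebesgue_on {a k..})"
    using measurable_sigma_on[OF k] by measurable
  have "(AE \<mu> in Msig k. P \<mu>) \<longleftrightarrow> (AE \<mu> in lebesgue_on {a k..}. 0 < sigma n c a k \<mu> \<longrightarrow> P \<mu>)"
    by (simp add: AE_density[OF m])
  also have "\<dots> \<longleftrightarrow> (AE \<mu> in lebesgue_on {a k..}. P \<mu>)"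
  proof
    assume "AE \<mu> in lebesgue_on {a k..}. 0 < sigma n c a k \<mu> \<longrightarrow> P \<mu>"
    moreover have "AE \<mu> in lebesgue_on {a k..}. a k \<le> \<mu>" by (rule AE_I2) simp
    ultimately show "AE \<mu> in lebesgue_on {a k..}. P \<mu>"
      using AE_half_line_neq[of "a k"] by eventually_elim (use sigma_pos[OF k] in auto)
  next
    assume "AE \<mu> in lebesgue_on {a k..}. P \<mu>"
    then show "AE \<mu> in lebesgue_on {a k..}. 0 < sigma n c a k \<mu> \<longrightarrow> P \<mu>" by eventually_elim simp
  qed
  finally show ?thesis .
qed

lemma sigma_eq_iff: "sigma_eq n a F G \<longleftrightarrow> L2_eq n Msig F G"
  unfolding sigma_eq_def L2_eq_def using AE_Msig_iff by blast

lemma continuous_F_minus: "continuous_on UNIV (\<lambda>x. cnj (F_minus n c a k z j x))"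
  unfolding F_minus_def by (cases "j = k") (auto intro!: continuous_intros)

lemma V_test:
  assumes f: "f \<in> test_functions n"
  shows "V n c a f k \<mu> = (\<Sum>j=1..n. LINT x|lborel. zero_extension f j x * cnj (F_minus n c a k (of_real \<mu>) j x))"
  unfolding V_def
  by (rule sum.cong[OF refl half_line_integral(2)[OF f _ continuous_F_minus]])

lemma V_isometry:
  assumes f: "f \<in> test_functions n"
  shows "V n c a f \<in> L2 n Msig" and "L2_norm n Msig (V n c a f) = L2_norm n half_line f"
proof -
  have "\<forall>k\<in>{1..n}. \<exists>\<alpha> \<beta> g'. 0 < \<alpha> \<and> C1_bump \<alpha> \<beta> (zero_extension f k) g'"
    using test_function_bump[OF f] by blast
  then obtain \<alpha> \<beta> g' where "\<forall>k\<in>{1..n}. 0 < \<alpha> k \<and> C1_bump (\<alpha> k) (\<beta> k) (zero_extension f k) (g' k)"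
    by metis
  then interpret network_bump n c a \<alpha> \<beta> "zero_extension f" g'
    by (intro network_bump.intro network_axioms network_bump_axioms.intro) blast+
  have VV: "V n c a f k = Vg k" if "k \<in> {1..n}" for k
    by (rule ext) (simp only: V_test[OF f] Vg_eq[OF that])
  have Vm: "V n c a f k \<in> borel_measurable borel" if "k \<in> {1..n}" for k
    unfolding VV[OF that] by (rule measurable_Vg[OF that])
  have i: "integrable lborel (\<lambda>\<mu>. sigma n c a k \<mu> * (cmod (V n c a f k \<mu>))\<^sup>2)" if k: "k \<in> {1..n}" for k
    unfolding VV[OF k] by (rule isometry(1)[OF k])
  show L: "V n c a f \<in> L2 n Msig"
    unfolding L2_sigma_eq[symmetric] L2_sigma_def
  proof (intro CollectI ballI conjI)
    fix k assume k: "k \<in> {1..n}"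
    show "V n c a f k \<in> borel_measurable (lebesgue_on {a k..})"
      by (rule borel_imp_lebesgue_on[OF Vm[OF k]])
    show "integrable (lebesgue_on {a k..}) (\<lambda>\<mu>. sigma n c a k \<mu> * (cmod (V n c a f k \<mu>))\<^sup>2)"
      by (rule integrable_lborel_imp_lebesgue_on[OF i[OF k]]) simp
  qed
  have "(L2_norm n Msig (V n c a f))\<^sup>2 = (\<Sum>k=1..n. LINT \<mu>|lborel. sigma n c a k \<mu> * (cmod (V n c a f k \<mu>))\<^sup>2)"
    unfolding L2_norm_square
  proof (rule sum.cong[OF refl])
    fix k assume k: "k \<in> {1..n}"
    have [measurable]: "V n c a f k \<in> borel_measurable (lebesgue_on {a k..})"
      by (rule borel_imp_lebesgue_on[OF Vm[OF k]])
    have "(\<lambda>\<mu>. (cmod (V n c a f k \<mu>))\<^sup>2) \<in> borel_measurable (lebesgue_on {a k..})" by measurable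
    from integral_Msig[OF k this]
    have "(LINT \<mu>|Msig k. (cmod (V n c a f k \<mu>))\<^sup>2)
        = (LINT \<mu>|lebesgue_on {a k..}. sigma n c a k \<mu> * (cmod (V n c a f k \<mu>))\<^sup>2)" by simp
    also have "\<dots> = (LINT \<mu>|lebesgue. indicator {a k..} \<mu> *\<^sub>R (sigma n c a k \<mu> * (cmod (V n c a f k \<mu>))\<^sup>2))"
      by (rule integral_restrict_space) simp
    \<comment> \<open>\<open>sigma\<close> vanishes below a_k, so the half line may be replaced by
      the whole line, over which the contour argument integrates.\<close>
    also have "\<dots> = (LINT \<mu>|lebesgue. sigma n c a k \<mu> * (cmod (V n c a f k \<mu>))\<^sup>2)"
      by (rule Bochner_Integration.integral_cong) (auto simp: indicator_def sigma_inactive[OF k])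
    also have "\<dots> = (LINT \<mu>|lborel. sigma n c a k \<mu> * (cmod (V n c a f k \<mu>))\<^sup>2)"
      using i[OF k] by (subst integral_completion) auto
    finally show "(LINT \<mu>|Msig k. (cmod (V n c a f k \<mu>))\<^sup>2)
        = (LINT \<mu>|lborel. sigma n c a k \<mu> * (cmod (V n c a f k \<mu>))\<^sup>2)" .
  qed
  also have "\<dots> = (\<Sum>k=1..n. LINT \<mu>|lborel. sigma n c a k \<mu> * (cmod (Vg k \<mu>))\<^sup>2)"
    by (rule sum.cong[OF refl]) (simp add: VV)
  also have "\<dots> = (L2_norm n half_line f)\<^sup>2"
    unfolding test_functions_H(2)[OF f] by (rule isometry(2))
  finally show "L2_norm n Msig (V n c a f) = L2_norm n half_line f"
    by (simp add: power2_eq_iff_nonneg)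
qed

lemma V_lincomb:
  assumes f: "f \<in> test_functions n" and g: "g \<in> test_functions n"
  shows "V n c a (lincomb \<alpha> f \<beta> g) = lincomb \<alpha> (V n c a f) \<beta> (V n c a g)"
proof (intro ext)
  fix k \<mu>
  let ?E = "\<lambda>j x. cnj (F_minus n c a k (of_real \<mu>) j x)"
  have "(LINT x|lebesgue_on {0<..}. lincomb \<alpha> f \<beta> g j x * ?E j x) =
      \<alpha> * (LINT x|lebesgue_on {0<..}. f j x * ?E j x) + \<beta> * (LINT x|lebesgue_on {0<..}. g j x * ?E j x)"
    if j: "j \<in> {1..n}" for j
    using half_line_integral(1)[OF f j continuous_F_minus] half_line_integral(1)[OF g j continuous_F_minus]
    by (simp add: lincomb_def distrib_right mult.assoc)
  then show "V n c a (lincomb \<alpha> f \<beta> g) k \<mu> = lincomb \<alpha> (V n c a f) \<beta> (V n c a g) k \<mu>"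
    by (simp add: V_def lincomb_def[of \<alpha> "V n c a f"] sum.distrib sum_distrib_left)
qed

text \<open>The factor W / (c_k \<eta>_k) of the sine correction may blow up at the threshold \<mu>
  = a_k. The inequality |sin(e x)| \<le> e x tames it; this costs linear growth in x but makes the
  bound uniform in \<mu>.\<close>

lemma F_minus_bound:
  assumes k: "k \<in> {1..n}"
  obtains C where "0 \<le> C"
    "\<And>j \<mu> x. j \<in> {1..n} \<Longrightarrow> a k \<le> \<mu> \<Longrightarrow> 0 < x \<Longrightarrow> cmod (F_minus n c a k (of_real \<mu>) j x) \<le> C * (1 + x)"
proof -
  \<comment> \<open>With e = \<eta>_k, subadditivity of the square root bounds |\<eta>_j| by
    sqrt(c_k / c_j) e + sqrt(|a_k - a_j| / c_j).\<close>
  define K where "K = (\<Sum>j=1..n. c j * (sqrt (c k / c j) + sqrt (\<bar>a k - a j\<bar> / c j)))"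
  define C where "C = 1 + K / c k"
  have ck: "0 < c k" using c k .
  have K: "0 \<le> K" unfolding K_def using c ck by (intro sum_nonneg mult_nonneg_nonneg add_nonneg_nonneg) (auto simp: less_imp_le)
  have W: "cmod (W (of_real \<mu>)) \<le> K * (e + 1)" if \<mu>: "a k \<le> \<mu>" "e = sqrt ((\<mu> - a k) / c k)" for \<mu> e
  proof -
    have e0: "0 \<le> e" using \<mu> ck by simp
    have "cmod (W (of_real \<mu>)) \<le> (\<Sum>j=1..n. c j * (sqrt (c k / c j) + sqrt (\<bar>a k - a j\<bar> / c j)) * (e + 1))"
      unfolding eta_sum_def
    proof (rule sum_norm_le)
      fix j assume j: "j \<in> {1..n}"
      have cj: "0 < c j" using c j .
      have "cmod (\<eta> j (of_real \<mu>)) = sqrt (\<bar>\<mu> - a j\<bar> / c j)"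
        unfolding norm_eta[OF j] of_real_diff[symmetric] norm_of_real ..
      also have "\<dots> \<le> sqrt ((\<mu> - a k) / c j + \<bar>a k - a j\<bar> / c j)"
        unfolding add_divide_distrib[symmetric] using \<mu> cj by (intro real_sqrt_le_mono divide_right_mono) auto
      also have "\<dots> \<le> sqrt ((\<mu> - a k) / c j) + sqrt (\<bar>a k - a j\<bar> / c j)"
        using \<mu> cj by (intro sqrt_add_le_add_sqrt) auto
      also have "sqrt ((\<mu> - a k) / c j) = sqrt (c k / c j) * e"
        unfolding \<mu>(2) real_sqrt_mult[symmetric] using ck by simp
      also have "sqrt (c k / c j) * e + sqrt (\<bar>a k - a j\<bar> / c j)
          \<le> (sqrt (c k / c j) + sqrt (\<bar>a k - a j\<bar> / c j)) * (e + 1)"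
        using e0 ck cj by (simp add: distrib_left distrib_right)
      finally show "cmod (of_real (c j) * \<eta> j (of_real \<mu>))
          \<le> c j * (sqrt (c k / c j) + sqrt (\<bar>a k - a j\<bar> / c j)) * (e + 1)"
        using cj by (simp add: norm_mult mult.assoc)
    qed
    then show ?thesis by (simp add: K_def sum_distrib_right)
  qed
  have "cmod (F_minus n c a k (of_real \<mu>) j x) \<le> C * (1 + x)"
    if j: "j \<in> {1..n}" and \<mu>: "a k \<le> \<mu>" and x: "0 < x" for j \<mu> x
  proof -
    let ?e = "sqrt ((\<mu> - a k) / c k)"
    have e0: "0 \<le> ?e" using \<mu> ck by simp
    let ?T = "\<i> * (W (of_real \<mu>) / (of_real (c k) * \<eta> k (of_real \<mu>))) * sin (\<eta> k (of_real \<mu>) * of_real x)"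
    have "cmod (exp (\<i> * \<eta> j (of_real \<mu>) * of_real x)) \<le> 1"
      using eta_nonneg(2)[OF j, of "of_real \<mu>"] x by simp
    moreover have "cmod ?T \<le> K / c k * (1 + x)"
    proof (cases "?e = 0")
      case True
      then have "\<eta> k (of_real \<mu>) = 0" using eta_active[OF k \<mu>] by simp
      then show ?thesis using K ck x by simp
    next
      case False
      then have e: "0 < ?e" using e0 by linarith
      have s: "\<bar>sin (?e * x)\<bar> \<le> 1" "\<bar>sin (?e * x)\<bar> \<le> ?e * x"
        using abs_sin_x_le_abs_x[of "?e * x"] e x by (auto simp: abs_mult)
      have "cmod ?T = cmod (W (of_real \<mu>)) / (c k * ?e) * \<bar>sin (?e * x)\<bar>"
        using ck e unfolding eta_active[OF k \<mu>] of_real_mult[symmetric] sin_of_real norm_mult norm_divide norm_of_real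
        by simp
      also have "\<dots> \<le> K * (?e + 1) / (c k * ?e) * \<bar>sin (?e * x)\<bar>"
        using W[OF \<mu> refl] ck e by (intro mult_right_mono divide_right_mono) auto
      also have "\<dots> = K / c k * (\<bar>sin (?e * x)\<bar> + \<bar>sin (?e * x)\<bar> / ?e)"
        using ck e by (simp add: field_simps)
      also have "\<dots> \<le> K / c k * (1 + x)"
      proof (intro mult_left_mono add_mono s(1))
        show "\<bar>sin (?e * x)\<bar> / ?e \<le> x" using s(2) e by (simp only: pos_divide_le_eq mult.commute)
      qed (use K ck in simp)
      finally show ?thesis .
    qed
    moreover have "cmod (F_minus n c a k (of_real \<mu>) j x) \<le> cmod (exp (\<i> * \<eta> j (of_real \<mu>) * of_real x)) + cmod ?T"
    proof -
      have "cmod (F_minus n c a k (of_real \<mu>) j x) = cmod (cnj (F_minus n c a k (of_real \<mu>) j x))" by simp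
      also have "\<dots> \<le> cmod (exp (\<i> * \<eta> j (of_real \<mu>) * of_real x)) + cmod ?T"
        unfolding cnj_F_minus[OF k] by (rule order_trans[OF norm_triangle_ineq4]) simp
      finally show ?thesis .
    qed
    ultimately have "cmod (F_minus n c a k (of_real \<mu>) j x) \<le> 1 + K / c k * (1 + x)" by linarith
    also have "\<dots> \<le> C * (1 + x)" using x by (simp add: C_def distrib_right)
    finally show ?thesis .
  qed
  then show ?thesis using that[of C] K ck by (simp add: C_def)
qed

text \<open>The numerator c_k Re \<eta>_k is one of the nonnegative summands of Re W, so
  \<open>sigma\<close> is at most 1 / (pi |W|) and can be singular only at a_1.\<close>

lemma sigma_bound:
  assumes k: "k \<in> {1..n}"
  shows "sigma n c a k \<mu> \<le> 1 / (sqrt (c 1) * pi) / sqrt \<bar>\<mu> - a 1\<bar>"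
proof (cases "\<mu> \<le> a k")
  case True
  then show ?thesis using sigma_inactive[OF k True] c[OF one] by simp
next
  case False
  then have \<mu>: "\<mu> \<noteq> a 1" using a[OF k] by simp
  let ?W = "cmod (W (of_real \<mu>))"
  have W: "sqrt (c 1) * sqrt \<bar>\<mu> - a 1\<bar> \<le> ?W"
    using norm_W_ge[of "of_real \<mu>"] unfolding of_real_diff[symmetric] norm_of_real by simp
  have pos: "0 < sqrt (c 1) * sqrt \<bar>\<mu> - a 1\<bar>" using c[OF one] \<mu> by simp
  have "c k * Re (\<eta> k (of_real \<mu>)) \<le> Re (W (of_real \<mu>))"
    using member_le_sum[OF k, of "\<lambda>j. c j * Re (\<eta> j (of_real \<mu>))"] eta_nonneg(1) c
    by (simp add: eta_sum_def less_imp_le)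
  also have "\<dots> \<le> ?W" by (rule complex_Re_le_cmod)
  finally have "sigma n c a k \<mu> \<le> ?W / ?W\<^sup>2 / pi"
    unfolding sigma_eq_eta by (intro divide_right_mono) auto
  also have "\<dots> = 1 / ?W / pi" by (simp add: power2_eq_square)
  also have "\<dots> \<le> 1 / (sqrt (c 1) * sqrt \<bar>\<mu> - a 1\<bar>) / pi"
  proof -
    have "0 < ?W" using W pos by linarith
    from divide_left_mono[OF W _ mult_pos_pos[OF this pos], of 1] show ?thesis
      by (intro divide_right_mono) auto
  qed
  finally show ?thesis by (simp add: field_simps)
qed

end

lemma sigma_finite_lebesgue: "sigma_finite_measure (lebesgue :: real measure)"
proof (rule sigma_finite_measure.intro, intro exI conjI ballI)
  let ?A = "range (\<lambda>m::nat. {- real m..real m})"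
  show "countable ?A" by simp
  show "?A \<subseteq> sets lebesgue" by auto
  show "\<Union>?A = space lebesgue"
  proof -
    have "\<exists>m. x \<in> {- real m..real m}" for x
    proof -
      obtain m where "\<bar>x\<bar> \<le> real m" using real_arch_simple by blast
      then show ?thesis by (intro exI[of _ m]) auto
    qed
    then show ?thesis by auto
  qed
  show "emeasure lebesgue A \<noteq> \<infinity>" if "A \<in> ?A" for A
    using that fmeasurableD2[OF lmeasurable_cbox] by auto
qed

lemma sigma_finite_lebesgue_on: "S \<in> sets lebesgue \<Longrightarrow> sigma_finite_measure (lebesgue_on S :: real measure)"
  by (rule sigma_finite_measure_restrict_space[OF sigma_finite_lebesgue])

context network
begin

section \<open>The operator Z as formal adjoint of V\<close>

lemma pair_sigma_finite_Msig:
  assumes k: "k \<in> {1..n}"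
  shows "pair_sigma_finite (Msig k) (lebesgue_on {0<..} :: real measure)"
proof -
  interpret sigma_finite_measure "lebesgue_on {a k..}" by (rule sigma_finite_lebesgue_on) simp
  have m: "(\<lambda>\<mu>. ennreal (sigma n c a k \<mu>)) \<in> borel_measurable (lebesgue_on {a k..})"
    using measurable_sigma_on[OF k] by measurable
  have "sigma_finite_measure (Msig k)"
    unfolding sigma_finite_iff_density_finite[OF m] by (rule AE_I2) simp
  moreover have "sigma_finite_measure (lebesgue_on {0<..} :: real measure)"
    by (rule sigma_finite_lebesgue_on) simp
  ultimately show ?thesis by (rule pair_sigma_finite.intro)
qed

text \<open>Joint measurability is read off from the formula for the conjugate, built from \<eta>,
  W, exp and sin; the definition itself goes through the branch cut of \<open>nsqrt\<close>.\<close>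

lemma measurable_F_minus:
  assumes k: "k \<in> {1..n}" and j: "j \<in> {1..n}"
  shows "(\<lambda>(\<mu>, x). F_minus n c a k (of_real \<mu>) j x) \<in> borel_measurable (borel \<Otimes>\<^sub>M borel)"
proof -
  note [measurable] = measurable_eta[OF k] measurable_eta[OF j] measurable_W
  have [measurable]: "sin \<in> borel_measurable (borel :: complex measure)"
    "cnj \<in> borel_measurable borel" "complex_of_real \<in> borel_measurable borel"
    by (intro borel_measurable_continuous_onI continuous_intros)+
  have "(\<lambda>(\<mu>, x). cnj (exp (\<i> * \<eta> j (of_real \<mu>) * of_real x) -
     (if j = k then \<i> * (W (of_real \<mu>) / (of_real (c k) * \<eta> k (of_real \<mu>)))
        * sin (\<eta> k (of_real \<mu>) * of_real x) else 0))) \<in> borel_measurable (borel \<Otimes>\<^sub>M borel)"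
    by measurable
  then show ?thesis unfolding cnj_F_minus[OF k, symmetric] complex_cnj_cnj .
qed

lemma measurable_F_minus_pair:
  assumes k: "k \<in> {1..n}" and j: "j \<in> {1..n}"
  shows "(\<lambda>(\<mu>, x). F_minus n c a k (of_real \<mu>) j x) \<in> borel_measurable (Msig k \<Otimes>\<^sub>M lebesgue_on {0<..})"
proof -
  have [measurable]: "(\<lambda>x. x) \<in> measurable (Msig k) borel" "(\<lambda>x. x) \<in> measurable (lebesgue_on {0<..}) (borel :: real measure)"
    using borel_imp_lebesgue_on[of "\<lambda>x. x"] by auto
  have "(\<lambda>p. (fst p, snd p)) \<in> measurable (Msig k \<Otimes>\<^sub>M lebesgue_on {0<..}) (borel \<Otimes>\<^sub>M (borel :: real measure))"
    using measurable_compose[OF measurable_fst \<open>(\<lambda>x. x) \<in> measurable (Msig k) borel\<close>]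
      measurable_compose[OF measurable_snd \<open>(\<lambda>x. x) \<in> measurable (lebesgue_on {0<..}) borel\<close>]
    by (intro measurable_Pair) auto
  from measurable_compose[OF this measurable_F_minus[OF k j]] show ?thesis
    by (simp add: split_def)
qed

lemma measurable_F_minus_spectral:
  assumes k: "k \<in> {1..n}" and j: "j \<in> {1..n}"
  shows "(\<lambda>\<mu>. F_minus n c a k (of_real \<mu>) j x) \<in> borel_measurable borel"
  using measurable_compose[OF measurable_Pair2'[of x borel borel] measurable_F_minus[OF k j]] by simp

text \<open>On this subspace the integrals defining \<open>Z\<close> converge absolutely at every point of the network.\<close>
definition Z_core :: "tuple set" where
  "Z_core = {G \<in> L2 n Msig. \<forall>k\<in>{1..n}. integrable (Msig k) (G k)}"

lemma Z_core_L2: "G \<in> Z_core \<Longrightarrow> G \<in> L2 n Msig"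
  and Z_core_integrable: "G \<in> Z_core \<Longrightarrow> k \<in> {1..n} \<Longrightarrow> integrable (Msig k) (G k)"
  by (auto simp: Z_core_def)

lemma Z_core_lincomb:
  assumes F: "F \<in> Z_core" and G: "G \<in> Z_core"
  shows "lincomb \<alpha> F \<beta> G \<in> Z_core"
proof -
  have "integrable (Msig k) (lincomb \<alpha> F \<beta> G k)" if "k \<in> {1..n}" for k
    using Z_core_integrable[OF F that] Z_core_integrable[OF G that] unfolding lincomb_def by auto
  then show ?thesis
    using lincomb_L2[OF Z_core_L2[OF F] Z_core_L2[OF G]] by (simp add: Z_core_def)
qed

lemma space_Msig: "\<mu> \<in> space (Msig k) \<Longrightarrow> a k \<le> \<mu>" by simp

lemma Z_integrable:
  assumes G: "G \<in> Z_core" and k: "k \<in> {1..n}" and j: "j \<in> {1..n}" and x: "0 < x"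
  shows "integrable (Msig k) (\<lambda>\<mu>. G k \<mu> * F_minus n c a k (of_real \<mu>) j x)"
proof -
  obtain C where C: "0 \<le> C" "\<And>j \<mu> x. j \<in> {1..n} \<Longrightarrow> a k \<le> \<mu> \<Longrightarrow> 0 < x \<Longrightarrow>
      cmod (F_minus n c a k (of_real \<mu>) j x) \<le> C * (1 + x)"
    using F_minus_bound[OF k] by blast
  note Gi = Z_core_integrable[OF G k]
  have [measurable]: "(\<lambda>\<mu>. F_minus n c a k (of_real \<mu>) j x) \<in> borel_measurable (Msig k)"
    using borel_imp_lebesgue_on[OF measurable_F_minus_spectral[OF k j]] by simp
  have [measurable]: "G k \<in> borel_measurable (Msig k)" by (rule borel_measurable_integrable[OF Gi])
  show ?thesis
  proof (rule Bochner_Integration.integrable_bound[OF integrable_mult_right[OF integrable_norm[OF Gi], of "C * (1 + x)"]])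
    show "AE \<mu> in Msig k. norm (G k \<mu> * F_minus n c a k (of_real \<mu>) j x) \<le> norm (C * (1 + x) * norm (G k \<mu>))"
    proof (rule AE_I2)
      fix \<mu> assume "\<mu> \<in> space (Msig k)"
      from mult_right_mono[OF C(2)[OF j space_Msig[OF this] x], of "norm (G k \<mu>)"] C(1) x
      show "norm (G k \<mu> * F_minus n c a k (of_real \<mu>) j x) \<le> norm (C * (1 + x) * norm (G k \<mu>))"
        by (simp add: norm_mult mult.commute abs_mult)
    qed
  qed measurable
qed

lemma Z_eq:
  assumes G: "G \<in> Z_core" and j: "j \<in> {1..n}"
  shows "Z n c a G j x = (\<Sum>k=1..n. LINT \<mu>|Msig k. G k \<mu> * F_minus n c a k (of_real \<mu>) j x)"
  unfolding Z_def
proof (rule sum.cong[OF refl])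
  fix k assume k: "k \<in> {1..n}"
  let ?u = "\<lambda>\<mu>. of_real (sigma n c a k \<mu>) * G k \<mu> * F_minus n c a k (of_real \<mu>) j x"
  have m: "(\<lambda>\<mu>. G k \<mu> * F_minus n c a k (of_real \<mu>) j x) \<in> borel_measurable (lebesgue_on {a k..})"
    using borel_imp_lebesgue_on[OF measurable_F_minus_spectral[OF k j]] L2D(1)[OF Z_core_L2[OF G] k]
    by (intro borel_measurable_times) auto
  have "(LINT \<mu>|lebesgue_on {a k<..}. ?u \<mu>) = (LINT \<mu>|lebesgue. indicator {a k<..} \<mu> *\<^sub>R ?u \<mu>)"
    by (rule integral_restrict_space) simp
  \<comment> \<open>Open and closed half line give the same integral because \<open>sigma\<close>
    vanishes at a_k.\<close>
  also have "\<dots> = (LINT \<mu>|lebesgue. indicator {a k..} \<mu> *\<^sub>R ?u \<mu>)"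
    by (rule Bochner_Integration.integral_cong) (auto simp: indicator_def sigma_inactive[OF k])
  also have "\<dots> = (LINT \<mu>|lebesgue_on {a k..}. ?u \<mu>)"
    by (rule integral_restrict_space[symmetric]) simp
  also have "\<dots> = (LINT \<mu>|Msig k. G k \<mu> * F_minus n c a k (of_real \<mu>) j x)"
    unfolding integral_Msig[OF k m] by (simp add: scaleR_conv_of_real mult.assoc)
  finally show "(LINT \<mu>|lebesgue_on {a k<..}. ?u \<mu>) = (LINT \<mu>|Msig k. G k \<mu> * F_minus n c a k (of_real \<mu>) j x)" .
qed

lemma Z_lincomb:
  assumes F: "F \<in> Z_core" and G: "G \<in> Z_core" and j: "j \<in> {1..n}" and x: "0 < x"
  shows "Z n c a (lincomb \<alpha> F \<beta> G) j x = lincomb \<alpha> (Z n c a F) \<beta> (Z n c a G) j x"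
proof -
  have "(LINT \<mu>|Msig k. lincomb \<alpha> F \<beta> G k \<mu> * F_minus n c a k (of_real \<mu>) j x) =
     \<alpha> * (LINT \<mu>|Msig k. F k \<mu> * F_minus n c a k (of_real \<mu>) j x) +
     \<beta> * (LINT \<mu>|Msig k. G k \<mu> * F_minus n c a k (of_real \<mu>) j x)" if k: "k \<in> {1..n}" for k
    using Z_integrable[OF F k j x] Z_integrable[OF G k j x]
    by (simp add: lincomb_def distrib_right mult.assoc)
  then show ?thesis
    by (simp add: Z_eq[OF Z_core_lincomb[OF F G] j] lincomb_def[of \<alpha> "Z n c a F"] Z_eq[OF F j] Z_eq[OF G j]
        sum.distrib sum_distrib_left)
qed

lemma measurable_Z:
  assumes G: "G \<in> Z_core" and j: "j \<in> {1..n}"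
  shows "Z n c a G j \<in> borel_measurable (lebesgue_on {0<..})"
proof -
  have "(\<lambda>x. LINT \<mu>|Msig k. G k \<mu> * F_minus n c a k (of_real \<mu>) j x) \<in> borel_measurable (lebesgue_on {0<..})"
    if k: "k \<in> {1..n}" for k
  proof -
    interpret P: pair_sigma_finite "Msig k" "lebesgue_on {0<..} :: real measure" by (rule pair_sigma_finite_Msig[OF k])
    have [measurable]: "G k \<in> borel_measurable (Msig k)"
      by (rule borel_measurable_integrable[OF Z_core_integrable[OF G k]])
    note measurable_F_minus_pair[OF k j, measurable]
    have "(\<lambda>(\<mu>, x). G k \<mu> * F_minus n c a k (of_real \<mu>) j x) \<in> borel_measurable (Msig k \<Otimes>\<^sub>M lebesgue_on {0<..})"
      using measurable_F_minus_pair[OF k j] by (simp add: split_def)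
    from measurable_compose[OF measurable_pair_swap' this]
    have "(\<lambda>(x, \<mu>). G k \<mu> * F_minus n c a k (of_real \<mu>) j x) \<in> borel_measurable (lebesgue_on {0<..} \<Otimes>\<^sub>M Msig k)"
      by (simp add: split_def)
    then show ?thesis by (rule P.M1.borel_measurable_lebesgue_integral)
  qed
  then show ?thesis unfolding Z_eq[OF G j, abs_def] by (rule borel_measurable_sum)
qed

lemma Z_bound:
  assumes G: "G \<in> Z_core"
  obtains K where "0 \<le> K" "\<And>j x. j \<in> {1..n} \<Longrightarrow> 0 < x \<Longrightarrow> cmod (Z n c a G j x) \<le> K * (1 + x)"
proof -
  have "\<forall>k\<in>{1..n}. \<exists>C. 0 \<le> C \<and> (\<forall>j \<mu> x. j \<in> {1..n} \<longrightarrow> a k \<le> \<mu> \<longrightarrow> 0 < x \<longrightarrow>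
      cmod (F_minus n c a k (of_real \<mu>) j x) \<le> C * (1 + x))"
    using F_minus_bound by metis
  then obtain C where C: "\<And>k. k \<in> {1..n} \<Longrightarrow> 0 \<le> C k" "\<And>k j \<mu> x. k \<in> {1..n} \<Longrightarrow> j \<in> {1..n} \<Longrightarrow> a k \<le> \<mu> \<Longrightarrow>
      0 < x \<Longrightarrow> cmod (F_minus n c a k (of_real \<mu>) j x) \<le> C k * (1 + x)"
    by metis
  let ?K = "\<Sum>k=1..n. C k * (LINT \<mu>|Msig k. norm (G k \<mu>))"
  have "cmod (Z n c a G j x) \<le> ?K * (1 + x)" if j: "j \<in> {1..n}" and x: "0 < x" for j x
    unfolding Z_eq[OF G j] sum_distrib_right
  proof (rule sum_norm_le)
    fix k assume k: "k \<in> {1..n}"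
    have "cmod (LINT \<mu>|Msig k. G k \<mu> * F_minus n c a k (of_real \<mu>) j x)
        \<le> (LINT \<mu>|Msig k. norm (G k \<mu> * F_minus n c a k (of_real \<mu>) j x))"
      by (rule integral_norm_bound)
    also have "\<dots> \<le> (LINT \<mu>|Msig k. C k * (1 + x) * norm (G k \<mu>))"
    proof (rule integral_mono[OF integrable_norm[OF Z_integrable[OF G k j x]]
          integrable_mult_right[OF integrable_norm[OF Z_core_integrable[OF G k]]]])
      fix \<mu> assume "\<mu> \<in> space (Msig k)"
      from mult_right_mono[OF C(2)[OF k j space_Msig[OF this] x], of "norm (G k \<mu>)"]
      show "norm (G k \<mu> * F_minus n c a k (of_real \<mu>) j x) \<le> C k * (1 + x) * norm (G k \<mu>)"
        by (simp add: norm_mult mult.commute)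
    qed
    also have "\<dots> = C k * (LINT \<mu>|Msig k. norm (G k \<mu>)) * (1 + x)" by simp
    finally show "cmod (LINT \<mu>|Msig k. G k \<mu> * F_minus n c a k (of_real \<mu>) j x)
        \<le> C k * (LINT \<mu>|Msig k. norm (G k \<mu>)) * (1 + x)" .
  qed
  moreover have "0 \<le> ?K" using C by (intro sum_nonneg mult_nonneg_nonneg) auto
  ultimately show ?thesis using that by blast
qed

text \<open>Fubini's theorem applies with the majorant |G_k(\<mu>)| C (1 + x) |f_j(x)|: membership
  in \<open>Z_core\<close> integrates the first factor, and the compact support of f absorbs the
  linear growth in x.\<close>

lemma Z_pairing:
  assumes G: "G \<in> Z_core" and f: "f \<in> test_functions n"
  shows "L2_inner n half_line (Z n c a G) f = L2_inner n Msig G (V n c a f)"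
    and "j \<in> {1..n} \<Longrightarrow> integrable (lebesgue_on {0<..}) (\<lambda>x. Z n c a G j x * cnj (f j x))"
proof -
  let ?h = "\<lambda>k j \<mu> x. G k \<mu> * F_minus n c a k (of_real \<mu>) j x * cnj (f j x)"
  have fi: "integrable (Msig k \<Otimes>\<^sub>M lebesgue_on {0<..}) (case_prod (?h k j))"
    if k: "k \<in> {1..n}" and j: "j \<in> {1..n}" for k j
  proof -
    interpret P: pair_sigma_finite "Msig k" "lebesgue_on {0<..} :: real measure" by (rule pair_sigma_finite_Msig[OF k])
    obtain C where C: "0 \<le> C" "\<And>j \<mu> x. j \<in> {1..n} \<Longrightarrow> a k \<le> \<mu> \<Longrightarrow> 0 < x \<Longrightarrow>
        cmod (F_minus n c a k (of_real \<mu>) j x) \<le> C * (1 + x)"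
      using F_minus_bound[OF k] by blast
    let ?q = "\<lambda>x. norm (f j x * of_real (C * (1 + x)))"
    have q: "integrable (lebesgue_on {0<..}) ?q"
      by (intro integrable_norm half_line_integral(1)[OF f j] continuous_intros)
    have [measurable]: "G k \<in> borel_measurable (Msig k)"
      by (rule borel_measurable_integrable[OF Z_core_integrable[OF G k]])
    have [measurable]: "(\<lambda>x. cnj (f j x)) \<in> borel_measurable (lebesgue_on {0<..})"
      by (rule measurable_cnj[OF L2D(1)[OF test_functions_H(1)[OF f] j]])
    note measurable_F_minus_pair[OF k j, unfolded split_def, measurable]
    show ?thesis
    proof (rule P.integrable_dominated_product[OF _ integrable_norm[OF Z_core_integrable[OF G k]] q])
      show "case_prod (?h k j) \<in> borel_measurable (Msig k \<Otimes>\<^sub>M lebesgue_on {0<..})"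
        unfolding split_def by measurable
      fix \<mu> x assume s: "\<mu> \<in> space (Msig k)" "x \<in> space (lebesgue_on {0<..} :: real measure)"
      then have x: "0 < x" by simp
      have "cmod (F_minus n c a k (of_real \<mu>) j x) * (norm (G k \<mu>) * norm (f j x))
          \<le> C * (1 + x) * (norm (G k \<mu>) * norm (f j x))"
        by (intro mult_right_mono C(2)[OF j space_Msig[OF s(1)] x]) simp
      moreover have "?q x = norm (f j x) * (C * (1 + x))"
        unfolding norm_mult norm_of_real using C(1) x by simp
      ultimately show "norm (?h k j \<mu> x) \<le> norm (G k \<mu>) * ?q x"
        by (simp only: norm_mult complex_mod_cnj mult_ac)
    qed
  qed
  have Zs: "Z n c a G j x * cnj (f j x) = (\<Sum>k=1..n. LINT \<mu>|Msig k. ?h k j \<mu> x)"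
    if j: "j \<in> {1..n}" for j x
    unfolding Z_eq[OF G j] sum_distrib_right by simp
  have i1: "integrable (lebesgue_on {0<..}) (\<lambda>x. LINT \<mu>|Msig k. ?h k j \<mu> x)"
    if k: "k \<in> {1..n}" and j: "j \<in> {1..n}" for k j
  proof -
    interpret P: pair_sigma_finite "Msig k" "lebesgue_on {0<..} :: real measure" by (rule pair_sigma_finite_Msig[OF k])
    show ?thesis by (rule P.integrable_snd[OF fi[OF k j]])
  qed
  have i2: "integrable (Msig k) (\<lambda>\<mu>. LINT x|lebesgue_on {0<..}. ?h k j \<mu> x)"
    if k: "k \<in> {1..n}" and j: "j \<in> {1..n}" for k j
  proof -
    interpret P: pair_sigma_finite "Msig k" "lebesgue_on {0<..} :: real measure" by (rule pair_sigma_finite_Msig[OF k])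
    show ?thesis by (rule P.integrable_fst[OF fi[OF k j]])
  qed
  show "integrable (lebesgue_on {0<..}) (\<lambda>x. Z n c a G j x * cnj (f j x))" if j: "j \<in> {1..n}"
    unfolding Zs[OF j] by (intro Bochner_Integration.integrable_sum i1 j)
  have "L2_inner n half_line (Z n c a G) f =
      (\<Sum>j=1..n. LINT x|lebesgue_on {0<..}. (\<Sum>k=1..n. LINT \<mu>|Msig k. ?h k j \<mu> x))"
    unfolding L2_inner_def by (rule sum.cong[OF refl]) (simp only: Zs)
  also have "\<dots> = (\<Sum>j=1..n. \<Sum>k=1..n. LINT x|lebesgue_on {0<..}. LINT \<mu>|Msig k. ?h k j \<mu> x)"
    by (rule sum.cong[OF refl], rule Bochner_Integration.integral_sum) (rule i1)
  also have "\<dots> = (\<Sum>j=1..n. \<Sum>k=1..n. LINT \<mu>|Msig k. LINT x|lebesgue_on {0<..}. ?h k j \<mu> x)"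
  proof (intro sum.cong refl)
    fix j k assume j: "j \<in> {1..n}" and k: "k \<in> {1..n}"
    interpret P: pair_sigma_finite "Msig k" "lebesgue_on {0<..} :: real measure" by (rule pair_sigma_finite_Msig[OF k])
    show "(LINT x|lebesgue_on {0<..}. LINT \<mu>|Msig k. ?h k j \<mu> x) = (LINT \<mu>|Msig k. LINT x|lebesgue_on {0<..}. ?h k j \<mu> x)"
      by (rule P.Fubini_integral[OF fi[OF k j]])
  qed
  also have "\<dots> = (\<Sum>k=1..n. \<Sum>j=1..n. LINT \<mu>|Msig k. LINT x|lebesgue_on {0<..}. ?h k j \<mu> x)"
    by (rule sum.swap)
  also have "\<dots> = (\<Sum>k=1..n. LINT \<mu>|Msig k. (\<Sum>j=1..n. LINT x|lebesgue_on {0<..}. ?h k j \<mu> x))"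
    by (rule sum.cong[OF refl], rule Bochner_Integration.integral_sum[symmetric]) (rule i2)
  also have "\<dots> = L2_inner n Msig G (V n c a f)"
    unfolding L2_inner_def
  proof (intro sum.cong refl Bochner_Integration.integral_cong)
    fix k \<mu>
    have "cnj (V n c a f k \<mu>) = (\<Sum>j=1..n. LINT x|lebesgue_on {0<..}. cnj (f j x) * F_minus n c a k (of_real \<mu>) j x)"
      unfolding V_def cnj_sum Bochner_Integration.integral_cnj[symmetric] by simp
    then show "(\<Sum>j=1..n. LINT x|lebesgue_on {0<..}. ?h k j \<mu> x) = G k \<mu> * cnj (V n c a f k \<mu>)"
      by (simp only: sum_distrib_left integral_mult_right_zero[symmetric] mult_ac)
  qed
  finally show "L2_inner n half_line (Z n c a G) f = L2_inner n Msig G (V n c a f)" .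
qed

text \<open>Where |G| \<ge> 1 / (m + 1) one has |G| \<le> (m + 1) |G|^2, so removing the small
  values turns square integrability into integrability even on a space of infinite measure.\<close>

lemma Z_core_dense:
  assumes G: "G \<in> L2 n Msig" and e: "0 < e"
  shows "\<exists>F\<in>Z_core. L2_norm n Msig (G \<ominus> F) < e"
proof -
  let ?P = "\<lambda>m k \<mu>. 1 / real (Suc m) \<le> cmod (G k \<mu>)"
  define t where "t m k \<mu> = (if ?P m k \<mu> then G k \<mu> else 0)" for m k \<mu>
  have P: "Measurable.pred (Msig k) (?P m k)" if k: "k \<in> {1..n}" for m k
  proof -
    note [measurable] = L2D(1)[OF G k]
    show ?thesis by measurable
  qed
  have ev: "\<forall>\<^sub>F m in sequentially. ?P m k \<mu> \<or> G k \<mu> = 0" for k \<mu>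
  proof (cases "G k \<mu> = 0")
    case False
    then have "0 < cmod (G k \<mu>)" by simp
    from order_tendstoD(2)[OF LIMSEQ_inverse_real_of_nat this]
    show ?thesis by eventually_elim (simp add: inverse_eq_divide)
  qed simp
  note trunc = L2_truncation[where P="?P", OF G e P ev]
  have tL: "t m \<in> L2 n Msig" for m using trunc(1) unfolding t_def[abs_def] .
  obtain m where m: "L2_norm n Msig (G \<ominus> t m) < e"
    using trunc(2) unfolding t_def[abs_def] by blast
  have "t m \<in> Z_core"
    unfolding Z_core_def
  proof (intro CollectI conjI ballI tL)
    fix k assume k: "k \<in> {1..n}"
    show "integrable (Msig k) (t m k)"
    proof (rule Bochner_Integration.integrable_bound[OF integrable_mult_right[OF L2D(2)[OF G k], of "real (Suc m)"] L2D(1)[OF tL k]])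
      show "AE \<mu> in Msig k. norm (t m k \<mu>) \<le> norm (real (Suc m) * (cmod (G k \<mu>))\<^sup>2)"
      proof (rule AE_I2)
        fix \<mu>
        show "norm (t m k \<mu>) \<le> norm (real (Suc m) * (cmod (G k \<mu>))\<^sup>2)"
        proof (cases "?P m k \<mu>")
          case True
          then have "1 \<le> real (Suc m) * cmod (G k \<mu>)" by (simp add: divide_le_eq mult.commute)
          from mult_right_mono[OF this, of "cmod (G k \<mu>)"] show ?thesis
            using True by (simp add: t_def power2_eq_square mult.assoc)
        qed (simp add: t_def)
      qed
    qed
  qed
  then show ?thesis using m by blast
qed

text \<open>
  Only the pairing of \<open>Z G\<close> with test functions is under control, so the bound is proved by
  duality for the restriction of \<open>Z G\<close> to a compact interval, which test functions supported in
  that interval approximate.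
\<close>
lemma Z_truncated_norm:
  assumes step: "smooth_step \<theta>" and G: "G \<in> Z_core" and pq: "0 < p" "p < q"
  defines "t \<equiv> \<lambda>j x. if x \<in> {p..q} then Z n c a G j x else 0"
  shows "t \<in> L2 n half_line" and "L2_norm n half_line t \<le> L2_norm n Msig G"
proof -
  interpret smooth_step \<theta> by (rule step)
  obtain K where K: "0 \<le> K" "\<And>j x. j \<in> {1..n} \<Longrightarrow> 0 < x \<Longrightarrow> cmod (Z n c a G j x) \<le> K * (1 + x)"
    using Z_bound[OF G] by blast
  let ?B = "K * (1 + q)"
  have tm: "t j \<in> borel_measurable (lebesgue_on {0<..})" if j: "j \<in> {1..n}" for j
  proof -
    note [measurable] = measurable_Z[OF G j]
    have [measurable]: "(\<lambda>x. x) \<in> borel_measurable (lebesgue_on {0<..} :: real measure)"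
      by (rule borel_imp_lebesgue_on) simp
    show ?thesis unfolding t_def by measurable
  qed
  have tb: "cmod (t j x) \<le> ?B * indicator {p..q} x" if j: "j \<in> {1..n}" and x: "0 < x" for j x
  proof (cases "x \<in> {p..q}")
    case True
    have "cmod (t j x) \<le> K * (1 + x)" using True K(2)[OF j x] by (simp add: t_def)
    also have "\<dots> \<le> ?B" using True K(1) by (intro mult_left_mono) auto
    finally show ?thesis using True by simp
  next
    case False
    then show ?thesis unfolding t_def by (simp only: if_False) simp
  qed
  show tL: "t \<in> L2 n half_line"
    unfolding L2_def
  proof (intro CollectI ballI conjI tm)
    fix j assume j: "j \<in> {1..n}"
    have "integrable (lebesgue_on {0<..}) (\<lambda>x. ?B\<^sup>2 * indicator {p..q} x :: real)"
      by (intro integrable_mult_right integrable_lborel_imp_lebesgue_on)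
         (auto intro!: integrable_real_indicator simp: emeasure_lborel_Icc_eq)
    then show "integrable (lebesgue_on {0<..}) (\<lambda>x. (cmod (t j x))\<^sup>2)"
    proof (rule Bochner_Integration.integrable_bound)
      note [measurable] = tm[OF j]
      show "(\<lambda>x. (cmod (t j x))\<^sup>2) \<in> borel_measurable (lebesgue_on {0<..})" by measurable
      show "AE x in lebesgue_on {0<..}. norm ((cmod (t j x))\<^sup>2) \<le> norm (?B\<^sup>2 * indicator {p..q} x :: real)"
      proof (rule AE_I2)
        fix x assume "x \<in> space (lebesgue_on {0<..} :: real measure)"
        then have "cmod (t j x) \<le> ?B * indicator {p..q} x" by (intro tb[OF j]) simp
        then have "(cmod (t j x))\<^sup>2 \<le> (?B * indicator {p..q} x)\<^sup>2" by (intro power_mono) auto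
        then show "norm ((cmod (t j x))\<^sup>2) \<le> norm (?B\<^sup>2 * indicator {p..q} x :: real)"
          by (cases "x \<in> {p..q}") auto
      qed
    qed
  qed
  let ?t = "L2_norm n half_line t" and ?g = "L2_norm n Msig G"
  \<comment> \<open>Split (t, t) = (t, \<phi>) + (t, t - \<phi>). As \<phi> is supported in [p, q],
    (t, \<phi>) equals (Z G, \<phi>) = (G, V \<phi>), and the isometry of V bounds it by the norms
    of G and \<phi>.\<close>
  have "?t\<^sup>2 \<le> ?g * ?t + e * (?g + ?t)" if e: "0 < e" for e
  proof -
    obtain \<phi> where ph: "\<And>k. k \<in> {1..n} \<Longrightarrow> \<phi> k \<in> bumps p q" "L2_norm n half_line (t \<ominus> \<phi>) < e"
      using bumps_dense_bounded[where h=t and n=n, OF tm tb pq e] by blast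
    have pt: "\<phi> \<in> test_functions n" by (rule bumps_test_functions[OF ph(1) pq(1)])
    have pL: "\<phi> \<in> L2 n half_line" by (rule test_functions_H(1)[OF pt])
    have "L2_inner n half_line t \<phi> = L2_inner n half_line (Z n c a G) \<phi>"
      unfolding L2_inner_def
    proof (intro sum.cong refl Bochner_Integration.integral_cong)
      fix j x assume "j \<in> {1..n}"
      then have "x \<notin> {p..q} \<Longrightarrow> \<phi> j x = 0" using ph(1) by (simp add: bumps_def)
      then show "t j x * cnj (\<phi> j x) = Z n c a G j x * cnj (\<phi> j x)" by (auto simp: t_def)
    qed
    also have "\<dots> = L2_inner n Msig G (V n c a \<phi>)" by (rule Z_pairing(1)[OF G pt])
    finally have "cmod (L2_inner n half_line t \<phi>) \<le> ?g * L2_norm n half_line \<phi>"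
      using L2_Cauchy_Schwarz[OF Z_core_L2[OF G] V_isometry(1)[OF pt]] V_isometry(2)[OF pt] by simp
    moreover have "L2_norm n half_line \<phi> \<le> e + ?t"
      using L2_norm_triangle'[OF pL tL] ph(2) L2_norm_diff_commute[of n half_line \<phi> t] by linarith
    then have "?g * L2_norm n half_line \<phi> \<le> ?g * (e + ?t)" by (intro mult_left_mono) auto
    moreover have "cmod (L2_inner n half_line t (t \<ominus> \<phi>)) \<le> ?t * e"
      using L2_Cauchy_Schwarz[OF tL lincomb_L2[OF tL pL, of 1 "-1"]] ph(2)
        mult_left_mono[of "L2_norm n half_line (t \<ominus> \<phi>)" e ?t] by simp
    moreover have "L2_inner n half_line t t = L2_inner n half_line t \<phi> + L2_inner n half_line t (t \<ominus> \<phi>)"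
      using arg_cong[OF L2_inner_lincomb[OF tL pL tL, of 1 "-1"], of cnj] by (simp add: L2_inner_cnj)
    then have "complex_of_real (?t\<^sup>2) = L2_inner n half_line t \<phi> + L2_inner n half_line t (t \<ominus> \<phi>)"
      by (simp only: L2_inner_self_norm)
    then have "?t\<^sup>2 \<le> cmod (L2_inner n half_line t \<phi>) + cmod (L2_inner n half_line t (t \<ominus> \<phi>))"
      by (metis norm_of_real abs_of_nonneg zero_le_power2 norm_triangle_ineq)
    moreover have "?g * (e + ?t) + ?t * e = ?g * ?t + e * (?g + ?t)" by (simp add: algebra_simps)
    ultimately show ?thesis by linarith
  qed
  note key = this
  have "?t\<^sup>2 \<le> ?g * ?t"
  proof (rule field_le_epsilon)
    fix e :: real assume e: "0 < e"
    have pos: "0 < ?g + ?t + 1" by (intro add_nonneg_pos add_nonneg_nonneg) auto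
    have "?t\<^sup>2 \<le> ?g * ?t + e / (?g + ?t + 1) * (?g + ?t)" using e pos by (intro key) simp
    also have "e / (?g + ?t + 1) * (?g + ?t) = e * ((?g + ?t) / (?g + ?t + 1))" by simp
    also have "\<dots> \<le> e * 1" using e pos by (intro mult_left_mono) (auto simp: divide_le_eq)
    finally show "?t\<^sup>2 \<le> ?g * ?t + e" by simp
  qed
  then show "?t \<le> ?g"
  proof (cases "?t = 0")
    case False
    then have "0 < ?t" using L2_norm_nonneg[of n half_line t] by linarith
    then show ?thesis using \<open>?t\<^sup>2 \<le> ?g * ?t\<close> by (simp add: power2_eq_square)
  qed simp
qed

text \<open>The bound is uniform over the truncations to growing intervals, so monotone convergence
  supplies the square integrability of Z G together with its norm bound.\<close>

lemma Z_contraction: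
  assumes step: "smooth_step \<theta>" and G: "G \<in> Z_core"
  shows "Z n c a G \<in> L2 n half_line" and "L2_norm n half_line (Z n c a G) \<le> L2_norm n Msig G"
proof -
  define t where "t m j x = (if x \<in> {1 / real (m + 2)..real (m + 2)} then Z n c a G j x else 0)" for m j x
  have pq: "0 < 1 / real (m + 2)" "1 / real (m + 2) < real (m + 2)" for m
  proof -
    have "1 / real (m + 2) < 1" by simp
    also have "1 < real (m + 2)" by simp
    finally show "1 / real (m + 2) < real (m + 2)" .
  qed simp
  have t: "t m \<in> L2 n half_line" "L2_norm n half_line (t m) \<le> L2_norm n Msig G" for m
    using Z_truncated_norm[OF step G pq[of m]] unfolding t_def by blast+
  let ?I = "\<lambda>m j. LINT x|lebesgue_on {0<..}. (cmod (t m j x))\<^sup>2"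
  have mono: "(cmod (t m j x))\<^sup>2 \<le> (cmod (t m' j x))\<^sup>2" if "m \<le> m'" for m m' j x
  proof -
    have "1 / real (m' + 2) \<le> 1 / real (m + 2)" using that by (intro divide_left_mono) auto
    moreover have "real (m + 2) \<le> real (m' + 2)" using that by simp
    ultimately have "x \<in> {1 / real (m + 2)..real (m + 2)} \<Longrightarrow> x \<in> {1 / real (m' + 2)..real (m' + 2)}"
      by (auto simp del: of_nat_add)
    then show ?thesis by (auto simp: t_def simp del: of_nat_add)
  qed
  have lim: "AE x in lebesgue_on {0<..}. (\<lambda>m. (cmod (t m j x))\<^sup>2) \<longlonglongrightarrow> (cmod (Z n c a G j x))\<^sup>2" for j
  proof (rule AE_I2)
    fix x :: real assume "x \<in> space (lebesgue_on {0<..})"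
    then have x: "0 < x" by simp
    have "\<forall>\<^sub>F m in sequentially. (cmod (t m j x))\<^sup>2 = (cmod (Z n c a G j x))\<^sup>2"
      using eventually_ge_at_top[of "nat \<lceil>max x (1 / x)\<rceil>"]
    proof eventually_elim
      case (elim m)
      then have "max x (1 / x) \<le> real m" by linarith
      then have m: "x \<le> real m" "1 / x \<le> real m" by auto
      have "1 / real (m + 2) \<le> x"
      proof -
        have "1 / x \<le> real (m + 2)" using m(2) by simp
        then show ?thesis using x by (simp add: field_simps)
      qed
      then show ?case using m by (simp add: t_def)
    qed
    then show "(\<lambda>m. (cmod (t m j x))\<^sup>2) \<longlonglongrightarrow> (cmod (Z n c a G j x))\<^sup>2" by (rule tendsto_eventually)
  qed
  have "\<exists>l. (\<lambda>m. ?I m j) \<longlonglongrightarrow> l" if j: "j \<in> {1..n}" for j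
  proof -
    have inc: "incseq (\<lambda>m. ?I m j)"
      by (rule incseq_SucI, rule integral_mono[OF L2D(2)[OF t(1) j] L2D(2)[OF t(1) j]], rule mono) simp
    have "?I m j \<le> (L2_norm n Msig G)\<^sup>2" for m
    proof -
      have "?I m j \<le> (L2_norm n half_line (t m))\<^sup>2"
        unfolding L2_norm_square using j by (intro member_le_sum) auto
      also have "\<dots> \<le> (L2_norm n Msig G)\<^sup>2" by (intro power_mono t) simp
      finally show ?thesis .
    qed
    then obtain l where "(\<lambda>m. ?I m j) \<longlonglongrightarrow> l" using incseq_convergent[OF inc] by blast
    then show ?thesis by blast
  qed
  then obtain l where l: "\<And>j. j \<in> {1..n} \<Longrightarrow> (\<lambda>m. ?I m j) \<longlonglongrightarrow> l j" by metis
  have Zi: "integrable (lebesgue_on {0<..}) (\<lambda>x. (cmod (Z n c a G j x))\<^sup>2)"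
    "(LINT x|lebesgue_on {0<..}. (cmod (Z n c a G j x))\<^sup>2) = l j" if j: "j \<in> {1..n}" for j
  proof -
    have m: "(\<lambda>x. (cmod (Z n c a G j x))\<^sup>2) \<in> borel_measurable (lebesgue_on {0<..})"
      using measurable_Z[OF G j] by measurable
    note * = integral_monotone_convergence_nonneg[OF L2D(2)[OF t(1) j] _ _ lim l[OF j] m]
    show "integrable (lebesgue_on {0<..}) (\<lambda>x. (cmod (Z n c a G j x))\<^sup>2)"
      by (rule *(1)) (auto intro!: AE_I2 monoI mono)
    show "(LINT x|lebesgue_on {0<..}. (cmod (Z n c a G j x))\<^sup>2) = l j"
      by (rule *(2)) (auto intro!: AE_I2 monoI mono)
  qed
  show "Z n c a G \<in> L2 n half_line"
    unfolding L2_def using measurable_Z[OF G] Zi(1) by blast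
  have "(\<lambda>m. (L2_norm n half_line (t m))\<^sup>2) \<longlonglongrightarrow> (L2_norm n half_line (Z n c a G))\<^sup>2"
    unfolding L2_norm_square by (intro tendsto_sum) (simp only: Zi(2) l)
  then have "(L2_norm n half_line (Z n c a G))\<^sup>2 \<le> (L2_norm n Msig G)\<^sup>2"
    by (rule LIMSEQ_le_const2) (intro exI allI impI power_mono t L2_norm_nonneg)
  then show "L2_norm n half_line (Z n c a G) \<le> L2_norm n Msig G"
    by (rule power2_le_imp_le) simp
qed

text \<open>Beyond b the function G coincides with a Schwartz function, and below b it is continuous
  on a compact interval; hence (1 + |\<mu> - a_1|) |G| is bounded. With \<open>sigma_bound\<close>
  this gives the majorant 1 / (sqrt |r| (1 + |r|)), r = \<mu> - a_1, up to a constant.\<close>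

lemma Z_domain_core:
  assumes chi: "\<forall>\<mu>>b. chi \<mu> = 1" and ab: "\<And>k. k \<in> {1..n} \<Longrightarrow> a k \<le> b"
  shows "Z_domain n a chi \<subseteq> Z_core"
proof
  fix G assume GZ: "G \<in> Z_domain n a chi"
  have *: "integrable (Msig k) (G k) \<and> G k \<in> borel_measurable (Msig k) \<and> integrable (Msig k) (\<lambda>\<mu>. (cmod (G k \<mu>))\<^sup>2)"
    if k: "k \<in> {1..n}" for k
  proof -
    have "C_inf_on {a k..} (G k)" using GZ k by (auto simp: Z_domain_def)
    then have cG: "continuous_on {a k..} (G k)" by (rule C_inf_on_continuous)
    then have Gm: "G k \<in> borel_measurable (lebesgue_on {a k..})"
      by (intro continuous_imp_measurable_on_sets_lebesgue) auto
    obtain D where D: "derivs_on UNIV (\<lambda>\<mu>. if a k \<le> \<mu> then of_real (chi \<mu>) * G k \<mu> else 0) D"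
      "\<And>m j. bounded (range (\<lambda>x. \<bar>x\<bar> ^ m * norm (D j x)))"
      using GZ k unfolding Z_domain_def schwartz_def by blast
    have DG: "D 0 \<mu> = G k \<mu>" if "b < \<mu>" for \<mu>
      using D(1) chi that ab[OF k] unfolding derivs_on_def by auto
    obtain B0 where B0: "\<And>x. cmod (D 0 x) \<le> B0"
      using D(2)[of 0 0] by (auto simp: bounded_iff)
    obtain B1 where B1: "\<And>x. \<bar>x\<bar> * cmod (D 0 x) \<le> B1"
      using D(2)[of 1 0] by (auto simp: bounded_iff abs_mult)
    have "compact ((\<lambda>\<mu>. (1 + \<bar>\<mu> - a 1\<bar>) * cmod (G k \<mu>)) ` {a k..b})"
      by (intro compact_continuous_image continuous_intros continuous_on_subset[OF cG]) auto
    then obtain B2 where B2: "\<And>\<mu>. \<mu> \<in> {a k..b} \<Longrightarrow> norm ((1 + \<bar>\<mu> - a 1\<bar>) * cmod (G k \<mu>)) \<le> B2"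
      using compact_imp_bounded bounded_iff by (metis (no_types, lifting) imageI)
    define K where "K = max B2 ((1 + \<bar>a 1\<bar>) * B0 + B1)"
    have GK: "(1 + \<bar>\<mu> - a 1\<bar>) * cmod (G k \<mu>) \<le> K" if \<mu>: "a k \<le> \<mu>" for \<mu>
    proof (cases "\<mu> \<le> b")
      case True
      then show ?thesis using B2[of \<mu>] \<mu> by (simp add: K_def abs_mult)
    next
      case False
      have "(1 + \<bar>\<mu> - a 1\<bar>) * cmod (G k \<mu>) \<le> (1 + \<bar>a 1\<bar> + \<bar>\<mu>\<bar>) * cmod (G k \<mu>)"
        by (intro mult_right_mono) auto
      also have "\<dots> = (1 + \<bar>a 1\<bar>) * cmod (D 0 \<mu>) + \<bar>\<mu>\<bar> * cmod (D 0 \<mu>)"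
        using DG[of \<mu>] False by (simp add: distrib_right)
      also have "\<dots> \<le> (1 + \<bar>a 1\<bar>) * B0 + B1"
        by (intro add_mono mult_left_mono B0 B1) auto
      finally show ?thesis by (simp add: K_def)
    qed
    have K0: "0 \<le> K" using GK[of "a k"] by (rule order_trans[rotated]) auto
    have G1: "cmod (G k \<mu>) \<le> K / (1 + \<bar>\<mu> - a 1\<bar>)" if "a k \<le> \<mu>" for \<mu>
    proof -
      have "0 < 1 + \<bar>\<mu> - a 1\<bar>" by (simp add: add_pos_nonneg)
      then show ?thesis using GK[OF that] by (simp add: pos_le_divide_eq mult.commute)
    qed
    have G2: "cmod (G k \<mu>) \<le> K" if "a k \<le> \<mu>" for \<mu>
    proof -
      have "1 * cmod (G k \<mu>) \<le> (1 + \<bar>\<mu> - a 1\<bar>) * cmod (G k \<mu>)" by (intro mult_right_mono) auto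
      then show ?thesis using GK[OF that] by simp
    qed
    let ?C = "1 / (sqrt (c 1) * pi)"
    have w: "integrable (lebesgue_on {a k..}) (\<lambda>\<mu>. ?C * K * (1 / (sqrt \<bar>\<mu> - a 1\<bar> * (1 + \<bar>\<mu> - a 1\<bar>))))"
      by (intro integrable_mult_right integrable_lborel_imp_lebesgue_on integrable_inverse_sqrt_kernel) auto
    have "integrable (lebesgue_on {a k..}) (\<lambda>\<mu>. sigma n c a k \<mu> *\<^sub>R G k \<mu>)"
    proof (rule Bochner_Integration.integrable_bound[OF w])
      show "(\<lambda>\<mu>. sigma n c a k \<mu> *\<^sub>R G k \<mu>) \<in> borel_measurable (lebesgue_on {a k..})"
        by (intro borel_measurable_scaleR measurable_sigma_on k Gm)
      show "AE \<mu> in lebesgue_on {a k..}. norm (sigma n c a k \<mu> *\<^sub>R G k \<mu>)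
          \<le> norm (?C * K * (1 / (sqrt \<bar>\<mu> - a 1\<bar> * (1 + \<bar>\<mu> - a 1\<bar>))))"
      proof (rule AE_I2)
        fix \<mu> assume "\<mu> \<in> space (lebesgue_on {a k..})"
        then have \<mu>: "a k \<le> \<mu>" by simp
        have "norm (sigma n c a k \<mu> *\<^sub>R G k \<mu>) = sigma n c a k \<mu> * cmod (G k \<mu>)"
          using sigma_nonneg[OF k] by simp
        also have "\<dots> \<le> (?C / sqrt \<bar>\<mu> - a 1\<bar>) * (K / (1 + \<bar>\<mu> - a 1\<bar>))"
          using c[OF one] by (intro mult_mono sigma_bound[OF k] G1[OF \<mu>]) auto
        also have "\<dots> = ?C * K * (1 / (sqrt \<bar>\<mu> - a 1\<bar> * (1 + \<bar>\<mu> - a 1\<bar>)))" by simp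
        also have "\<dots> \<le> norm (?C * K * (1 / (sqrt \<bar>\<mu> - a 1\<bar> * (1 + \<bar>\<mu> - a 1\<bar>))))"
          unfolding real_norm_def by (rule abs_ge_self)
        finally show "norm (sigma n c a k \<mu> *\<^sub>R G k \<mu>)
          \<le> norm (?C * K * (1 / (sqrt \<bar>\<mu> - a 1\<bar> * (1 + \<bar>\<mu> - a 1\<bar>))))" .
      qed
    qed
    then have i: "integrable (Msig k) (G k)" by (simp add: integrable_Msig[OF k Gm])
    have Gm': "G k \<in> borel_measurable (Msig k)" using Gm by simp
    \<comment> \<open>Boundedness of G reduces this to integrability: |G|^2 \<le> K |G|.\<close>
    have "integrable (Msig k) (\<lambda>\<mu>. (cmod (G k \<mu>))\<^sup>2)"
    proof (rule Bochner_Integration.integrable_bound[OF integrable_mult_right[OF integrable_norm[OF i], of K]])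
      show "(\<lambda>\<mu>. (cmod (G k \<mu>))\<^sup>2) \<in> borel_measurable (Msig k)" using Gm' by measurable
      show "AE \<mu> in Msig k. norm ((cmod (G k \<mu>))\<^sup>2) \<le> norm (K * norm (G k \<mu>))"
      proof (rule AE_I2)
        fix \<mu> assume "\<mu> \<in> space (Msig k)"
        from mult_right_mono[OF G2[OF space_Msig[OF this]], of "cmod (G k \<mu>)"] K0
        show "norm ((cmod (G k \<mu>))\<^sup>2) \<le> norm (K * norm (G k \<mu>))"
          by (simp add: power2_eq_square abs_mult)
      qed
    qed
    then show ?thesis using i Gm' by blast
  qed
  show "G \<in> Z_core" unfolding Z_core_def L2_def using * by blast
qed

lemma V_extension:
  assumes "smooth_step \<theta>"
  shows "L2_extension n half_line Msig (test_functions n) (V n c a)"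
proof
  interpret smooth_step \<theta> by fact
  show "test_functions n \<subseteq> L2 n half_line" using test_functions_H(1) by blast
  show "\<exists>f\<in>test_functions n. L2_norm n half_line (h \<ominus> f) < e" if "h \<in> L2 n half_line" "0 < e" for h e
    by (rule test_functions_dense[OF that])
  show "L2_eq n Msig (V n c a (lincomb \<alpha> f \<beta> g)) (lincomb \<alpha> (V n c a f) \<beta> (V n c a g))"
    if "f \<in> test_functions n" "g \<in> test_functions n" for f g \<alpha> \<beta>
    by (simp add: V_lincomb[OF that] L2_eq_def)
qed (simp_all add: test_functions_lincomb V_isometry)

lemma Z_extension:
  assumes "smooth_step \<theta>"
  shows "L2_extension n Msig half_line Z_core (Z n c a)"
proof
  show "Z_core \<subseteq> L2 n Msig" using Z_core_L2 by blast
  show "L2_eq n half_line (Z n c a (lincomb \<alpha> F \<beta> G)) (lincomb \<alpha> (Z n c a F) \<beta> (Z n c a G))"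
    if "F \<in> Z_core" "G \<in> Z_core" for F G \<alpha> \<beta>
    unfolding L2_eq_def using Z_lincomb[OF that] by (intro ballI AE_I2) simp
qed (simp_all add: Z_core_lincomb Z_core_dense Z_contraction[OF assms])

end

section \<open>The isometric extension of V and its left inverse\<close>

text \<open>The operators act on representatives, so the inversion is required for every
  \<open>F\<close> that agrees with \<open>V' f\<close> almost everywhere; \<open>Z'\<close> is tied
  to the integral formula by agreement on \<open>Z_domain\<close>.\<close>

theorem theorem7p5:
  fixes n :: nat and c a :: "nat \<Rightarrow> real" and chi :: "real \<Rightarrow> real"
  assumes "2 \<le> n"
    and "\<forall>k\<in>{1..n}. 0 < c k"
    and "0 \<le> a 1" and "\<forall>k\<in>{1..<n}. a k \<le> a (Suc k)"
    and "C_inf_on UNIV chi"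
    and "\<forall>\<mu><a n + 1. chi \<mu> = 0" and "\<forall>\<mu>>a n + 2. chi \<mu> = 1"
  shows "linear_isometry (test_functions n) (H_norm n) (L2_sigma n c a) (sigma_norm n c a)
           (sigma_eq n a) (V n c a)
    \<and> (\<exists>V'. linear_isometry (H_space n) (H_norm n) (L2_sigma n c a) (sigma_norm n c a)
              (sigma_eq n a) V'
          \<and> (\<forall>f\<in>test_functions n. sigma_eq n a (V' f) (V n c a f))
          \<and> (\<forall>f\<in>H_space n. of_real ((sigma_norm n c a (V' f))\<^sup>2) = H_inner n f f)
          \<and> (\<exists>Z'. Z_domain n a chi \<subseteq> L2_sigma n c a
                \<and> bounded_op (L2_sigma n c a) (sigma_norm n c a) (H_space n) (H_norm n)
                    (H_eq n) Z'
                \<and> (\<forall>G\<in>Z_domain n a chi. H_eq n (Z' G) (Z n c a G))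
                \<and> (\<forall>f\<in>H_space n. \<forall>F\<in>L2_sigma n c a.
                      sigma_eq n a F (V' f) \<longrightarrow> H_eq n (Z' F) f)))"
proof -
  have mono: "a j \<le> a k" if "1 \<le> j" "j \<le> k" "k \<le> n" for j k
    using that(2,1,3)
  proof (induction k rule: dec_induct)
    case (step k)
    then show ?case using assms(4) by (force intro: order_trans)
  qed simp
  interpret network n c a
    by unfold_locales (use assms(1,2) mono in auto)
  \<comment> \<open>The shift moves the transition zone [a_n + 1, a_n + 2] of \<open>chi\<close> to
    [0, 1].\<close>
  define \<theta> where "\<theta> x = chi (1 * x + (a n + 1))" for x
  have step: "smooth_step \<theta>"
    by unfold_locales (use C_inf_on_affine[OF assms(5), of 1 "a n + 1"] assms(6,7) in \<open>auto simp: \<theta>_def[abs_def]\<close>)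
  interpret VE: L2_extension n half_line Msig "test_functions n" "V n c a" by (rule V_extension[OF step])
  interpret ZE: L2_extension n Msig half_line Z_core "Z n c a" by (rule Z_extension[OF step])
  \<comment> \<open>Here b = a_n + 2, which lies above every a_k by monotonicity.\<close>
  have core: "Z_domain n a chi \<subseteq> Z_core"
    by (rule Z_domain_core[OF assms(7)]) (use mono[of _ n] in force)
  have V_iso: "L2_norm n Msig (VE.ext f) = L2_norm n half_line f" if "f \<in> L2 n half_line" for f
    by (rule VE.ext_isometry[OF V_isometry(2) that])
  have 1: "linear_isometry (test_functions n) (H_norm n) (L2_sigma n c a) (sigma_norm n c a)
           (sigma_eq n a) (V n c a)"
    unfolding linear_isometry_def linear_op_def L2_sigma_eq H_norm_eq sigma_eq_iff
    using VE.T VE.T_lincomb V_isometry(2) by (auto simp: sigma_norm_eq)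
  have 2: "linear_isometry (H_space n) (H_norm n) (L2_sigma n c a) (sigma_norm n c a) (sigma_eq n a) VE.ext"
    unfolding linear_isometry_def linear_op_def L2_sigma_eq H_norm_eq H_space_eq sigma_eq_iff
    using VE.ext(1) VE.ext_lincomb V_iso by (auto simp: sigma_norm_eq)
  have 3: "\<forall>f\<in>test_functions n. sigma_eq n a (VE.ext f) (V n c a f)"
    unfolding sigma_eq_iff using VE.ext_on_D by blast
  have 4: "\<forall>f\<in>H_space n. of_real ((sigma_norm n c a (VE.ext f))\<^sup>2) = H_inner n f f"
    unfolding H_space_eq H_inner_eq L2_inner_self_norm
    using VE.ext(1) V_iso by (simp add: sigma_norm_eq)
  have 5: "bounded_op (L2_sigma n c a) (sigma_norm n c a) (H_space n) (H_norm n) (H_eq n) ZE.ext"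
    unfolding bounded_op_def linear_op_def L2_sigma_eq H_norm_eq H_space_eq H_eq_eq
    using ZE.ext(1) ZE.ext_lincomb ZE.ext_norm_le by (auto simp: sigma_norm_eq intro!: exI[of _ 1])
  have 6: "\<forall>G\<in>Z_domain n a chi. H_eq n (ZE.ext G) (Z n c a G)"
    unfolding H_eq_eq using ZE.ext_on_D core by blast
  have 7: "\<forall>f\<in>H_space n. \<forall>F\<in>L2_sigma n c a. sigma_eq n a F (VE.ext f) \<longrightarrow> H_eq n (ZE.ext F) f"
    unfolding H_space_eq L2_sigma_eq sigma_eq_iff H_eq_eq
  proof (intro ballI impI)
    fix f F assume f: "f \<in> L2 n half_line" and F: "F \<in> L2 n Msig" and eq: "L2_eq n Msig F (VE.ext f)"
    have norms: "L2_norm n Msig F = L2_norm n half_line f"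
      using L2_norm_cong[OF eq F VE.ext(1)[OF f]] V_iso[OF f] by simp
    have "L2_inner n half_line (ZE.ext F) f = L2_inner n Msig F (VE.ext f)"
      by (rule ext_adjoint[OF VE.L2_extension_axioms ZE.L2_extension_axioms Z_pairing(1) f F])
    \<comment> \<open>F and \<open>VE.ext f\<close> agree only almost everywhere; their difference
      has norm 0 and drops out of the inner product by Cauchy-Schwarz.\<close>
    also have "\<dots> = L2_inner n Msig F F"
    proof -
      have "L2_norm n Msig (VE.ext f \<ominus> F) = 0"
      proof -
        have "L2_eq n Msig (F \<ominus> F) (VE.ext f \<ominus> F)"
          by (intro L2_eq_lincomb eq) (simp add: L2_eq_def)
        then have "L2_norm n Msig (VE.ext f \<ominus> F) = L2_norm n Msig (F \<ominus> F)"
          by (intro L2_norm_cong[symmetric] lincomb_L2 F VE.ext f)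
        moreover have "(L2_norm n Msig (F \<ominus> F))\<^sup>2 = 0" unfolding L2_norm_square by (simp add: lincomb_def)
        ultimately show ?thesis by simp
      qed
      then have "L2_inner n Msig F (VE.ext f \<ominus> F) = 0"
        using L2_Cauchy_Schwarz[OF F lincomb_L2[OF VE.ext(1)[OF f] F, of 1 "-1"]] by simp
      then show ?thesis
        using arg_cong[OF L2_inner_lincomb[OF VE.ext(1)[OF f] F F, of 1 "-1"], of cnj] by (simp add: L2_inner_cnj)
    qed
    finally have "L2_inner n half_line (ZE.ext F) f = of_real ((L2_norm n Msig F)\<^sup>2)"
      by (simp only: L2_inner_self_norm)
    then show "L2_eq n half_line (ZE.ext F) f"
      by (rule adjoint_inverts_isometry[OF f F ZE.ext(1)[OF F] ZE.ext_norm_le[OF F] norms])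
  qed
  have "Z_domain n a chi \<subseteq> L2_sigma n c a"
    unfolding L2_sigma_eq using core Z_core_L2 by blast
  with 1 2 3 4 5 6 7 show ?thesis by blast
qed

end
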